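(* Let $S=S_{g,b}$ be a hyperbolic surface homeomorphic to a compact orientable surface of genus $g$ with $b\ge1$ boundary components (no cusps), with Fuchsian group $G=G_{g,b}\cong\pi_1(S)$. Consider any geodesic loop $\sigma\in\pi_1(S)$. Suppose that another geodesic loop $h$ separates $S$ into two surfaces $S_1,S_2$ whose interiors are disjoint. Let $\sigma(t)$ $(t\in\mathbb{R})$, $\sigma(0)=\sigma$, be a deformation of $\sigma$ by the affine twist cocycle $\mathbf{AT}_h$ under the infinitesimal deformation of Goldman–Margulis, and let $\ell_\sigma(t):=\ell(\sigma(t))$, where $\ell$ is hyperbolic translation length. Then the rate of the infinitesimal deformation of the hyperbolic length $\ell(\sigma)=\ell_\sigma(0)$ is $$\left.\frac{d\,\ell_\sigma}{dt}(t)\right|_{t=0}=2\sum_{p\in h\cap\sigma}\cos(\theta_h^\sigma)_p ,$$ where $(\theta_h^\sigma)_p$ is the angle between $h$ and $\sigma$ at $p\in S$ defined in the context.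
   Context: Lorentzian space: $\mathbb{R}_1^2$ is $\mathbb{R}^3$ with $B(x,y)=x_1y_1+x_2y_2-x_3y_3$, and $\mathrm{SO}^o(2,1)\cong\mathrm{PSL}(2,\mathbb{R})$. For hyperbolic $x\in\mathrm{SO}^o(2,1)$, $\mathbf X_x^\pm$ are the future-pointing null eigenvectors of Euclidean norm $1$ for the largest ($+$) and smallest ($-$) eigenvalue, and $\mathbf X_x^0$ is the unit spacelike eigenvector of eigenvalue $1$ with $\det(\mathbf X_x^0,\mathbf X_x^-,\mathbf X_x^+)>0$. Closed geodesics are identified with elements of $G\subset\mathrm{SO}^o(2,1)$; all nontrivial elements of $G$ are hyperbolic. A cocycle is a map $\mathbf u:G\to\mathbb{R}_1^2$ with $\mathbf u(xy)=x\,\mathbf u(y)+\mathbf u(x)$. Affine twist cocycle: let $\Sigma_i=\pi_1(S_i)$, $i=1,2$. Then $\mathbf{AT}_h$ is the cocycle on $G$ with $\mathbf{AT}_h(x)=\mathbf 0$ for $x\in\Sigma_1$, $\mathbf{AT}_h(x)=\mathbf X_h^0-x\mathbf X_h^0$ for $x\in\Sigma_2$, and determined on all other elements by the cocycle condition. Angle: for oriented geodesic loops $h_1,h_2$ crossing at $p$, $(\theta_{h_1}^{h_2})_p\in(0,\pi)$ is the angle at $p$ between the forward direction of $h_1$ and the part of $h_2$ (orientation forgotten) lying to the left of $h_1$. Goldman–Margulis infinitesimal deformation: $\mathbb{R}_1^2$ is identified with $\mathfrak{sl}_2(\mathbb{R})$, equipped with the form $\tfrac12\mathrm{tr}(XY)$,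 by the isometric $\mathrm{PSL}(2,\mathbb{R})$-equivariant isomorphism under which every hyperbolic $x$ satisfies $x=\exp\!\big(\tfrac{\ell(x)}{2}\mathbf X_x^0\big)$. A deformation of $G$ by a cocycle $\mathbf u$ is a smooth path of homomorphisms $\phi_t:G\to\mathrm{PSL}(2,\mathbb{R})$ with $\phi_0$ the inclusion and $\phi_t(x)=\exp(t\,\mathbf u(x)+O(t^2))\,x$ as $t\to0$; then $\sigma(t):=\phi_t(\sigma)$.
   Formalization: The two pieces are labelled so that S_2 lies on the left of the oriented loop h; with the opposite labelling the twist cocycle changes the sign of the derivative while the cosine sum does not change, so the stated formula fails whenever the sum is nonzero. *)

theory Defs
  imports "HOL-Analysis.Analysis" "HOL-Algebra.Group" "HOL-Library.Landau_Symbols"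
begin

section \<open>Lorentzian space and hyperbolic isometries\<close>

definition lor :: "real^3 \<Rightarrow> real^3 \<Rightarrow> real"
  where "lor x y = x$1 * y$1 + x$2 * y$2 - x$3 * y$3"

text \<open>The identity component of SO(2,1) consists of the isometries of determinant 1 that
  preserve the future direction, i.e. whose (3,3) entry is positive.\<close>

definition SO21 :: "(real^3^3) monoid"
  where "SO21 = \<lparr>carrier = {A. (\<forall>x y. lor (A *v x) (A *v y) = lor x y) \<and> det A = 1 \<and> A$3$3 > 0},
                 mult = (**), one = mat 1\<rparr>"

definition H2 :: "(real^3) set"
  where "H2 = {z. lor z z = -1 \<and> z$3 > 0}"

definition hdist :: "real^3 \<Rightarrow> real^3 \<Rightarrow> real"
  where "hdist z w = arcosh (- lor z w)"

definition tlen :: "real^3^3 \<Rightarrow> real"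
  where "tlen x = (INF z\<in>H2. hdist z (x *v z))"

definition eigenvalues :: "real^3^3 \<Rightarrow> real set"
  where "eigenvalues x = {c. \<exists>v. v \<noteq> 0 \<and> x *v v = c *\<^sub>R v}"

definition hyperbolic :: "real^3^3 \<Rightarrow> bool"
  where "hyperbolic x \<longleftrightarrow> x \<in> carrier SO21 \<and> card (eigenvalues x) = 3"

definition Xplus :: "real^3^3 \<Rightarrow> real^3"
  where "Xplus x = (THE v. x *v v = Max (eigenvalues x) *\<^sub>R v \<and> lor v v = 0 \<and> v$3 > 0 \<and> norm v = 1)"

definition Xminus :: "real^3^3 \<Rightarrow> real^3"
  where "Xminus x = (THE v. x *v v = Min (eigenvalues x) *\<^sub>R v \<and> lor v v = 0 \<and> v$3 > 0 \<and> norm v = 1)"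

definition det3 :: "real^3 \<Rightarrow> real^3 \<Rightarrow> real^3 \<Rightarrow> real"
  where "det3 u v w = det (vector [u, v, w] :: real^3^3)"

definition Xzero :: "real^3^3 \<Rightarrow> real^3"
  where "Xzero x = (THE v. x *v v = v \<and> lor v v = 1 \<and> det3 v (Xminus x) (Xplus x) > 0)"

section \<open>Geodesics, sides and angles\<close>

text \<open>Unit-speed parametrization of the axis of a hyperbolic \<open>x\<close>, running from the ideal
  endpoint \<open>Xminus x\<close> to \<open>Xplus x\<close>, so that \<open>x *v axis_path x s = axis_path x (s + tlen x)\<close>.\<close>

definition axis_path :: "real^3^3 \<Rightarrow> real \<Rightarrow> real^3"
  where "axis_path x s =
    (1 / sqrt (- 2 * lor (Xplus x) (Xminus x))) *\<^sub>R (exp s *\<^sub>R Xplus x + exp (- s) *\<^sub>R Xminus x)"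

definition geod_axis :: "real^3^3 \<Rightarrow> (real^3) set"
  where "geod_axis x = range (axis_path x)"

definition forward :: "real^3^3 \<Rightarrow> real^3 \<Rightarrow> real^3"
  where "forward x z = vector_derivative (axis_path x) (at (THE s. axis_path x s = z))"

text \<open>The hyperboloid is oriented by its projection to the standardly oriented
  \<open>(x\<^sub>1, x\<^sub>2)\<close>-plane.  A point, or a tangent vector at a point of the axis, is on the left of
  the oriented axis of \<open>x\<close> iff its determinant with \<open>Xminus x\<close>, \<open>Xplus x\<close> is positive; for
  instance \<open>(0, 1, 0)\<close> is on the left of the axis from \<open>(-1, 0, 1)\<close> to \<open>(1, 0, 1)\<close>.\<close>

definition on_left :: "real^3^3 \<Rightarrow> real^3 \<Rightarrow> bool"
  where "on_left x w \<longleftrightarrow> det3 w (Xminus x) (Xplus x) > 0"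

text \<open>The angle at a crossing point \<open>z\<close> of the axes of \<open>k\<close> and \<open>x\<close>, between the forward
  direction of \<open>k\<close> and the half of the axis of \<open>x\<close> lying to the left of \<open>k\<close>.\<close>

definition crossing_angle :: "real^3^3 \<Rightarrow> real^3^3 \<Rightarrow> real^3 \<Rightarrow> real"
  where "crossing_angle k x z =
    arccos (lor (forward k z) (if on_left k (forward x z) then forward x z else - forward x z))"

section \<open>The hyperbolic surface of a Fuchsian group\<close>

text \<open>The geodesic segment between \<open>z\<close> and \<open>w\<close> is the part of the hyperboloid in the cone
  spanned by \<open>z\<close> and \<open>w\<close>.\<close>

definition hyp_convex :: "(real^3) set \<Rightarrow> bool"
  where "hyp_convex C \<longleftrightarrow> C \<subseteq> H2 \<and>
    (\<forall>z\<in>C. \<forall>w\<in>C. \<forall>a\<ge>0. \<forall>b\<ge>0. a *\<^sub>R z + b *\<^sub>R w \<in> H2 \<longrightarrow> a *\<^sub>R z + b *\<^sub>R w \<in> C)"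

definition nielsen_region :: "(real^3^3) set \<Rightarrow> (real^3) set"
  where "nielsen_region G =
    \<Inter>{C. C \<noteq> {} \<and> closed C \<and> hyp_convex C \<and> (\<forall>x\<in>G. \<forall>z\<in>C. x *v z \<in> C)}"

definition quotient_by :: "('a \<Rightarrow> 'b) \<Rightarrow> 'a topology \<Rightarrow> 'b topology"
  where "quotient_by f X =
    topology (\<lambda>U. U \<subseteq> f ` topspace X \<and> openin X {x \<in> topspace X. f x \<in> U})"

lemma openin_quotient_by:
  "openin (quotient_by f X) U \<longleftrightarrow>
     U \<subseteq> f ` topspace X \<and> openin X {x \<in> topspace X. f x \<in> U}"
proof -
  have "istopology (\<lambda>U. U \<subseteq> f ` topspace X \<and> openin X {x \<in> topspace X. f x \<in> U})"
    unfolding istopology_def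
  proof (intro conjI allI impI)
    fix S T
    assume *: "S \<subseteq> f ` topspace X \<and> openin X {x \<in> topspace X. f x \<in> S}"
      "T \<subseteq> f ` topspace X \<and> openin X {x \<in> topspace X. f x \<in> T}"
    show "S \<inter> T \<subseteq> f ` topspace X" using * by blast
    have "{x \<in> topspace X. f x \<in> S \<inter> T} =
      {x \<in> topspace X. f x \<in> S} \<inter> {x \<in> topspace X. f x \<in> T}" by blast
    then show "openin X {x \<in> topspace X. f x \<in> S \<inter> T}" using * by (simp add: openin_Int)
  next
    fix \<K>
    assume *: "\<forall>K\<in>\<K>. K \<subseteq> f ` topspace X \<and> openin X {x \<in> topspace X. f x \<in> K}"
    show "\<Union>\<K> \<subseteq> f ` topspace X" using * by blast
    have "{x \<in> topspace X. f x \<in> \<Union>\<K>} = \<Union>((\<lambda>K. {x \<in> topspace X. f x \<in> K}) ` \<K>)" by blast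
    then show "openin X {x \<in> topspace X. f x \<in> \<Union>\<K>}" using * by auto
  qed
  then show ?thesis by (simp add: quotient_by_def)
qed

lemma topspace_quotient_by: "topspace (quotient_by f X) = f ` topspace X"
proof
  show "topspace (quotient_by f X) \<subseteq> f ` topspace X"
    by (metis openin_quotient_by openin_topspace)
  have "{x \<in> topspace X. f x \<in> f ` topspace X} = topspace X" by blast
  then have "openin (quotient_by f X) (f ` topspace X)"
    by (simp add: openin_quotient_by)
  then show "f ` topspace X \<subseteq> topspace (quotient_by f X)" by (rule openin_subset)
qed

lemma quotient_map_quotient_by: "quotient_map X (quotient_by f X) f"
  by (auto simp: quotient_map_def topspace_quotient_by openin_quotient_by)

definition orbit :: "(real^3^3) set \<Rightarrow> real^3 \<Rightarrow> (real^3) set"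
  where "orbit G z = (\<lambda>x. x *v z) ` G"

definition surface :: "(real^3^3) set \<Rightarrow> (real^3) set topology"
  where "surface G = quotient_by (orbit G) (top_of_set (nielsen_region G))"

text \<open>The compact orientable surface of genus \<open>g\<close> with \<open>b\<close> boundary components is the closed
  disc, viewed as a polygon with \<open>4 * g + 3 * b\<close> edges, glued according to the boundary word
  \<open>\<Prod>\<^sub>i a\<^sub>i b\<^sub>i a\<^sub>i\<inverse> b\<^sub>i\<inverse> \<Prod>\<^sub>j d\<^sub>j c\<^sub>j d\<^sub>j\<inverse>\<close>; the edges
  \<open>c\<^sub>j\<close> stay free and become the boundary circles.\<close>

definition poly_edge :: "nat \<Rightarrow> nat \<Rightarrow> real \<Rightarrow> complex"
  where "poly_edge N k s = cis (2 * pi * (real k + s) / real N)"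

definition edge_pairing :: "nat \<Rightarrow> nat \<Rightarrow> (complex \<times> complex) set"
  where "edge_pairing g b = (let e = poly_edge (4 * g + 3 * b) in
     {(e (4 * i) s, e (4 * i + 2) (1 - s)) | i s. i < g \<and> s \<in> {0..1}} \<union>
     {(e (4 * i + 1) s, e (4 * i + 3) (1 - s)) | i s. i < g \<and> s \<in> {0..1}} \<union>
     {(e (4 * g + 3 * j) s, e (4 * g + 3 * j + 2) (1 - s)) | j s. j < b \<and> s \<in> {0..1}})"

definition model_surface :: "nat \<Rightarrow> nat \<Rightarrow> complex set topology"
  where "model_surface g b =
    quotient_by (\<lambda>z. (edge_pairing g b \<union> (edge_pairing g b)\<inverse>)\<^sup>* `` {z}) (top_of_set (cball 0 1))"

definition surface_group :: "nat \<Rightarrow> nat \<Rightarrow> (real^3^3) set \<Rightarrow> bool"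
  where "surface_group g b G \<longleftrightarrow>
     subgroup G SO21 \<and> discrete G \<and> (\<forall>x\<in>G. x \<noteq> mat 1 \<longrightarrow> hyperbolic x) \<and>
     surface G homeomorphic_space model_surface g b"

section \<open>Separating geodesics and the affine twist\<close>

definition loop_image :: "(real^3^3) set \<Rightarrow> real^3^3 \<Rightarrow> (real^3) set set"
  where "loop_image G x = orbit G ` geod_axis x"

definition simple_loop :: "(real^3^3) set \<Rightarrow> real^3^3 \<Rightarrow> bool"
  where "simple_loop G h \<longleftrightarrow>
     (\<forall>x\<in>G. (\<lambda>z. x *v z) ` geod_axis h = geod_axis h \<or> (\<lambda>z. x *v z) ` geod_axis h \<inter> geod_axis h = {})"

definition separates_into ::
    "(real^3^3) set \<Rightarrow> real^3^3 \<Rightarrow> (real^3) set set \<Rightarrow> (real^3) set set \<Rightarrow> bool"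
  where "separates_into G h S1 S2 \<longleftrightarrow> simple_loop G h \<and>
     (\<exists>C1 C2. C1 \<noteq> C2 \<and>
        connected_components_of (subtopology (surface G) (topspace (surface G) - loop_image G h)) = {C1, C2} \<and>
        S1 = surface G closure_of C1 \<and> S2 = surface G closure_of C2) \<and>
     surface G interior_of S1 \<inter> surface G interior_of S2 = {}"

text \<open>\<open>T\<close> lies locally on the left of \<open>h\<close>.  Exchanging the roles of the two sides changes the
  sign of the affine twist, so the two pieces have to be labelled.\<close>

definition lies_left :: "(real^3^3) set \<Rightarrow> real^3^3 \<Rightarrow> (real^3) set set \<Rightarrow> bool"
  where "lies_left G h T \<longleftrightarrow>
     (\<forall>z\<in>geod_axis h. \<forall>\<^sub>F w in at z within {w \<in> nielsen_region G. on_left h w}. orbit G w \<in> T)"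

text \<open>The image of the fundamental group of a subsurface \<open>T\<close> in that of the surface, at the
  base point \<open>orbit G z\<close>, the latter group being identified with the deck group \<open>G\<close>: a loop
  corresponds to \<open>x\<close> iff its lift starting at \<open>z\<close> ends at \<open>x *v z\<close>.\<close>

definition subsurface_group :: "(real^3^3) set \<Rightarrow> real^3 \<Rightarrow> (real^3) set set \<Rightarrow> (real^3^3) set"
  where "subsurface_group G z T =
     {x \<in> G. \<exists>\<gamma>. path \<gamma> \<and> path_image \<gamma> \<subseteq> {w \<in> nielsen_region G. orbit G w \<in> T} \<and>
        pathstart \<gamma> = z \<and> pathfinish \<gamma> = x *v z}"

definition cocycle :: "(real^3^3) set \<Rightarrow> (real^3^3 \<Rightarrow> real^3) \<Rightarrow> bool"
  where "cocycle G u \<longleftrightarrow> (\<forall>x\<in>G. \<forall>y\<in>G. u (x ** y) = x *v u y + u x)"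

definition affine_twist ::
    "(real^3^3) set \<Rightarrow> (real^3^3) set \<Rightarrow> (real^3^3) set \<Rightarrow> real^3^3 \<Rightarrow> (real^3^3 \<Rightarrow> real^3) \<Rightarrow> bool"
  where "affine_twist G \<Sigma>1 \<Sigma>2 h u \<longleftrightarrow> cocycle G u \<and>
     (\<forall>x\<in>\<Sigma>1. u x = 0) \<and> (\<forall>x\<in>\<Sigma>2. u x = Xzero h - x *v Xzero h)"

section \<open>Goldman--Margulis infinitesimal deformations\<close>

definition SL2R :: "(real^2^2) monoid"
  where "SL2R = \<lparr>carrier = {A. det A = 1}, mult = (**), one = mat 1\<rparr>"

definition mexp :: "real^'n^'n \<Rightarrow> real^'n^'n"
  where "mexp A = (\<Sum>k. (1 / fact k) *\<^sub>R (((**) A) ^^ k) (mat 1))"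

text \<open>\<open>\<rho>\<close> induces the isomorphism of PSL(2,R) with the isometry group, and \<open>J\<close> is the
  corresponding identification of Lorentzian space with the trace-free matrices.\<close>

definition gm_identification :: "(real^2^2 \<Rightarrow> real^3^3) \<Rightarrow> (real^3 \<Rightarrow> real^2^2) \<Rightarrow> bool"
  where "gm_identification \<rho> J \<longleftrightarrow>
     \<rho> \<in> hom SL2R SO21 \<and> \<rho> ` carrier SL2R = carrier SO21 \<and>
     (\<forall>A\<in>carrier SL2R. \<rho> A = mat 1 \<longleftrightarrow> A = mat 1 \<or> A = - mat 1) \<and>
     linear J \<and> bij_betw J UNIV {X. trace X = 0} \<and>
     (\<forall>v w. trace (J v ** J w) / 2 = lor v w) \<and>
     (\<forall>A\<in>carrier SL2R. \<forall>v. J (\<rho> A *v v) = A ** J v ** matrix_inv A) \<and>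
     (\<forall>x. hyperbolic x \<longrightarrow> x = \<rho> (mexp ((tlen x / 2) *\<^sub>R J (Xzero x))))"

definition smooth_curve :: "(real \<Rightarrow> 'a::real_normed_vector) \<Rightarrow> bool"
  where "smooth_curve f \<longleftrightarrow>
     (\<exists>D :: nat \<Rightarrow> real \<Rightarrow> 'a. D 0 = f \<and> (\<forall>n t. (D n has_vector_derivative D (Suc n) t) (at t)))"

definition gm_deformation ::
    "(real^2^2 \<Rightarrow> real^3^3) \<Rightarrow> (real^3 \<Rightarrow> real^2^2) \<Rightarrow> (real^3^3) set \<Rightarrow> (real^3^3 \<Rightarrow> real^3) \<Rightarrow>
     (real \<Rightarrow> real^3^3 \<Rightarrow> real^3^3) \<Rightarrow> bool"
  where "gm_deformation \<rho> J G u \<phi> \<longleftrightarrow>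
     (\<forall>t. \<phi> t \<in> hom (SO21\<lparr>carrier := G\<rparr>) SO21) \<and>
     (\<forall>x\<in>G. \<phi> 0 x = x) \<and>
     (\<forall>x\<in>G. smooth_curve (\<lambda>t. \<phi> t x)) \<and>
     (\<forall>x\<in>G. \<exists>r :: real \<Rightarrow> real^3. (\<lambda>t. norm (r t)) \<in> O[at 0](\<lambda>t. t^2) \<and>
        (\<forall>\<^sub>F t in at 0. \<phi> t x = \<rho> (mexp (J (t *\<^sub>R u x + r t))) ** x))"

section \<open>Crossings of closed geodesics\<close>

text \<open>The crossings of the closed geodesic \<open>\<sigma>\<close>, traversed once over the parameter interval
  from 0 to its length, with the geodesic \<open>h\<close>.  A crossing is recorded by its parameter \<open>s\<close> and
  by the conjugate \<open>k\<close> of \<open>h\<close> whose axis is met there in the universal cover, so that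
  a point of the surface through which \<open>\<sigma>\<close> passes several times is counted once for
  each passage, with the angle of that passage.\<close>

definition crossings :: "(real^3^3) set \<Rightarrow> real^3^3 \<Rightarrow> real^3^3 \<Rightarrow> (real \<times> (real^3^3)) set"
  where "crossings G h \<sigma> =
     {(s, k). 0 \<le> s \<and> s < tlen \<sigma> \<and> k \<in> {x ** h ** matrix_inv x | x. x \<in> G} \<and>
        axis_path \<sigma> s \<in> geod_axis k \<and> geod_axis k \<noteq> geod_axis \<sigma>}"

end

theory Submission
  imports Defs
begin

text \<open>Writing \<open>\<phi>\<^sub>t(\<sigma>) = \<rho>(A\<^sub>t) \<sigma>\<close> and using that the adjoint representation has trace
  \<open>(tr A)\<^sup>2 - 1\<close>, the derivative of the length is twice the Lorentzian product of \<open>u \<sigma>\<close> with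
  \<open>Xzero \<sigma>\<close>.  The affine twist cocycle is the coboundary of a vector-valued step function on the
  complement of the lifts of \<open>h\<close>, which jumps by \<open>Xzero k\<close> when the axis of a lift \<open>k\<close> is crossed
  from right to left.  Along one period of the axis of \<open>\<sigma>\<close> the product of this function with
  \<open>Xzero \<sigma>\<close> changes by the product of \<open>u \<sigma>\<close> with \<open>Xzero \<sigma>\<close>; on the other hand it changes by the sum of
  its jumps, and the product of the unit normals of two crossing axes is the cosine of their angle.\<close>

section \<open>The Lorentzian form\<close>

text \<open>The cocycle is prescribed only on the groups of the two pieces, yet no amalgam
  decomposition of \<open>G\<close> enters. On each of these groups it is a coboundary, of 0 and of
  \<open>Xzero h\<close> respectively, and this is exactly what makes the step function well defined
  on a region reached from several translates of the base point. As \<open>z0\<close> lies on the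
  axis of \<open>h\<close>, it belongs to the preimages of both closed pieces, so both values can be
  compared there; translating by \<open>G\<close> carries the comparison to every other lift. The
  obstacle is topological. Separation is a statement about components of the quotient, whereas a
  jump requires knowing which piece lies on which side of each lift. Connectedness of the Nielsen
  region makes both pieces accumulate at the axis of \<open>h\<close>; local finiteness of the lifts
  and convexity spread this along the whole axis. The factor 2 stems from the normalisation of the
  identification, under which the exponential of \<open>s\<close> times \<open>Xzero x\<close>
  translates by \<open>2 * s\<close>.\<close>

lemma lor_add_left: "lor (x + y) z = lor x z + lor y z"
  and lor_add_right: "lor z (x + y) = lor z x + lor z y"
  and lor_diff_left: "lor (x - y) z = lor x z - lor y z"
  and lor_diff_right: "lor z (x - y) = lor z x - lor z y"
  and lor_scale_left: "lor (c *\<^sub>R x) z = c * lor x z"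
  and lor_scale_right: "lor z (c *\<^sub>R x) = c * lor z x"
  and lor_minus_left: "lor (- x) z = - lor x z"
  and lor_minus_right: "lor z (- x) = - lor z x"
  and lor_zero_left: "lor 0 z = 0"
  and lor_zero_right: "lor z 0 = 0"
  by (simp_all add: lor_def algebra_simps)

lemmas lor_simps = lor_add_left lor_add_right lor_diff_left lor_diff_right lor_scale_left
  lor_scale_right lor_minus_left lor_minus_right lor_zero_left lor_zero_right

lemma lor_sym: "lor x y = lor y x"
  by (simp add: lor_def algebra_simps)

lemma vec3_eq_iff: "(x::real^3) = y \<longleftrightarrow> x$1 = y$1 \<and> x$2 = y$2 \<and> x$3 = y$3"
  by (simp add: vec_eq_iff forall_3)

lemma lor_eqI:
  assumes "\<And>y. lor x y = lor x' y"
  shows "x = x'"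
  using assms[of "axis 1 1"] assms[of "axis 2 1"] assms[of "axis 3 1"]
  by (simp add: vec3_eq_iff lor_def axis_def)

lemma continuous_on_lor [continuous_intros]:
  "continuous_on S f \<Longrightarrow> continuous_on S g \<Longrightarrow> continuous_on S (\<lambda>x. lor (f x) (g x))"
  unfolding lor_def by (intro continuous_intros)

lemma tendsto_lor [tendsto_intros]:
  "(f \<longlongrightarrow> a) F \<Longrightarrow> (g \<longlongrightarrow> b) F \<Longrightarrow> ((\<lambda>x. lor (f x) (g x)) \<longlongrightarrow> lor a b) F"
  unfolding lor_def by (intro tendsto_intros)

lemma det3_explicit:
  "det3 u v w = u$1 * v$2 * w$3 + u$2 * v$3 * w$1 + u$3 * v$1 * w$2
     - u$1 * v$3 * w$2 - u$2 * v$1 * w$3 - u$3 * v$2 * w$1"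
  unfolding det3_def det_3 by (simp add: algebra_simps)

lemma det3_nondegenerate:
  assumes "det3 a b c \<noteq> 0" "lor d a = 0" "lor d b = 0" "lor d c = 0"
  shows "d = 0"
proof -
  \<comment> \<open>Cramer's rule, with the cofactors of the matrix with rows \<open>a\<close>,
    \<open>b\<close>, \<open>c\<close>. The third identity carries an extra sign because
    \<open>lor\<close> is negative in that coordinate.\<close>
  have "det3 a b c * d$1 = (b$2 * c$3 - b$3 * c$2) * lor d a + (a$3 * c$2 - a$2 * c$3) * lor d b
      + (a$2 * b$3 - a$3 * b$2) * lor d c"
    by (simp add: det3_explicit lor_def algebra_simps)
  moreover have "det3 a b c * d$2 = (b$3 * c$1 - b$1 * c$3) * lor d a + (a$1 * c$3 - a$3 * c$1) * lor d b
      + (a$3 * b$1 - a$1 * b$3) * lor d c"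
    by (simp add: det3_explicit lor_def algebra_simps)
  moreover have "det3 a b c * d$3 = - ((b$1 * c$2 - b$2 * c$1) * lor d a + (a$2 * c$1 - a$1 * c$2) * lor d b
      + (a$1 * b$2 - a$2 * b$1) * lor d c)"
    by (simp add: det3_explicit lor_def algebra_simps)
  ultimately show ?thesis using assms by (simp add: vec3_eq_iff)
qed

text \<open>The product of two determinants is the determinant of the matrix of all pairings, up to
  the determinant -1 of diag(1, 1, -1). Determinants of frames are thereby known up to sign.\<close>

lemma det3_gram:
  "det3 a b c * det3 a' b' c' =
    - (lor a a' * (lor b b' * lor c c' - lor b c' * lor c b')
     - lor a b' * (lor b a' * lor c c' - lor b c' * lor c a')
     + lor a c' * (lor b a' * lor c b' - lor b b' * lor c a'))"
  unfolding det3_explicit lor_def by (simp add: algebra_simps)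

section \<open>Isometries\<close>

lemma SO21_carrier:
  "A \<in> carrier SO21 \<longleftrightarrow> (\<forall>x y. lor (A *v x) (A *v y) = lor x y) \<and> det A = 1 \<and> A$3$3 > 0"
  by (simp add: SO21_def)

lemma SO21_mult [simp]: "x \<otimes>\<^bsub>SO21\<^esub> y = x ** y" and SO21_one [simp]: "\<one>\<^bsub>SO21\<^esub> = mat 1"
  by (simp_all add: SO21_def)

lemma SO21_lor: "A \<in> carrier SO21 \<Longrightarrow> lor (A *v x) (A *v y) = lor x y"
  by (simp add: SO21_carrier)

text \<open>The adjoint with respect to \<open>lor\<close>. On \<open>SO21\<close> it is the
  inverse, in a form that is visibly continuous in the entries.\<close>

definition ladj :: "real^3^3 \<Rightarrow> real^3^3"
  where "ladj A = (\<chi> i j. (if i = 3 then -1 else 1) * (if j = 3 then -1 else 1) * A$j$i)"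

lemma ladj_nth: "ladj A $ i $ j = (if i = 3 then -1 else 1) * (if j = 3 then -1 else 1) * A$j$i"
  by (simp add: ladj_def)

lemma mv3: "((A::real^3^3) *v x)$i = A$i$1 * x$1 + A$i$2 * x$2 + A$i$3 * x$3"
  by (simp add: matrix_vector_mult_def sum_3)

lemma lor_ladj: "lor (ladj A *v x) y = lor x (A *v y)"
  by (simp add: lor_def mv3 ladj_nth algebra_simps)

lemma ladj_mult:
  assumes "A \<in> carrier SO21"
  shows "ladj A ** A = mat 1" "A ** ladj A = mat 1"
proof -
  have "(ladj A ** A) *v x = mat 1 *v x" for x
    by (rule lor_eqI) (simp add: matrix_vector_mul_assoc[symmetric] lor_ladj SO21_lor[OF assms])
  then show "ladj A ** A = mat 1" by (metis matrix_eq)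
  then show "A ** ladj A = mat 1" using matrix_left_right_inverse by blast
qed

lemma ladj_vec:
  assumes "A \<in> carrier SO21"
  shows "ladj A *v (A *v x) = x" "A *v (ladj A *v x) = x"
  by (simp_all add: matrix_vector_mul_assoc ladj_mult[OF assms])

lemma matrix_inv_eqI:
  fixes A B :: "real^'n^'n"
  assumes "A ** B = mat 1" "B ** A = mat 1"
  shows "matrix_inv A = B"
proof -
  have *: "A ** matrix_inv A = mat 1 \<and> matrix_inv A ** A = mat 1"
    unfolding matrix_inv_def by (rule someI[of _ B]) (use assms in simp)
  have "matrix_inv A = matrix_inv A ** (A ** B)" using assms by simp
  also have "\<dots> = B" using * by (simp add: matrix_mul_assoc)
  finally show ?thesis .
qed

lemma matrix_inv_SO21: "A \<in> carrier SO21 \<Longrightarrow> matrix_inv A = ladj A"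
  by (intro matrix_inv_eqI ladj_mult)

section \<open>Causal inequalities for timelike and null vectors\<close>

lemma cauchy_schwarz_2:
  fixes a b c d :: real
  shows "(a * c + b * d)\<^sup>2 \<le> (a\<^sup>2 + b\<^sup>2) * (c\<^sup>2 + d\<^sup>2)"
proof -
  have "(a\<^sup>2 + b\<^sup>2) * (c\<^sup>2 + d\<^sup>2) - (a * c + b * d)\<^sup>2 = (a * d - b * c)\<^sup>2" by algebra
  then show ?thesis using zero_le_power2[of "a * d - b * c"] by linarith
qed

lemma future_lor_nonpos:
  assumes "lor u u \<le> 0" "u$3 > 0" "lor v v \<le> 0" "v$3 > 0"
  shows "lor u v \<le> 0"
proof -
  have u: "(u$1)\<^sup>2 + (u$2)\<^sup>2 \<le> (u$3)\<^sup>2" and v: "(v$1)\<^sup>2 + (v$2)\<^sup>2 \<le> (v$3)\<^sup>2"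
    using assms by (simp_all add: lor_def power2_eq_square)
  have "(u$1 * v$1 + u$2 * v$2)\<^sup>2 \<le> ((u$1)\<^sup>2 + (u$2)\<^sup>2) * ((v$1)\<^sup>2 + (v$2)\<^sup>2)" by (rule cauchy_schwarz_2)
  also have "\<dots> \<le> (u$3)\<^sup>2 * (v$3)\<^sup>2" using u v by (intro mult_mono) auto
  finally have "(u$1 * v$1 + u$2 * v$2)\<^sup>2 \<le> (u$3 * v$3)\<^sup>2" by (simp add: power_mult_distrib)
  then have "u$1 * v$1 + u$2 * v$2 \<le> u$3 * v$3" by (rule power2_le_imp_le) (use assms in auto)
  then show ?thesis by (simp add: lor_def)
qed

lemma future_lor_neg:
  assumes "lor u u < 0" "u$3 > 0" "lor v v \<le> 0" "v$3 > 0"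
  shows "lor u v < 0"
proof -
  have u: "(u$1)\<^sup>2 + (u$2)\<^sup>2 < (u$3)\<^sup>2" and v: "(v$1)\<^sup>2 + (v$2)\<^sup>2 \<le> (v$3)\<^sup>2"
    using assms by (simp_all add: lor_def power2_eq_square)
  have "(u$1 * v$1 + u$2 * v$2)\<^sup>2 \<le> ((u$1)\<^sup>2 + (u$2)\<^sup>2) * ((v$1)\<^sup>2 + (v$2)\<^sup>2)" by (rule cauchy_schwarz_2)
  also have "\<dots> \<le> ((u$1)\<^sup>2 + (u$2)\<^sup>2) * (v$3)\<^sup>2" using v by (intro mult_left_mono) auto
  also have "\<dots> < (u$3)\<^sup>2 * (v$3)\<^sup>2" using u assms by (intro mult_strict_right_mono) auto
  finally have "(u$1 * v$1 + u$2 * v$2)\<^sup>2 < (u$3 * v$3)\<^sup>2" by (simp add: power_mult_distrib)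
  then have "u$1 * v$1 + u$2 * v$2 < u$3 * v$3" by (rule power2_less_imp_less) (use assms in auto)
  then show ?thesis by (simp add: lor_def)
qed

text \<open>The complement of a timelike vector is positive definite: orthogonality expresses
  \<open>t$3 * e$3\<close> by the planar parts, Cauchy-Schwarz bounds it, and the planar part of
  \<open>t\<close> is shorter than its third coordinate.\<close>

lemma spacelike_of_orthogonal:
  assumes "lor t t < 0" "lor t e = 0" "e \<noteq> 0"
  shows "lor e e > 0"
proof -
  have t: "(t$1)\<^sup>2 + (t$2)\<^sup>2 < (t$3)\<^sup>2" using assms by (simp add: lor_def power2_eq_square)
  have eq: "t$1 * e$1 + t$2 * e$2 = t$3 * e$3" using assms by (simp add: lor_def)
  have "t$3 \<noteq> 0"
  proof
    assume "t$3 = 0"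
    then have "(t$1)\<^sup>2 + (t$2)\<^sup>2 < 0" using t by simp
    then show False using sum_power2_ge_zero[of "t$1" "t$2"] by linarith
  qed
  have ne: "(e$1)\<^sup>2 + (e$2)\<^sup>2 > 0"
  proof (rule ccontr)
    assume "\<not> ?thesis"
    then have "e$1 = 0 \<and> e$2 = 0" by (simp only: sum_power2_gt_zero_iff) blast
    with eq \<open>t$3 \<noteq> 0\<close> have "e = 0" by (simp add: vec3_eq_iff)
    with assms show False by simp
  qed
  have "(t$3)\<^sup>2 * (e$3)\<^sup>2 = (t$1 * e$1 + t$2 * e$2)\<^sup>2" using eq by (simp add: power_mult_distrib)
  also have "\<dots> \<le> ((t$1)\<^sup>2 + (t$2)\<^sup>2) * ((e$1)\<^sup>2 + (e$2)\<^sup>2)" by (rule cauchy_schwarz_2)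
  also have "\<dots> < (t$3)\<^sup>2 * ((e$1)\<^sup>2 + (e$2)\<^sup>2)" using t ne by (rule mult_strict_right_mono)
  finally have "(e$3)\<^sup>2 < (e$1)\<^sup>2 + (e$2)\<^sup>2" using \<open>t$3 \<noteq> 0\<close> by simp
  then show ?thesis by (simp add: lor_def power2_eq_square)
qed

lemma H2_iff: "z \<in> H2 \<longleftrightarrow> lor z z = -1 \<and> z$3 > 0"
  by (simp add: H2_def)

lemma e3_H2: "axis 3 1 \<in> H2"
  by (simp add: H2_iff lor_def axis_def)

lemma lor_e3: "lor (axis 3 1) v = - v$3"
  by (simp add: lor_def axis_def)

section \<open>Closure properties of \<open>SO21\<close> and preservation of the future\<close>

lemma ladj_SO21:
  assumes "A \<in> carrier SO21" shows "ladj A \<in> carrier SO21"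
proof -
  have "lor (ladj A *v x) (ladj A *v y) = lor x y" for x y
    by (simp add: lor_ladj ladj_vec[OF assms])
  moreover have "det (ladj A) = 1"
    by (metis assms SO21_carrier det_I det_mul ladj_mult(1) mult.right_neutral)
  ultimately show ?thesis using assms by (simp add: SO21_carrier ladj_nth)
qed

text \<open>\<open>SO21\<close> only asks for a positive (3,3) entry. Moving \<open>A\<close> across
  the form turns the third coordinate of \<open>A *v v\<close> into a pairing of \<open>v\<close>
  with \<open>ladj A *v axis 3 1\<close>, a timelike vector whose third coordinate is that
  entry.\<close>

lemma SO21_future:
  assumes A: "A \<in> carrier SO21" and "lor v v \<le> 0" "v$3 > 0"
  shows "(A *v v)$3 > 0"
proof -
  have B: "ladj A \<in> carrier SO21" by (rule ladj_SO21[OF A])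
  let ?w = "ladj A *v axis 3 1"
  have "lor ?w ?w < 0" by (simp add: SO21_lor[OF B] lor_e3)
  moreover have "(ladj A *v axis 3 1)$3 > 0"
    using B by (simp add: mv3 axis_def SO21_carrier)
  ultimately have "lor ?w v < 0" using assms(2,3) by (rule future_lor_neg)
  then show ?thesis by (simp add: lor_ladj lor_e3)
qed

lemma SO21_H2: "A \<in> carrier SO21 \<Longrightarrow> z \<in> H2 \<Longrightarrow> A *v z \<in> H2"
  using SO21_future[of A z] by (auto simp: H2_iff SO21_lor)

lemma SO21_mult_closed:
  assumes "A \<in> carrier SO21" "B \<in> carrier SO21" shows "A ** B \<in> carrier SO21"
proof -
  have "((A ** B) *v axis 3 1)$3 > 0"
    using SO21_H2[OF assms(1) SO21_H2[OF assms(2) e3_H2]]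
    by (simp add: H2_iff matrix_vector_mul_assoc)
  then have "(A ** B)$3$3 > 0" by (simp add: mv3 axis_def)
  then show ?thesis using assms
    by (simp add: SO21_carrier det_mul matrix_vector_mul_assoc[symmetric])
qed

lemma det3_mv: "det3 (A *v u) (A *v v) (A *v w) = det A * det3 u v w"
proof -
  have "vector [A *v u, A *v v, A *v w] = (vector [u, v, w] :: real^3^3) ** transpose A"
    by (simp add: vec_eq_iff forall_3 matrix_matrix_mult_def transpose_def sum_3 mv3 algebra_simps)
  then show ?thesis unfolding det3_def by (simp add: det_mul)
qed

lemma det3_SO21: "A \<in> carrier SO21 \<Longrightarrow> det3 (A *v u) (A *v v) (A *v w) = det3 u v w"
  by (simp add: det3_mv SO21_carrier)

lemma inv_SO21:
  assumes "A \<in> carrier SO21" shows "inv\<^bsub>SO21\<^esub> A = ladj A"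
  unfolding m_inv_def
proof (rule the_equality)
  show "ladj A \<in> carrier SO21 \<and> A \<otimes>\<^bsub>SO21\<^esub> ladj A = \<one>\<^bsub>SO21\<^esub> \<and> ladj A \<otimes>\<^bsub>SO21\<^esub> A = \<one>\<^bsub>SO21\<^esub>"
    using assms by (simp add: ladj_SO21 ladj_mult)
  fix y assume "y \<in> carrier SO21 \<and> A \<otimes>\<^bsub>SO21\<^esub> y = \<one>\<^bsub>SO21\<^esub> \<and> y \<otimes>\<^bsub>SO21\<^esub> A = \<one>\<^bsub>SO21\<^esub>"
  then show "y = ladj A" using assms matrix_inv_eqI matrix_inv_SO21 by (metis SO21_mult SO21_one)
qed

section \<open>Eigenframes of hyperbolic isometries\<close>

text \<open>An eigenbasis adapted to the form, with null vectors of arbitrary length. Any such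
  frame, however found, determines the definite descriptions \<open>Xplus\<close>,
  \<open>Xminus\<close>, \<open>Xzero\<close> and the translation length \<open>ln l\<close>, so for
  a conjugate or a given trace it suffices to exhibit one.\<close>

definition hframe :: "real^3^3 \<Rightarrow> real \<Rightarrow> real^3 \<Rightarrow> real^3 \<Rightarrow> real^3 \<Rightarrow> bool"
  where "hframe x l p m e \<longleftrightarrow> x \<in> carrier SO21 \<and> l > 1 \<and>
    x *v p = l *\<^sub>R p \<and> x *v m = (1 / l) *\<^sub>R m \<and> x *v e = e \<and>
    lor p p = 0 \<and> lor m m = 0 \<and> p$3 > 0 \<and> m$3 > 0 \<and> lor e e = 1 \<and> det3 e m p > 0"

text \<open>Two eigenvectors of an isometry are orthogonal unless their eigenvalues multiply to 1.
  The pairing of \<open>p\<close> and \<open>m\<close> cannot vanish as well, since \<open>p\<close>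
  would be orthogonal to a basis.\<close>

lemma hframe_lor:
  assumes "hframe x l p m e"
  shows "lor e p = 0" "lor e m = 0" "lor p m < 0"
proof -
  note f = assms[unfolded hframe_def]
  have "lor (x *v e) (x *v p) = lor e p" "lor (x *v e) (x *v m) = lor e m"
    using f by (blast intro: SO21_lor)+
  then have "l * lor e p = lor e p" "(1 / l) * lor e m = lor e m"
    using f by (simp_all add: lor_simps)
  then show ep: "lor e p = 0" and em: "lor e m = 0" using f by (auto simp: divide_simps)
  have "lor p m \<noteq> 0"
  proof
    assume "lor p m = 0"
    then have "p = 0" using f ep by (intro det3_nondegenerate[of e m p p]) (auto simp: lor_sym)
    then show False using f by simp
  qed
  moreover have "lor p m \<le> 0" by (rule future_lor_nonpos) (use f in auto)
  ultimately show "lor p m < 0" by simp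
qed

text \<open>The two null vectors are dual to each other, so the coefficient of \<open>p\<close> is
  found by pairing with \<open>m\<close> and conversely.\<close>

lemma hframe_expand:
  assumes "hframe x l p m e"
  shows "v = lor v e *\<^sub>R e + (lor v m / lor p m) *\<^sub>R p + (lor v p / lor p m) *\<^sub>R m"
proof -
  note f = assms[unfolded hframe_def] and g = hframe_lor[OF assms]
  have s: "lor m p = lor p m" "lor p e = lor e p" "lor m e = lor e m" by (rule lor_sym)+
  let ?d = "v - (lor v e *\<^sub>R e + (lor v m / lor p m) *\<^sub>R p + (lor v p / lor p m) *\<^sub>R m)"
  have "?d = 0"
    by (rule det3_nondegenerate[of e m p]) (use f g s in \<open>auto simp: lor_simps\<close>)
  then show ?thesis by simp
qed

lemma hframe_mv:
  assumes "hframe x l p m e"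
  shows "x *v (a *\<^sub>R e + b *\<^sub>R p + c *\<^sub>R m) = a *\<^sub>R e + (b * l) *\<^sub>R p + (c / l) *\<^sub>R m"
  using assms unfolding hframe_def
  by (simp add: matrix_vector_right_distrib matrix_vector_mult_scaleR)

lemma hframe_coord:
  assumes "hframe x l p m e"
  shows "lor (a *\<^sub>R e + b *\<^sub>R p + c *\<^sub>R m) e = a" "lor (a *\<^sub>R e + b *\<^sub>R p + c *\<^sub>R m) m = b * lor p m"
    "lor (a *\<^sub>R e + b *\<^sub>R p + c *\<^sub>R m) p = c * lor p m"
  using assms hframe_lor[OF assms] unfolding hframe_def
  by (simp_all add: lor_simps) (simp_all add: lor_sym)

lemma hframe_eigen:
  assumes "hframe x l p m e" "x *v v = c *\<^sub>R v" "v \<noteq> 0"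
  shows "c = 1 \<and> (\<exists>a. v = a *\<^sub>R e) \<or> c = l \<and> (\<exists>a. v = a *\<^sub>R p) \<or> c = 1 / l \<and> (\<exists>a. v = a *\<^sub>R m)"
proof -
  note f = assms(1)[unfolded hframe_def] and g = hframe_lor[OF assms(1)]
  define a b d where "a = lor v e" "b = lor v m / lor p m" "d = lor v p / lor p m"
  have v: "v = a *\<^sub>R e + b *\<^sub>R p + d *\<^sub>R m" using hframe_expand[OF assms(1)] a_b_d_def by simp
  have eq: "a *\<^sub>R e + (b * l) *\<^sub>R p + (d / l) *\<^sub>R m = (c * a) *\<^sub>R e + (c * b) *\<^sub>R p + (c * d) *\<^sub>R m"
    using assms(2) unfolding v hframe_mv[OF assms(1)] by (simp add: algebra_simps)
  have "a = c * a" using arg_cong[OF eq, of "\<lambda>w. lor w e"] unfolding hframe_coord[OF assms(1)] by simp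
  then have 1: "a * (c - 1) = 0" by (simp only: right_diff_distrib mult.commute[of a])
  have "b * l = c * b" using arg_cong[OF eq, of "\<lambda>w. lor w m"] g unfolding hframe_coord[OF assms(1)] by simp
  then have 2: "b * (c - l) = 0" by (simp only: right_diff_distrib mult.commute[of c])
  have "d / l = c * d" using arg_cong[OF eq, of "\<lambda>w. lor w p"] g unfolding hframe_coord[OF assms(1)]
    by (metis mult_right_cancel order_less_irrefl)
  then have "d * (c - 1 / l) = 0" by (simp only: right_diff_distrib mult.commute[of c] times_divide_eq_right mult_1_right)
  with 1 2 have *: "a = 0 \<or> c = 1" "b = 0 \<or> c = l" "d = 0 \<or> c = 1 / l"
    by (metis mult_eq_0_iff eq_iff_diff_eq_0)+
  have l: "l > 1" "1 / l < 1" using f by auto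
  consider "a \<noteq> 0" "c = 1" "b = 0" "d = 0" | "b \<noteq> 0" "c = l" "a = 0" "d = 0" | "d \<noteq> 0" "c = 1 / l" "a = 0" "b = 0"
    | "a = 0" "b = 0" "d = 0"
    using * l by fastforce
  then show ?thesis
    by cases (use v assms(3) in \<open>auto\<close>)
qed

lemma hframe_eigenvalues:
  assumes "hframe x l p m e"
  shows "eigenvalues x = {1 / l, 1, l}"
proof -
  note f = assms(1)[unfolded hframe_def]
  have "p \<noteq> 0" "m \<noteq> 0" "e \<noteq> 0" using f by (auto simp: lor_simps)
  then have "{1 / l, 1, l} \<subseteq> eigenvalues x"
    unfolding eigenvalues_def using f by (auto intro: exI[of _ p] exI[of _ m] exI[of _ e])
  moreover have "eigenvalues x \<subseteq> {1 / l, 1, l}"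
    unfolding eigenvalues_def using hframe_eigen[OF assms] by blast
  ultimately show ?thesis by blast
qed

lemma hframe_hyperbolic:
  assumes "hframe x l p m e" shows "hyperbolic x"
proof -
  have "l > 1" using assms by (simp add: hframe_def)
  then have "l \<noteq> 1 / l" "1 \<noteq> 1 / l" "l \<noteq> 1" by (auto simp: field_simps) (metis less_1_mult order_less_irrefl)
  then show ?thesis using assms
    unfolding hyperbolic_def hframe_eigenvalues[OF assms] hframe_def by simp
qed

lemma Max_Min_eigenvalues:
  assumes "hframe x l p m e"
  shows "Max (eigenvalues x) = l" "Min (eigenvalues x) = 1 / l"
proof -
  have l: "l > 1" using assms by (simp add: hframe_def)
  then have "1 / l < 1" "1 / l < l" by (simp, smt (verit) divide_less_eq_1_pos)
  then show "Max (eigenvalues x) = l" "Min (eigenvalues x) = 1 / l"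
    unfolding hframe_eigenvalues[OF assms] using l by (auto intro!: Max_eqI Min_eqI)
qed

lemma normalized_multiple:
  assumes "norm v = 1" "v$3 > 0" "v = a *\<^sub>R w" "(w::real^3)$3 > 0"
  shows "v = (1 / norm w) *\<^sub>R w"
proof -
  have "a > 0" using assms by (simp add: zero_less_mult_iff)
  then have "a * norm w = 1" using assms by simp
  then have "a = 1 / norm w" by (metis nonzero_divide_eq_eq mult_eq_0_iff zero_neq_one)
  then show ?thesis using assms by simp
qed

lemma hframe_Xplus:
  assumes "hframe x l p m e" shows "Xplus x = (1 / norm p) *\<^sub>R p"
proof -
  note f = assms(1)[unfolded hframe_def]
  have p0: "norm p > 0" using f by auto
  have sc: "x *v (c *\<^sub>R p) = c *\<^sub>R (x *v p)" for c by (rule matrix_vector_mult_scaleR)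
  show ?thesis unfolding Xplus_def Max_Min_eigenvalues[OF assms]
  proof (rule the_equality)
    show "x *v ((1 / norm p) *\<^sub>R p) = l *\<^sub>R (1 / norm p) *\<^sub>R p \<and> lor ((1 / norm p) *\<^sub>R p) ((1 / norm p) *\<^sub>R p) = 0
      \<and> ((1 / norm p) *\<^sub>R p) $ 3 > 0 \<and> norm ((1 / norm p) *\<^sub>R p) = 1"
      using f p0 by (simp add: sc lor_simps)
    fix v assume v: "x *v v = l *\<^sub>R v \<and> lor v v = 0 \<and> v $ 3 > 0 \<and> norm v = 1"
    then have "v \<noteq> 0" by auto
    have "l \<noteq> 1" "l \<noteq> 1 / l" using f by (auto simp: field_simps) (metis less_1_mult order_less_irrefl)
    then obtain a where "v = a *\<^sub>R p" using hframe_eigen[OF assms _ \<open>v \<noteq> 0\<close>] v by blast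
    then show "v = (1 / norm p) *\<^sub>R p" using normalized_multiple v f by blast
  qed
qed

lemma hframe_Xminus:
  assumes "hframe x l p m e" shows "Xminus x = (1 / norm m) *\<^sub>R m"
proof -
  note f = assms(1)[unfolded hframe_def]
  have p0: "norm m > 0" using f by auto
  have sc: "x *v (c *\<^sub>R m) = c *\<^sub>R (x *v m)" for c by (rule matrix_vector_mult_scaleR)
  show ?thesis unfolding Xminus_def Max_Min_eigenvalues[OF assms]
  proof (rule the_equality)
    show "x *v ((1 / norm m) *\<^sub>R m) = (1 / l) *\<^sub>R (1 / norm m) *\<^sub>R m \<and> lor ((1 / norm m) *\<^sub>R m) ((1 / norm m) *\<^sub>R m) = 0
      \<and> ((1 / norm m) *\<^sub>R m) $ 3 > 0 \<and> norm ((1 / norm m) *\<^sub>R m) = 1"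
      using f p0 by (simp add: sc lor_simps)
    fix v assume v: "x *v v = (1 / l) *\<^sub>R v \<and> lor v v = 0 \<and> v $ 3 > 0 \<and> norm v = 1"
    then have "v \<noteq> 0" by auto
    have "1 / l \<noteq> 1" "1 / l \<noteq> l" using f by (auto simp: field_simps) (metis less_1_mult order_less_irrefl)
    then obtain a where "v = a *\<^sub>R m" using hframe_eigen[OF assms _ \<open>v \<noteq> 0\<close>] v by blast
    then show "v = (1 / norm m) *\<^sub>R m" using normalized_multiple v f by blast
  qed
qed

lemma det3_scale: "det3 u (a *\<^sub>R v) (b *\<^sub>R w) = a * b * det3 u v w"
  "det3 (c *\<^sub>R u) v w = c * det3 u v w"
  by (simp_all add: det3_explicit algebra_simps)

lemma hframe_Xzero:
  assumes "hframe x l p m e" shows "Xzero x = e"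
proof -
  note f = assms(1)[unfolded hframe_def]
  have p0: "norm p > 0" "norm m > 0" using f by auto
  show ?thesis unfolding Xzero_def hframe_Xplus[OF assms] hframe_Xminus[OF assms] det3_scale
  proof (rule the_equality)
    show "x *v e = e \<and> lor e e = 1 \<and> 1 / norm m * (1 / norm p) * det3 e m p > 0"
      using f p0 by simp
    fix v assume v: "x *v v = v \<and> lor v v = 1 \<and> 1 / norm m * (1 / norm p) * det3 v m p > 0"
    then have "v \<noteq> 0" by (auto simp: lor_simps)
    have "1 / l \<noteq> 1" "l \<noteq> 1" using f by auto
    then obtain a where a: "v = a *\<^sub>R e" using hframe_eigen[OF assms, of v 1] v \<open>v \<noteq> 0\<close> by auto
    have "1 / norm m * (1 / norm p) > 0" using p0 by simp
    then have "det3 v m p > 0" using v zero_less_mult_pos by blast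
    then have "a * a = 1" "a > 0" using v f a by (auto simp: lor_simps det3_scale zero_less_mult_iff)
    then have "a = 1" by (metis abs_of_pos mult_1 power2_eq_square real_sqrt_abs real_sqrt_one)
    then show "v = e" using a by simp
  qed
qed

lemma ln_cosh:
  assumes "l > 1" shows "cosh (ln l) = (l + 1 / l) / 2" "sinh (ln l) = (l - 1 / l) / 2" "ln (l::real) > 0"
  using assms by (simp_all add: cosh_def sinh_def exp_minus field_simps)

text \<open>\<open>lor z e\<close> is the hyperbolic sine of the signed distance from
  \<open>z\<close> to the axis, so this is the displacement as a function of that distance. It gives
  the translation length here and the local finiteness of axes later.\<close>

lemma hframe_displacement:
  assumes "hframe x l p m e" "z \<in> H2"
  shows "- lor z (x *v z) = cosh (ln l) + (lor z e)\<^sup>2 * (cosh (ln l) - 1)"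
proof -
  note f = assms(1)[unfolded hframe_def] and g = hframe_lor[OF assms(1)]
  define a b d where "a = lor z e" "b = lor z m / lor p m" "d = lor z p / lor p m"
  have v: "z = a *\<^sub>R e + b *\<^sub>R p + d *\<^sub>R m" using hframe_expand[OF assms(1)] a_b_d_def by simp
  have s: "lor m p = lor p m" "lor p e = 0" "lor m e = 0" using g lor_sym by metis+
  have "lor z z = a\<^sup>2 + 2 * b * d * lor p m" unfolding v
    using f g s by (simp add: lor_simps power2_eq_square algebra_simps)
  then have 1: "2 * b * d * lor p m = - 1 - a\<^sup>2" using assms(2) by (simp add: H2_iff)
  have "lor z (x *v z) = a\<^sup>2 + b * d * lor p m * (l + 1 / l)" unfolding v hframe_mv[OF assms(1)]
    using f g s by (simp add: lor_simps power2_eq_square algebra_simps add_divide_distrib)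
  also have "\<dots> = a\<^sup>2 + (2 * b * d * lor p m) * cosh (ln l)" using f by (simp add: ln_cosh)
  finally show ?thesis unfolding 1 a_b_d_def(1)[symmetric] by (simp add: algebra_simps)
qed

lemma arcosh_mono: "1 \<le> a \<Longrightarrow> a \<le> b \<Longrightarrow> arcosh a \<le> arcosh (b::real)"
  by (metis arcosh_real_strict_mono less_le order_refl)

lemma hframe_tlen:
  assumes "hframe x l p m e" shows "tlen x = ln l"
proof -
  note f = assms(1)[unfolded hframe_def] and g = hframe_lor[OF assms(1)]
  have l: "ln l > 0" "cosh (ln l) \<ge> 1" using f ln_cosh by (auto simp: cosh_real_ge_1)
  define N where "N = sqrt (- 2 * lor p m)"
  have N: "N > 0" "N * N = - 2 * lor p m" using g by (simp_all add: N_def)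
  \<comment> \<open>A point of the axis, where the infimum is attained.\<close>
  let ?z = "(1 / N) *\<^sub>R (p + m)"
  have "lor ?z ?z = - 1" using f g N by (simp add: lor_simps lor_sym[of m p] field_simps)
  then have z: "?z \<in> H2" using f N by (simp add: H2_iff)
  have "lor ?z e = 0" using g by (simp add: lor_simps lor_sym[of _ e])
  then have hz: "hdist ?z (x *v ?z) = ln l"
    using hframe_displacement[OF assms z] l by (simp add: hdist_def arcosh_cosh_real)
  have le: "ln l \<le> hdist z (x *v z)" if "z \<in> H2" for z
  proof -
    have "cosh (ln l) \<le> - lor z (x *v z)" using hframe_displacement[OF assms that] l by simp
    then have "arcosh (cosh (ln l)) \<le> hdist z (x *v z)" unfolding hdist_def using l by (intro arcosh_mono) auto
    then show ?thesis using l by (simp add: arcosh_cosh_real)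
  qed
  have "bdd_below ((\<lambda>z. hdist z (x *v z)) ` H2)" using le by (rule bdd_belowI2)
  then have "tlen x \<le> ln l" unfolding tlen_def
    using cINF_lower2[OF _ z, of "\<lambda>z. hdist z (x *v z)" "ln l"] hz by simp
  moreover have "ln l \<le> tlen x" unfolding tlen_def using z le by (intro cINF_greatest) auto
  ultimately show ?thesis by simp
qed

lemma hframe_exists_norm:
  assumes "hframe x l p m e"
  shows "hframe x l (Xplus x) (Xminus x) (Xzero x)"
proof -
  note f = assms[unfolded hframe_def]
  have n: "norm p > 0" "norm m > 0" using f by auto
  show ?thesis
    unfolding hframe_Xplus[OF assms] hframe_Xminus[OF assms] hframe_Xzero[OF assms] hframe_def
    using f n by (simp add: matrix_vector_mult_scaleR lor_simps det3_scale)
qed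

section \<open>The characteristic polynomial\<close>

lemma eigenvalues_det:
  "c \<in> eigenvalues x \<longleftrightarrow> det (x - c *\<^sub>R mat 1) = 0"
proof -
  have "(x - c *\<^sub>R mat 1) *v v = x *v v - c *\<^sub>R v" for v
    by (simp add: matrix_vector_mult_diff_rdistrib scaleR_matrix_vector_assoc[symmetric])
  then show ?thesis
    unfolding eigenvalues_def using invertible_det_nz[of "x - c *\<^sub>R mat 1"]
      matrix_left_invertible_ker[of "x - c *\<^sub>R mat 1"] invertible_left_inverse[of "x - c *\<^sub>R mat 1"]
    by auto
qed

lemma matrix_diff_ldistrib: "A ** (B - C) = A ** B - A ** (C :: real^'n^'m)"
  by (simp add: vec_eq_iff matrix_matrix_mult_def right_diff_distrib sum_subtractf)

text \<open>In odd dimension 1 is an eigenvalue: \<open>x - 1\<close> equals \<open>x\<close> times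
  \<open>1 - ladj x\<close>, and \<open>ladj x\<close> is a signed transpose of \<open>x\<close>.
  The root 1 forces \<open>e2 = trace x\<close>, so the trace alone governs the other
  factor.\<close>

lemma charpoly_SO21:
  assumes "x \<in> carrier SO21"
  shows "det (x - c *\<^sub>R mat 1) = - ((c - 1) * (c\<^sup>2 - (trace x - 1) * c + 1))"
proof -
  define e2 where "e2 = x$1$1 * x$2$2 - x$1$2 * x$2$1 + x$1$1 * x$3$3 - x$1$3 * x$3$1
    + x$2$2 * x$3$3 - x$2$3 * x$3$2"
  have poly: "det (x - c *\<^sub>R mat 1) = - (c ^ 3) + trace x * c\<^sup>2 - e2 * c + 1" for c
  proof -
    have "det (x - c *\<^sub>R mat 1) = - (c ^ 3) + trace x * c\<^sup>2 - e2 * c + det x"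
      by (simp add: det_3 mat_def trace_def sum_3 e2_def algebra_simps power2_eq_square power3_eq_cube)
    then show ?thesis using assms by (simp add: SO21_carrier)
  qed
  have "x - 1 *\<^sub>R mat 1 = x ** (mat 1 - ladj x)"
    by (simp add: matrix_diff_ldistrib ladj_mult[OF assms])
  then have "det (x - 1 *\<^sub>R mat 1) = det (mat 1 - ladj x)"
    using assms by (simp add: det_mul SO21_carrier)
  moreover have "det (mat 1 - ladj x) = - det (x - 1 *\<^sub>R mat 1)"
    by (simp add: det_3 mat_def ladj_nth algebra_simps)
  ultimately have "det (x - 1 *\<^sub>R mat 1) = 0" by simp
  then have "e2 = trace x" unfolding poly by simp
  then show ?thesis unfolding poly by (simp add: algebra_simps power2_eq_square power3_eq_cube)
qed

lemma null_eigenvector: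
  assumes "x \<in> carrier SO21" "x *v v = c *\<^sub>R v" "c\<^sup>2 \<noteq> 1"
  shows "lor v v = 0"
proof -
  have "lor (x *v v) (x *v v) = lor v v" by (rule SO21_lor[OF assms(1)])
  then show ?thesis using assms by (simp add: lor_simps power2_eq_square)
qed

text \<open>A null vector with vanishing third coordinate is zero, so the eigenvector can be
  rescaled into the future; preservation of the future then makes the eigenvalue positive.\<close>

lemma null_future_eigenvector:
  assumes "x \<in> carrier SO21" "c \<in> eigenvalues x" "c\<^sup>2 \<noteq> 1"
  obtains v where "x *v v = c *\<^sub>R v" "lor v v = 0" "v$3 > 0" "norm v = 1" "c > 0"
proof -
  obtain w where w: "w \<noteq> 0" "x *v w = c *\<^sub>R w" using assms(2) by (auto simp: eigenvalues_def)
  have n: "lor w w = 0" using null_eigenvector assms w by blast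
  have w3: "w$3 \<noteq> 0"
  proof
    assume "w$3 = 0"
    then have "w$1 * w$1 + w$2 * w$2 = 0" using n by (simp add: lor_def)
    then have "w = 0" using \<open>w$3 = 0\<close> by (simp add: vec3_eq_iff sum_squares_eq_zero_iff)
    then show False using w by simp
  qed
  define v where "v = (sgn (w$3) / norm w) *\<^sub>R w"
  have sg: "sgn (w$3) * w$3 > 0" using w3 by (metis abs_sgn mult.commute zero_less_abs_iff)
  have "x *v v = c *\<^sub>R v" "lor v v = 0" "v$3 > 0" "norm v = 1"
    using w n w3 sg by (auto simp: v_def matrix_vector_mult_scaleR lor_simps abs_sgn_eq)
  moreover have "c > 0"
    using SO21_future[OF assms(1), of v] calculation by (simp add: zero_less_mult_iff)
  ultimately show ?thesis using that by blast
qed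

text \<open>A trace above 3 can be written \<open>1 + l + 1 / l\<close> with \<open>l > 1\<close>,
  and then the quadratic factor of the characteristic polynomial splits as
  \<open>(c - l) * (c - 1 / l)\<close>.\<close>

lemma hframe_of_trace:
  assumes x: "x \<in> carrier SO21" and tr: "trace x > 3"
  obtains p m e where "hframe x (exp (arcosh ((trace x - 1) / 2))) p m e"
proof -
  define a where "a = arcosh ((trace x - 1) / 2)"
  have a: "a > 0" "cosh a = (trace x - 1) / 2" using tr unfolding a_def by auto
  define l where "l = exp a"
  have l: "l > 1" "l > 0" using a by (auto simp: l_def)
  then have l': "1 / l < 1" "1 / l < l" by (simp, smt (verit) divide_less_eq_1_pos)
  have tl: "trace x - 1 = l + 1 / l" using a by (simp add: cosh_def l_def exp_minus field_simps)
  have ev: "c \<in> eigenvalues x \<longleftrightarrow> c = 1 \<or> c = l \<or> c = 1 / l" for c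
  proof -
    have "c\<^sup>2 - (l + 1 / l) * c + 1 = (c - l) * (c - 1 / l)"
      using l by (simp add: field_simps power2_eq_square)
    then show ?thesis unfolding eigenvalues_det charpoly_SO21[OF x] tl by auto
  qed
  have "1 / l > 0" using l by simp
  then have "l\<^sup>2 \<noteq> 1" "(1 / l)\<^sup>2 \<noteq> 1" unfolding power2_eq_1_iff using l l' by linarith+
  with ev null_future_eigenvector[OF x] obtain p m where
    p: "x *v p = l *\<^sub>R p" "lor p p = 0" "p$3 > 0" "norm p = 1" and
    m: "x *v m = (1 / l) *\<^sub>R m" "lor m m = 0" "m$3 > 0" "norm m = 1" by (metis (no_types))
  obtain e0 where e0: "e0 \<noteq> 0" "x *v e0 = e0" using ev[of 1] by (auto simp: eigenvalues_def)
  have "lor (x *v e0) (x *v p) = lor e0 p" "lor (x *v e0) (x *v m) = lor e0 m"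
    using x by (blast intro: SO21_lor)+
  then have "l * lor e0 p = lor e0 p" "(1 / l) * lor e0 m = lor e0 m"
    unfolding p m e0 by (simp_all add: lor_simps)
  then have ep: "lor e0 p = 0" "lor e0 m = 0" using l l' by (auto simp: divide_simps)
  have pm: "lor p m < 0"
  proof -
    \<comment> \<open>A null vector of Euclidean norm 1 has third coordinate
      \<open>sqrt (1 / 2)\<close>, so \<open>p\<close> and \<open>m\<close> lie on one circle. If
      they were orthogonal they would coincide, although their eigenvalues differ.\<close>
    have sq: "(v$1)\<^sup>2 + (v$2)\<^sup>2 = 1 / 2 \<and> v$3 = sqrt (1 / 2)" if "lor v v = 0" "v$3 > 0" "norm v = 1" for v
    proof -
      have "(v$1)\<^sup>2 + (v$2)\<^sup>2 + (v$3)\<^sup>2 = 1"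
        using that(3) by (simp add: norm_vec_def L2_set_def sum_3)
      moreover have "(v$1)\<^sup>2 + (v$2)\<^sup>2 = (v$3)\<^sup>2" using that(1) by (simp add: lor_def power2_eq_square)
      ultimately have "(v$3)\<^sup>2 = 1 / 2" by linarith
      then show ?thesis using \<open>(v$1)\<^sup>2 + (v$2)\<^sup>2 = (v$3)\<^sup>2\<close> that(2) by (metis real_sqrt_unique less_imp_le)
    qed
    note sp = sq[OF p(2-4)] and sm = sq[OF m(2-4)]
    have "lor p m \<noteq> 0"
    proof
      assume "lor p m = 0"
      then have "p$1 * m$1 + p$2 * m$2 = 1 / 2" using sp sm by (simp add: lor_def)
      then have "(p$1 - m$1)\<^sup>2 + (p$2 - m$2)\<^sup>2 = 0" using sp sm by (simp add: power2_diff)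
      then have "p = m" using sp sm by (simp add: vec3_eq_iff sum_power2_eq_zero_iff)
      then have "l *\<^sub>R p = (1 / l) *\<^sub>R p" using p(1) m(1) by metis
      then show False using l' p(4) by auto
    qed
    moreover have "lor p m \<le> 0" by (rule future_lor_nonpos) (use p m in auto)
    ultimately show ?thesis by simp
  qed
  have "lor (p + m) (p + m) < 0" "lor (p + m) e0 = 0"
    using p m pm ep by (simp_all add: lor_simps lor_sym[of m p] lor_sym[of _ e0])
  then have ee: "lor e0 e0 > 0" using spacelike_of_orthogonal e0 by blast
  have sy: "lor p e0 = 0" "lor m e0 = 0" "lor m p = lor p m" using ep lor_sym by metis+
  have "det3 e0 m p * det3 e0 m p = lor e0 e0 * (lor p m)\<^sup>2"
    unfolding det3_gram sy p(2) m(2) ep by (simp add: power2_eq_square)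
  then have d: "det3 e0 m p \<noteq> 0" using ee pm by auto
  define e where "e = (sgn (det3 e0 m p) / sqrt (lor e0 e0)) *\<^sub>R e0"
  have "sgn (det3 e0 m p) * det3 e0 m p > 0" "(sgn (det3 e0 m p))\<^sup>2 = 1"
    using d by (auto simp: sgn_if)
  then have "x *v e = e" "lor e e = 1" "det3 e m p > 0"
    using ee e0 d by (simp_all add: e_def matrix_vector_mult_scaleR lor_simps det3_scale
        power2_eq_square[symmetric] divide_simps)
  then have "hframe x l p m e" unfolding hframe_def using x l p m by blast
  then show ?thesis using that unfolding l_def a_def by blast
qed

text \<open>One of three distinct eigenvalues differs from 1 and -1; it is positive and a root of
  the quadratic factor. With trace at most 3 this root would satisfy
  \<open>(c - 1)\<^sup>2 \<le> 0\<close>.\<close>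

lemma hyperbolic_trace:
  assumes "hyperbolic x" shows "trace x > 3"
proof (rule ccontr)
  assume n: "\<not> ?thesis"
  have x: "x \<in> carrier SO21" and c3: "card (eigenvalues x) = 3" using assms by (auto simp: hyperbolic_def)
  have ev: "c \<in> eigenvalues x \<longleftrightarrow> c = 1 \<or> c\<^sup>2 - (trace x - 1) * c + 1 = 0" for c
    unfolding eigenvalues_det charpoly_SO21[OF x] by auto
  have "\<exists>c\<in>eigenvalues x. c \<noteq> 1 \<and> c \<noteq> -1"
  proof (rule ccontr)
    assume "\<not> ?thesis"
    then have "eigenvalues x \<subseteq> {1, -1}" by blast
    then have "card (eigenvalues x) \<le> card {1, -1::real}" by (intro card_mono) auto
    then show False using c3 by simp
  qed
  then obtain c where c: "c \<in> eigenvalues x" "c \<noteq> 1" "c \<noteq> -1" by blast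
  then have "c > 0" using null_future_eigenvector[OF x c(1)] by (metis power2_eq_1_iff)
  have "c\<^sup>2 - (trace x - 1) * c + 1 = 0" using c ev by blast
  moreover have "(trace x - 1) * c \<le> 2 * c" using n \<open>c > 0\<close> by (intro mult_right_mono) auto
  ultimately have "(c - 1)\<^sup>2 \<le> 0" by (simp add: power2_diff)
  then show False using c by simp
qed

text \<open>Phrased with the trace because a strict bound on it is an open condition, which persists
  along a deformation.\<close>

lemma tlen_trace:
  assumes "x \<in> carrier SO21" "trace x > 3"
  shows "tlen x = arcosh ((trace x - 1) / 2)"
  using hframe_of_trace[OF assms] hframe_tlen by (metis ln_exp)

lemma hyperbolic_frame:
  assumes "hyperbolic x"
  shows "hframe x (exp (tlen x)) (Xplus x) (Xminus x) (Xzero x)"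
proof -
  have x: "x \<in> carrier SO21" "trace x > 3" using assms hyperbolic_trace by (auto simp: hyperbolic_def)
  show ?thesis using hframe_of_trace[OF x] hframe_exists_norm unfolding tlen_trace[OF x] by metis
qed

lemma tlen_pos: "hyperbolic x \<Longrightarrow> tlen x > 0"
  using hyperbolic_frame[of x] by (simp add: hframe_def)

lemma hyperbolic_conj:
  assumes g: "g \<in> carrier SO21" and "hyperbolic x"
  shows "hyperbolic (g ** x ** matrix_inv g)" "Xzero (g ** x ** matrix_inv g) = g *v Xzero x"
    "tlen (g ** x ** matrix_inv g) = tlen x"
proof -
  note f = hyperbolic_frame[OF assms(2), unfolded hframe_def]
  have c: "(g ** x ** matrix_inv g) *v (g *v v) = g *v (x *v v)" for v
    by (simp add: matrix_vector_mul_assoc[symmetric] matrix_inv_SO21[OF g] ladj_vec[OF g])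
  have "g ** x ** matrix_inv g \<in> carrier SO21"
    using f g by (auto simp: matrix_inv_SO21[OF g] intro!: SO21_mult_closed ladj_SO21)
  then have "hframe (g ** x ** matrix_inv g) (exp (tlen x)) (g *v Xplus x) (g *v Xminus x) (g *v Xzero x)"
    unfolding hframe_def c using f SO21_future[OF g]
    by (auto simp: matrix_vector_mult_scaleR SO21_lor[OF g] det3_SO21[OF g])
  from hframe_hyperbolic[OF this] hframe_Xzero[OF this] hframe_tlen[OF this]
  show "hyperbolic (g ** x ** matrix_inv g)" "Xzero (g ** x ** matrix_inv g) = g *v Xzero x"
    "tlen (g ** x ** matrix_inv g) = tlen x" by simp_all
qed

section \<open>Axes\<close>

text \<open>The unit tangent vector of \<open>axis_path x\<close> at \<open>s\<close>.\<close>

definition axis_dir :: "real^3^3 \<Rightarrow> real \<Rightarrow> real^3"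
  where "axis_dir x s =
    (1 / sqrt (- 2 * lor (Xplus x) (Xminus x))) *\<^sub>R (exp s *\<^sub>R Xplus x - exp (- s) *\<^sub>R Xminus x)"

lemma Xpm_norm:
  assumes "hyperbolic x"
  obtains N where "N > 0" "N * N = - 2 * lor (Xplus x) (Xminus x)"
    "\<And>s. axis_path x s = (1 / N) *\<^sub>R (exp s *\<^sub>R Xplus x + exp (- s) *\<^sub>R Xminus x)"
    "\<And>s. axis_dir x s = (1 / N) *\<^sub>R (exp s *\<^sub>R Xplus x - exp (- s) *\<^sub>R Xminus x)"
proof -
  note g = hframe_lor[OF hyperbolic_frame[OF assms]]
  show ?thesis
    by (rule that[of "sqrt (- 2 * lor (Xplus x) (Xminus x))"])
      (use g in \<open>simp_all add: axis_path_def axis_dir_def\<close>)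
qed

lemma axis_lor:
  assumes "hyperbolic x"
  shows "lor (axis_path x s) (axis_path x s) = -1" "lor (axis_dir x s) (axis_dir x s) = 1"
    "lor (axis_path x s) (axis_dir x s) = 0" "lor (axis_path x s) (Xzero x) = 0"
    "lor (axis_dir x s) (Xzero x) = 0" "axis_path x s $ 3 > 0"
proof -
  note f = hyperbolic_frame[OF assms, unfolded hframe_def]
  note g = hframe_lor[OF hyperbolic_frame[OF assms]]
  have sy: "lor (Xminus x) (Xplus x) = lor (Xplus x) (Xminus x)" "lor (Xplus x) (Xzero x) = 0"
    "lor (Xminus x) (Xzero x) = 0" using g lor_sym by metis+
  obtain N where N: "N > 0" "N * N = - 2 * lor (Xplus x) (Xminus x)"
    "\<And>s. axis_path x s = (1 / N) *\<^sub>R (exp s *\<^sub>R Xplus x + exp (- s) *\<^sub>R Xminus x)"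
    "\<And>s. axis_dir x s = (1 / N) *\<^sub>R (exp s *\<^sub>R Xplus x - exp (- s) *\<^sub>R Xminus x)"
    using Xpm_norm[OF assms] by metis
  have pm: "lor (Xplus x) (Xminus x) = - (N * N) / 2" using N by simp
  have e: "exp s * exp (- s) = 1" "exp (-s) * exp s = 1" by (simp_all add: exp_minus)
  show "lor (axis_path x s) (axis_path x s) = -1" "lor (axis_dir x s) (axis_dir x s) = 1"
    "lor (axis_path x s) (axis_dir x s) = 0"
    unfolding N(3,4) using N(1) f e by (simp_all add: lor_simps sy pm exp_minus field_simps)
  show "lor (axis_path x s) (Xzero x) = 0" "lor (axis_dir x s) (Xzero x) = 0"
    unfolding N(3,4) by (simp_all add: lor_simps sy)
  show "axis_path x s $ 3 > 0" unfolding N using f N by (simp add: add_pos_pos)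
qed

lemma Xzero_unit: "hyperbolic x \<Longrightarrow> lor (Xzero x) (Xzero x) = 1"
  using hyperbolic_frame[of x] by (simp add: hframe_def)

lemma axis_path_H2: "hyperbolic x \<Longrightarrow> axis_path x s \<in> H2"
  by (simp add: H2_iff axis_lor)

lemma axis_path_mv:
  assumes "hyperbolic x"
  shows "x *v axis_path x s = axis_path x (s + tlen x)"
proof -
  note f = hyperbolic_frame[OF assms, unfolded hframe_def]
  show ?thesis unfolding axis_path_def
    using f by (simp add: matrix_vector_mult_scaleR matrix_vector_right_distrib exp_add exp_minus
        exp_diff divide_simps scaleR_add_right)
qed

lemma axis_path_add:
  "axis_path x (s + t) = cosh t *\<^sub>R axis_path x s + sinh t *\<^sub>R axis_dir x s"
  unfolding axis_path_def axis_dir_def cosh_def sinh_def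
  by (simp add: vec_eq_iff exp_add exp_minus exp_diff divide_simps) (simp add: algebra_simps)

lemma axis_path_inj:
  assumes "hyperbolic x" "axis_path x s = axis_path x t" shows "s = t"
proof -
  have "lor (axis_path x t) (axis_dir x s) = sinh (t - s)"
    using axis_path_add[of x s "t - s"] assms(1) by (simp add: lor_simps axis_lor)
  then show ?thesis using assms by (metis axis_lor(3) eq_iff_diff_eq_0 sinh_real_zero_iff)
qed

lemma continuous_on_axis_path [continuous_intros]: "continuous_on S (axis_path x)"
  unfolding axis_path_def by (intro continuous_intros)

lemma forward_axis_path:
  assumes "hyperbolic x" shows "forward x (axis_path x s) = axis_dir x s"
proof -
  have "(THE t. axis_path x t = axis_path x s) = s"
    by (rule the_equality) (use axis_path_inj[OF assms] in auto)
  moreover have "(axis_path x has_vector_derivative axis_dir x s) (at s)"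
    unfolding axis_path_def axis_dir_def
    by (rule bounded_linear.has_vector_derivative[OF bounded_linear_scaleR_right]) (auto intro!: derivative_eq_intros)
  ultimately show ?thesis unfolding forward_def by (simp add: vector_derivative_at)
qed

text \<open>The complement of \<open>Xzero x\<close> is spanned by the two null eigenvectors. Axes
  thus become linear sections of the hyperboloid, the form in which incidence is tested
  throughout.\<close>

lemma geod_axis_eq:
  assumes "hyperbolic x"
  shows "geod_axis x = {z \<in> H2. lor z (Xzero x) = 0}"
proof
  show "geod_axis x \<subseteq> {z \<in> H2. lor z (Xzero x) = 0}"
    unfolding geod_axis_def using axis_path_H2[OF assms] axis_lor[OF assms] by auto
  show "{z \<in> H2. lor z (Xzero x) = 0} \<subseteq> geod_axis x"
  proof safe
    fix z assume z: "z \<in> H2" "lor z (Xzero x) = 0"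
    note F = hyperbolic_frame[OF assms]
    note f = F[unfolded hframe_def] and g = hframe_lor[OF F]
    obtain N where N: "N > 0" "N * N = - 2 * lor (Xplus x) (Xminus x)"
      "\<And>s. axis_path x s = (1 / N) *\<^sub>R (exp s *\<^sub>R Xplus x + exp (- s) *\<^sub>R Xminus x)"
      using Xpm_norm[OF assms] by metis
    define b d where "b = lor z (Xminus x) / lor (Xplus x) (Xminus x)"
      and "d = lor z (Xplus x) / lor (Xplus x) (Xminus x)"
    have v: "z = b *\<^sub>R Xplus x + d *\<^sub>R Xminus x"
      using hframe_expand[OF F, of z] z by (simp add: b_def d_def)
    have "lor z (Xminus x) < 0" by (rule future_lor_neg) (use z f in \<open>auto simp: H2_iff\<close>)
    then have b: "b > 0" using g by (simp add: b_def divide_neg_neg)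
    have "lor z z = 2 * b * d * lor (Xplus x) (Xminus x)"
      unfolding v using f by (simp add: lor_simps lor_sym[of "Xminus x" "Xplus x"])
    then have bd: "N * N * b * d = 1" using z N(2) by (simp add: H2_iff algebra_simps)
    \<comment> \<open>The coefficient of \<open>Xplus x\<close> determines the parameter;
      \<open>lor z z = -1\<close> then fixes the coefficient of \<open>Xminus x\<close>.\<close>
    define s where "s = ln (N * b)"
    have s: "exp s = N * b" using N b by (simp add: s_def)
    then have s': "exp (- s) = N * d" using bd N(1) b unfolding exp_minus by (intro inverse_unique) (simp only: mult_ac)
    have "axis_path x s = z" unfolding N(3) s s' using N(1) by (simp add: v algebra_simps)
    then show "z \<in> geod_axis x" unfolding geod_axis_def by blast
  qed
qed

lemma on_left_iff:
  assumes "hyperbolic x" shows "on_left x w \<longleftrightarrow> lor w (Xzero x) > 0"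
proof -
  note F = hyperbolic_frame[OF assms]
  note f = F[unfolded hframe_def] and g = hframe_lor[OF F]
  define a b d where "a = lor w (Xzero x)" "b = lor w (Xminus x) / lor (Xplus x) (Xminus x)"
    "d = lor w (Xplus x) / lor (Xplus x) (Xminus x)"
  have v: "w = a *\<^sub>R Xzero x + b *\<^sub>R Xplus x + d *\<^sub>R Xminus x"
    using hframe_expand[OF F, of w] a_b_d_def by simp
  have "det3 w (Xminus x) (Xplus x) = a * det3 (Xzero x) (Xminus x) (Xplus x)"
    unfolding v by (simp add: det3_explicit algebra_simps)
  then show ?thesis unfolding on_left_def a_b_d_def(1)[symmetric] using f by (simp add: zero_less_mult_iff)
qed

text \<open>Orthonormality makes the square of the determinant 1 by \<open>det3_gram\<close>; the
  sign is the orientation convention in \<open>Xzero\<close>.\<close>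

lemma det3_axis_frame:
  assumes "hyperbolic x"
  shows "det3 (Xzero x) (axis_path x s) (axis_dir x s) = 1"
proof -
  note F = hyperbolic_frame[OF assms]
  note f = F[unfolded hframe_def]
  obtain N where N: "N > 0"
    "\<And>s. axis_path x s = (1 / N) *\<^sub>R (exp s *\<^sub>R Xplus x + exp (- s) *\<^sub>R Xminus x)"
    "\<And>s. axis_dir x s = (1 / N) *\<^sub>R (exp s *\<^sub>R Xplus x - exp (- s) *\<^sub>R Xminus x)"
    using Xpm_norm[OF assms] by metis
  have e: "exp s * exp (- s) = 1" by (simp add: exp_minus)
  have "det3 (Xzero x) (exp s *\<^sub>R Xplus x + exp (- s) *\<^sub>R Xminus x) (exp s *\<^sub>R Xplus x - exp (- s) *\<^sub>R Xminus x)
     = (exp s * exp (- s)) * (2 * det3 (Xzero x) (Xminus x) (Xplus x))"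
    by (simp add: det3_explicit algebra_simps)
  then have pos: "det3 (Xzero x) (axis_path x s) (axis_dir x s) > 0"
    unfolding N(2,3) det3_scale e using f N(1) by simp
  have "det3 (Xzero x) (axis_path x s) (axis_dir x s) * det3 (Xzero x) (axis_path x s) (axis_dir x s) = 1"
    unfolding det3_gram using axis_lor[OF assms, of s] Xzero_unit[OF assms]
      lor_sym[of "Xzero x" "axis_path x s"] lor_sym[of "Xzero x" "axis_dir x s"]
      lor_sym[of "axis_dir x s" "axis_path x s"] by simp
  then show ?thesis using pos
    by (metis abs_of_pos power2_eq_square real_sqrt_abs real_sqrt_one)
qed

lemma lor_frame_expand:
  assumes d: "det3 e z f = 1" and o: "lor z z = -1" "lor f f = 1" "lor e e = 1" "lor z f = 0" "lor z e = 0" "lor f e = 0"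
  shows "lor v w = lor v e * lor w e + lor v f * lor w f - lor v z * lor w z"
proof -
  have sy: "lor f z = 0" "lor e z = 0" "lor e f = 0" using o lor_sym by metis+
  let ?d = "v - (lor v e *\<^sub>R e + lor v f *\<^sub>R f - lor v z *\<^sub>R z)"
  have "?d = 0" by (rule det3_nondegenerate[of e z f]) (use d o sy in \<open>auto simp: lor_simps\<close>)
  then have "lor v w = lor (lor v e *\<^sub>R e + lor v f *\<^sub>R f - lor v z *\<^sub>R z) w" by simp
  then show ?thesis by (simp add: lor_simps lor_sym[of w])
qed

text \<open>Both orthonormal frames at the crossing point have the same orientation, so the angle between
  the normals equals the angle between the tangent directions.\<close>

lemma crossing_lor:
  assumes k: "hyperbolic k" and x: "hyperbolic x" and z: "axis_path k r = axis_path x s"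
  shows "lor (axis_dir k r) (axis_dir x s) = lor (Xzero k) (Xzero x)"
    "(lor (Xzero k) (Xzero x))\<^sup>2 + (lor (axis_dir x s) (Xzero k))\<^sup>2 = 1"
proof -
  define a b c d where "a = lor (Xzero k) (Xzero x)" and "b = lor (Xzero k) (axis_dir x s)"
    and "c = lor (axis_dir k r) (Xzero x)" and "d = lor (axis_dir k r) (axis_dir x s)"
  let ?z = "axis_path x s"
  note K = axis_lor[OF k, of r, unfolded z] and X = axis_lor[OF x, of s]
  have sy: "lor (Xzero k) ?z = 0" "lor (axis_dir k r) ?z = 0" "lor ?z (Xzero x) = 0"
    using K X lor_sym by metis+
  have "det3 (Xzero k) ?z (axis_dir k r) * det3 (Xzero x) ?z (axis_dir x s) = a * d - b * c"
    unfolding det3_gram a_def b_def c_def d_def using K X sy by simp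
  then have 1: "a * d - b * c = 1" using det3_axis_frame[OF k, of r] det3_axis_frame[OF x, of s] z by simp
  note E = lor_frame_expand[OF det3_axis_frame[OF x, of s] X(1,2) Xzero_unit[OF x] X(3,4,5)]
  have 2: "a * a + b * b = 1" using E[of "Xzero k" "Xzero k"] Xzero_unit[OF k] sy by (simp add: a_def b_def)
  have 3: "c * c + d * d = 1" using E[of "axis_dir k r" "axis_dir k r"] K sy by (simp add: c_def d_def)
  \<comment> \<open>The matrix with rows (a, b) and (c, d) has unit rows and determinant 1, hence is
    a rotation: the sum of squares expands to 1 + 1 - 2.\<close>
  have "(a - d)\<^sup>2 + (b + c)\<^sup>2 = 0" using 1 2 3 by (simp add: power2_eq_square algebra_simps)
  then have "a = d" by (simp add: sum_power2_eq_zero_iff)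
  then show "lor (axis_dir k r) (axis_dir x s) = lor (Xzero k) (Xzero x)"
    "(lor (Xzero k) (Xzero x))\<^sup>2 + (lor (axis_dir x s) (Xzero k))\<^sup>2 = 1"
    using 2 lor_sym[of "axis_dir x s"] by (auto simp: a_def b_def d_def power2_eq_square)
qed

lemma cos_crossing_angle:
  assumes k: "hyperbolic k" and x: "hyperbolic x" and z: "axis_path x s \<in> geod_axis k"
  shows "cos (crossing_angle k x (axis_path x s)) =
    (if lor (axis_dir x s) (Xzero k) > 0 then lor (Xzero k) (Xzero x) else - lor (Xzero k) (Xzero x))"
proof -
  obtain r where r: "axis_path k r = axis_path x s" using z by (auto simp: geod_axis_def)
  note C = crossing_lor[OF k x r]
  have fk: "forward k (axis_path x s) = axis_dir k r" using forward_axis_path[OF k, of r] r by simp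
  have "(lor (Xzero k) (Xzero x))\<^sup>2 \<le> 1"
    using C(2) zero_le_power2[of "lor (axis_dir x s) (Xzero k)"] by linarith
  then have "\<bar>lor (Xzero k) (Xzero x)\<bar> \<le> 1" by (simp add: abs_square_le_1)
  then show ?thesis unfolding crossing_angle_def fk forward_axis_path[OF x] on_left_iff[OF k]
    using C(1) by (auto simp: lor_simps cos_arccos_abs)
qed

lemma geod_axis_conj:
  assumes "g \<in> carrier SO21" "hyperbolic x"
  shows "geod_axis (g ** x ** matrix_inv g) = (\<lambda>z. g *v z) ` geod_axis x"
proof -
  note c = hyperbolic_conj[OF assms]
  show ?thesis unfolding geod_axis_eq[OF c(1)] geod_axis_eq[OF assms(2)] c(2)
  proof safe
    fix z assume z: "z \<in> H2" "lor z (g *v Xzero x) = 0"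
    have "z = g *v (ladj g *v z)" using assms by (simp add: ladj_vec)
    moreover have "ladj g *v z \<in> H2" using SO21_H2 ladj_SO21 assms z by blast
    moreover have "lor (ladj g *v z) (Xzero x) = 0" using z by (simp add: lor_ladj)
    ultimately show "z \<in> (*v) g ` {z \<in> H2. lor z (Xzero x) = 0}" by blast
  next
    fix z assume z: "z \<in> H2" "lor z (Xzero x) = 0"
    show "g *v z \<in> H2" "lor (g *v z) (g *v Xzero x) = 0" using SO21_H2 SO21_lor assms z by auto
  qed
qed

text \<open>Tangency makes \<open>Xzero k\<close> orthogonal to both the point and the tangent
  vector, hence a multiple of \<open>Xzero x\<close>.\<close>

lemma axis_crossing_unique:
  assumes x: "hyperbolic x" and k: "hyperbolic k"
    and z: "axis_path x s \<in> geod_axis k" and d: "lor (axis_dir x s) (Xzero k) = 0"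
  shows "geod_axis k = geod_axis x"
proof -
  obtain r where r: "axis_path k r = axis_path x s" using z by (auto simp: geod_axis_def)
  note E = lor_frame_expand[OF det3_axis_frame[OF x, of s] axis_lor(1,2)[OF x] Xzero_unit[OF x] axis_lor(3,4,5)[OF x]]
  have "lor (Xzero k) (axis_path x s) = 0" using axis_lor(4)[OF k, of r] r lor_sym by metis
  moreover have d': "lor (Xzero k) (axis_dir x s) = 0" using d lor_sym by metis
  ultimately have *: "lor (Xzero k) w = lor (Xzero k) (Xzero x) * lor w (Xzero x)" for w
    using E[of "Xzero k" w] by simp
  have "lor (Xzero k) (Xzero x) \<noteq> 0"
    using *[of "Xzero k"] Xzero_unit[OF k] by auto
  then have "lor w (Xzero k) = 0 \<longleftrightarrow> lor w (Xzero x) = 0" for w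
    using *[of w] lor_sym[of w "Xzero k"] by simp
  then show ?thesis unfolding geod_axis_eq[OF x] geod_axis_eq[OF k] by simp
qed

section \<open>The derivative of the translation length\<close>

text \<open>\<open>coshq q\<close> and \<open>sinhq q\<close> are cosh (sqrt q) and sinh (sqrt q) /
  sqrt q as power series in \<open>q\<close>. Without the root they make sense for both signs of
  \<open>q\<close> and are differentiable at 0, where the deformation starts.\<close>

definition coshq :: "real \<Rightarrow> real" where "coshq q = (\<Sum>n. (1 / fact (2 * n)) * q ^ n)"
definition sinhq :: "real \<Rightarrow> real" where "sinhq q = (\<Sum>n. (1 / fact (Suc (2 * n))) * q ^ n)"

lemma summable_coshq: "summable (\<lambda>n. (1 / fact (2 * n)) * (q::real) ^ n)"
  and summable_sinhq: "summable (\<lambda>n. (1 / fact (Suc (2 * n))) * (q::real) ^ n)"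
proof -
  have e: "summable (\<lambda>n. \<bar>q\<bar> ^ n / fact n)"
    using summable_exp[of "\<bar>q\<bar>"] by (simp add: field_simps)
  have "norm ((1 / fact (2 * n)) * q ^ n) \<le> \<bar>q\<bar> ^ n / fact n" for n
    by (auto simp: abs_mult power_abs intro!: divide_left_mono fact_mono)
  then show "summable (\<lambda>n. (1 / fact (2 * n)) * (q::real) ^ n)"
    by (intro summable_comparison_test[OF _ e]) auto
  have "norm ((1 / fact (Suc (2 * n))) * q ^ n) \<le> \<bar>q\<bar> ^ n / fact n" for n
    by (auto simp: abs_mult power_abs simp del: fact_Suc intro!: divide_left_mono fact_mono)
  then show "summable (\<lambda>n. (1 / fact (Suc (2 * n))) * (q::real) ^ n)"
    by (intro summable_comparison_test[OF _ e]) auto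
qed

text \<open>Padded with zeros so that the even and odd parts can be added term by term to the series
  of \<open>mexp\<close>.\<close>

lemma coshq_sums: "(\<lambda>n. if even n then q ^ (n div 2) / fact n else 0) sums coshq q"
proof -
  have "(\<lambda>n. (1 / fact (2 * n)) * q ^ n) sums coshq q"
    unfolding coshq_def by (rule summable_sums[OF summable_coshq])
  then have "(\<lambda>n. (\<lambda>n. if even n then q ^ (n div 2) / fact n else 0) (2 * n)) sums coshq q" by simp
  then show ?thesis
    by (subst (asm) sums_mono_reindex) (auto simp: strict_mono_def elim!: evenE)
qed

lemma sinhq_sums: "(\<lambda>n. if odd n then q ^ (n div 2) / fact n else 0) sums sinhq q"
proof -
  have "(\<lambda>n. (1 / fact (Suc (2 * n))) * q ^ n) sums sinhq q"
    unfolding sinhq_def by (rule summable_sums[OF summable_sinhq])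
  then have "(\<lambda>n. (\<lambda>n. if odd n then q ^ (n div 2) / fact n else 0) (Suc (2 * n))) sums sinhq q" by simp
  then show ?thesis
    by (subst (asm) sums_mono_reindex) (auto simp: strict_mono_def elim!: oddE)
qed

lemma coshq_square: "coshq (s\<^sup>2) = cosh s" and sinhq_square: "s * sinhq (s\<^sup>2) = sinh s"
proof -
  have "(\<lambda>n. if even n then (s\<^sup>2) ^ (n div 2) / fact n else 0) = (\<lambda>n. if even n then s ^ n /\<^sub>R fact n else 0)"
    by (auto simp: fun_eq_iff power_mult[symmetric] field_simps)
  then show "coshq (s\<^sup>2) = cosh s" using coshq_sums[of "s\<^sup>2"] cosh_converges[of s] sums_unique2 by metis
  have "(\<lambda>n. s * (if odd n then (s\<^sup>2) ^ (n div 2) / fact n else 0)) = (\<lambda>n. if even n then 0 else s ^ n /\<^sub>R fact n)"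
    by (auto simp: fun_eq_iff power_mult[symmetric] field_simps power_Suc[symmetric] simp del: power_Suc)
  then show "s * sinhq (s\<^sup>2) = sinh s"
    using sums_mult[OF sinhq_sums[of "s\<^sup>2"], of s] sinh_converges[of s] sums_unique2 by metis
qed

lemma coshq_neg_square: "coshq (- s\<^sup>2) = cos s" and sinhq_neg_square: "s * sinhq (- s\<^sup>2) = sin s"
proof -
  have "(\<lambda>n. if even n then (- s\<^sup>2) ^ (n div 2) / fact n else 0) = (\<lambda>n. cos_coeff n * s ^ n)"
    by (auto simp: fun_eq_iff cos_coeff_def power_mult[symmetric] power_minus[of "s\<^sup>2"])
  then have "(\<lambda>n. cos_coeff n * s ^ n) sums coshq (- s\<^sup>2)" using coshq_sums[of "- s\<^sup>2"] by simp
  moreover have "(\<lambda>n. cos_coeff n * s ^ n) sums cos s" using cos_converges[of s] by simp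
  ultimately show "coshq (- s\<^sup>2) = cos s" by (rule sums_unique2)
  have "(\<lambda>n. s * (if odd n then (- s\<^sup>2) ^ (n div 2) / fact n else 0)) = (\<lambda>n. sin_coeff n * s ^ n)"
    by (auto simp: fun_eq_iff sin_coeff_def power_mult[symmetric] power_minus[of "s\<^sup>2"] elim!: oddE)
  then have "(\<lambda>n. sin_coeff n * s ^ n) sums (s * sinhq (- s\<^sup>2))"
    using sums_mult[OF sinhq_sums[of "- s\<^sup>2"], of s] by simp
  moreover have "(\<lambda>n. sin_coeff n * s ^ n) sums sin s" using sin_converges[of s] by simp
  ultimately show "s * sinhq (- s\<^sup>2) = sin s" by (rule sums_unique2)
qed

text \<open>For \<open>q \<ge> 0\<close> this is the identity for cosh and sinh, otherwise the one
  for cos and sin. It gives the exponential determinant 1.\<close>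

lemma coshq_sinhq: "(coshq q)\<^sup>2 - q * (sinhq q)\<^sup>2 = 1"
proof (cases "q \<ge> 0")
  case True
  define s where "s = sqrt q"
  have q: "q = s\<^sup>2" using True by (simp add: s_def)
  have "s\<^sup>2 * (sinhq (s\<^sup>2))\<^sup>2 = (sinh s)\<^sup>2" by (metis power_mult_distrib sinhq_square)
  then show ?thesis unfolding q coshq_square by (simp add: cosh_square_eq)
next
  case False
  define s where "s = sqrt (- q)"
  have q: "q = - s\<^sup>2" using False by (simp add: s_def)
  have "s\<^sup>2 * (sinhq (- s\<^sup>2))\<^sup>2 = (sin s)\<^sup>2" by (metis power_mult_distrib sinhq_neg_square)
  then show ?thesis unfolding q coshq_neg_square by (simp add: cos_squared_eq)
qed

lemma coshq_zero: "coshq 0 = 1" and sinhq_zero: "sinhq 0 = 1"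
proof -
  show "coshq 0 = 1" using coshq_square[of 0] by simp
  have "(\<lambda>n. (1 / fact (Suc (2 * n))) * (0::real) ^ n) sums sinhq 0"
    unfolding sinhq_def by (rule summable_sums[OF summable_sinhq])
  then show "sinhq 0 = 1" by (subst (asm) powser_sums_zero_iff) simp
qed

text \<open>Mere existence suffices: the chain rule multiplies these derivatives by that of
  \<open>lor (w t) (w t)\<close>, which vanishes at 0.\<close>

lemma DERIV_coshq_0: "\<exists>c. (coshq has_real_derivative c) (at 0)"
  and DERIV_sinhq_0: "\<exists>c. (sinhq has_real_derivative c) (at 0)"
  unfolding coshq_def[abs_def] sinhq_def[abs_def]
  by (rule exI, rule termdiffs_strong[OF summable_coshq[of 1]], simp)
    (rule exI, rule termdiffs_strong[OF summable_sinhq[of 1]], simp)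

section \<open>Exponentials of traceless two-by-two matrices\<close>

lemma scaleR_mm:
  "(c *\<^sub>R A) ** B = c *\<^sub>R (A ** B :: real^'n^'m)" "A ** (c *\<^sub>R B) = c *\<^sub>R (A ** B)"
  by (simp_all add: vec_eq_iff matrix_matrix_mult_def sum_distrib_left algebra_simps)

lemma mm_add:
  "(A + B) ** C = A ** C + B ** (C :: real^'n^'m)" "C' ** (A + B) = C' ** A + C' ** B"
  by (simp_all add: vec_eq_iff matrix_matrix_mult_def sum.distrib algebra_simps)

lemma vec2_eq_iff: "(X::real^2^2) = Y \<longleftrightarrow> X$1$1 = Y$1$1 \<and> X$1$2 = Y$1$2 \<and> X$2$1 = Y$2$1 \<and> X$2$2 = Y$2$2"
  by (simp add: vec_eq_iff forall_2)

lemma mm2: "((A::real^2^2) ** B)$i$j = A$i$1 * B$1$j + A$i$2 * B$2$j"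
  by (simp add: matrix_matrix_mult_def sum_2)

lemma trace2: "trace (X::real^2^2) = X$1$1 + X$2$2"
  by (simp add: trace_def sum_2)

lemma traceless_square:
  assumes "trace (X::real^2^2) = 0"
  shows "X ** X = (trace (X ** X) / 2) *\<^sub>R mat 1" "det X = - trace (X ** X) / 2"
proof -
  have "X$2$2 = - X$1$1" using assms by (simp add: trace2)
  then show "X ** X = (trace (X ** X) / 2) *\<^sub>R mat 1" "det X = - trace (X ** X) / 2"
    by (simp_all add: vec2_eq_iff mm2 trace2 mat_def det_2)
qed

lemma mexp_traceless:
  assumes "trace (X::real^2^2) = 0"
  defines "q \<equiv> trace (X ** X) / 2"
  shows "mexp X = coshq q *\<^sub>R mat 1 + sinhq q *\<^sub>R X"
proof -
  have sq: "X ** X = q *\<^sub>R mat 1" using traceless_square[OF assms(1)] by (simp add: q_def)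
  have pw: "((**) X ^^ n) (mat 1) = (if even n then q ^ (n div 2) *\<^sub>R mat 1 else q ^ (n div 2) *\<^sub>R X)" for n
  proof (induction n)
    case (Suc n)
    then show ?case
      by (auto simp: scaleR_mm sq elim!: evenE oddE)
  qed simp
  have "(\<lambda>n. (if even n then q ^ (n div 2) / fact n else 0) *\<^sub>R mat 1 + (if odd n then q ^ (n div 2) / fact n else 0) *\<^sub>R X)
     sums (coshq q *\<^sub>R mat 1 + sinhq q *\<^sub>R X)"
    by (intro sums_add sums_scaleR_left coshq_sums sinhq_sums)
  also have "(\<lambda>n. (if even n then q ^ (n div 2) / fact n else 0) *\<^sub>R mat 1 + (if odd n then q ^ (n div 2) / fact n else 0) *\<^sub>R X)
    = (\<lambda>n. (1 / fact n) *\<^sub>R ((**) X ^^ n) (mat 1))"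
    by (auto simp: fun_eq_iff pw)
  finally show ?thesis unfolding mexp_def by (simp add: sums_iff)
qed

lemma mexp_SL2R:
  assumes "trace (X::real^2^2) = 0" shows "mexp X \<in> carrier SL2R"
proof -
  let ?q = "trace (X ** X) / 2"
  have tr: "X$2$2 = - X$1$1" using assms by (simp add: trace2)
  have "det (mexp X) = (coshq ?q)\<^sup>2 + (sinhq ?q)\<^sup>2 * det X"
    unfolding mexp_traceless[OF assms] by (simp add: det_2 mat_def tr power2_eq_square algebra_simps)
  also have "det X = - ?q" using traceless_square(2)[OF assms] by simp
  finally have "det (mexp X) = 1" using coshq_sinhq[of ?q] by (simp add: algebra_simps)
  then show ?thesis by (simp add: SL2R_def)
qed

text \<open>The standard identification, for which \<open>lor v v\<close> is
  \<open>- det (stdJ v)\<close>. An arbitrary \<open>J\<close> is compared with it so that traces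
  can be computed in coordinates.\<close>

definition stdJ :: "real^3 \<Rightarrow> real^2^2"
  where "stdJ v = vector [vector [v$1, v$2 + v$3], vector [v$2 - v$3, - v$1]]"

definition stdJ_inv :: "real^2^2 \<Rightarrow> real^3"
  where "stdJ_inv X = vector [(X$1$1 - X$2$2) / 2, (X$1$2 + X$2$1) / 2, (X$1$2 - X$2$1) / 2]"

lemma stdJ_inv: "stdJ_inv (stdJ v) = v" "trace X = 0 \<Longrightarrow> stdJ (stdJ_inv X) = X"
  by (auto simp: stdJ_def stdJ_inv_def vec3_eq_iff vec2_eq_iff trace2 field_simps)

lemma lor_stdJ_inv:
  "trace X = 0 \<Longrightarrow> trace Y = 0 \<Longrightarrow> lor (stdJ_inv X) (stdJ_inv Y) = trace (X ** Y) / 2"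
  by (simp add: stdJ_inv_def lor_def trace2 mm2 eq_neg_iff_add_eq_0[symmetric] field_simps)

lemma linear_stdJ_inv: "linear stdJ_inv"
  by (rule linearI) (auto simp: stdJ_inv_def vec3_eq_iff field_simps)

lemma linear_stdJ: "linear stdJ"
  by (rule linearI) (auto simp: stdJ_def vec2_eq_iff field_simps)

lemma matrix_inv_2:
  assumes "det (A::real^2^2) = 1"
  shows "matrix_inv A = vector [vector [A$2$2, - A$1$2], vector [- A$2$1, A$1$1]]"
  by (rule matrix_inv_eqI) (use assms in \<open>auto simp: vec2_eq_iff mm2 mat_def det_2 algebra_simps\<close>)

lemma trace_scaleR: "trace (c *\<^sub>R A) = c * trace (A :: real^'n^'n)"
  by (simp add: trace_def sum_distrib_left)

text \<open>The character of the adjoint representation: eigenvalues a and 1/a of \<open>A\<close>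
  give a^2, 1 and a^-2, whose sum is (a + 1/a)^2 - 1.\<close>

lemma trace_stdAd:
  assumes "det (A::real^2^2) = 1"
  shows "trace (matrix (\<lambda>v. stdJ_inv (A ** stdJ v ** matrix_inv A))) = (trace A)\<^sup>2 - 1"
proof -
  have d: "A$1$1 * A$2$2 = 1 + A$1$2 * A$2$1" using assms by (simp add: det_2)
  show ?thesis unfolding matrix_inv_2[OF assms]
    using d by (simp add: trace_def[where 'n=3] sum_3 matrix_def stdJ_def stdJ_inv_def axis_def mm2 trace2
        field_simps power2_eq_square)
qed

text \<open>\<open>stdJ_inv \<circ> J\<close> preserves \<open>lor\<close>, hence is invertible, and
  it conjugates \<open>\<rho> A\<close> to the standard adjoint action of \<open>A\<close>, which
  has the same trace.\<close>

lemma trace_gm: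
  assumes gm: "gm_identification \<rho> J" and A: "A \<in> carrier SL2R"
  shows "trace (\<rho> A) = (trace A)\<^sup>2 - 1"
proof -
  have dA: "det A = 1" using A by (simp add: SL2R_def)
  have linJ: "linear J" and trJ: "\<And>v. trace (J v) = 0" and lorJ: "\<And>v w. trace (J v ** J w) / 2 = lor v w"
    and eqJ: "\<And>v. J (\<rho> A *v v) = A ** J v ** matrix_inv A"
    using gm A unfolding gm_identification_def by (auto simp: bij_betw_def)
  define f where "f = stdJ_inv \<circ> J"
  define M where "M = matrix f"
  define g where "g = (\<lambda>v. stdJ_inv (A ** stdJ v ** matrix_inv A))"
  have "linear f" unfolding f_def by (rule linear_compose[OF linJ linear_stdJ_inv])
  then have M: "M *v v = f v" for v by (simp add: M_def matrix_works)
  have "linear (\<lambda>v. A ** stdJ v ** matrix_inv A)"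
    using linear_stdJ by (auto intro!: linearI simp: linear_add linear_scale mm_add scaleR_mm)
  then have "linear g" unfolding g_def using linear_compose[OF _ linear_stdJ_inv] by (simp add: o_def)
  then have "matrix g *v v = g v" for v by (simp add: matrix_works)
  then have R: "matrix g *v v = stdJ_inv (A ** stdJ v ** matrix_inv A)" for v by (simp only: g_def)
  have Mlor: "lor (M *v v) (M *v w) = lor v w" for v w
    unfolding M f_def by (simp add: lor_stdJ_inv trJ lorJ)
  have lM: "ladj M ** M = mat 1"
  proof -
    have "(ladj M ** M) *v x = mat 1 *v x" for x
      by (rule lor_eqI) (simp add: matrix_vector_mul_assoc[symmetric] lor_ladj Mlor)
    then show ?thesis by (metis matrix_eq)
  qed
  then have rM: "M ** ladj M = mat 1" using matrix_left_right_inverse by blast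
  have "(M ** \<rho> A) *v v = (matrix g ** M) *v v" for v
    by (simp add: matrix_vector_mul_assoc[symmetric] M R f_def eqJ stdJ_inv trJ)
  then have MR: "M ** \<rho> A = matrix g ** M" by (metis matrix_eq)
  have "trace (\<rho> A) = trace (ladj M ** (M ** \<rho> A))" by (simp add: matrix_mul_assoc lM)
  also have "\<dots> = trace ((matrix g ** M) ** ladj M)" unfolding MR by (rule trace_mul_sym)
  also have "\<dots> = trace (matrix g)" by (simp add: matrix_mul_assoc[symmetric] rM)
  finally show ?thesis unfolding g_def trace_stdAd[OF dA] .
qed

lemma gm_hyperbolic_eq:
  assumes gm: "gm_identification \<rho> J" and x: "hyperbolic x"
  shows "x = \<rho> (cosh (tlen x / 2) *\<^sub>R mat 1 + sinh (tlen x / 2) *\<^sub>R J (Xzero x))"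
proof -
  have J: "linear J" "\<And>v. trace (J v) = 0" "\<And>v w. trace (J v ** J w) / 2 = lor v w"
    using gm unfolding gm_identification_def by (auto simp: bij_betw_def)
  let ?l = "tlen x / 2"
  have "?l *\<^sub>R J (Xzero x) = J (?l *\<^sub>R Xzero x)" using J(1) by (simp add: linear_scale)
  then have m: "mexp (?l *\<^sub>R J (Xzero x)) = coshq (?l\<^sup>2) *\<^sub>R mat 1 + sinhq (?l\<^sup>2) *\<^sub>R J (?l *\<^sub>R Xzero x)"
    using mexp_traceless[OF J(2), of "?l *\<^sub>R Xzero x"] Xzero_unit[OF x]
    by (simp add: J(3) lor_simps power2_eq_square)
  have "mexp (?l *\<^sub>R J (Xzero x)) = cosh ?l *\<^sub>R mat 1 + sinh ?l *\<^sub>R J (Xzero x)"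
    unfolding m linear_scale[OF J(1)] coshq_square sinhq_square[symmetric] by (simp add: mult.commute)
  moreover have "x = \<rho> (mexp (?l *\<^sub>R J (Xzero x)))" using gm x unfolding gm_identification_def by blast
  ultimately show ?thesis by simp
qed

lemma hyperbolic_eqI:
  assumes "gm_identification \<rho> J" "hyperbolic x" "hyperbolic y" "tlen x = tlen y" "Xzero x = Xzero y"
  shows "x = y"
  using gm_hyperbolic_eq[OF assms(1,2)] gm_hyperbolic_eq[OF assms(1,3)] assms(4,5) by simp

text \<open>Both factors lift to exponentials of traceless matrices. In the trace of their product
  the mixed terms vanish, and the product of the traceless parts contributes the pairing of
  \<open>w\<close> with \<open>Xzero x\<close>.\<close>

lemma trace_deformed:
  assumes gm: "gm_identification \<rho> J" and x: "hyperbolic x"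
  shows "trace (\<rho> (mexp (J w)) ** x) =
    (2 * coshq (lor w w) * cosh (tlen x / 2) + 2 * sinhq (lor w w) * sinh (tlen x / 2) * lor w (Xzero x))\<^sup>2 - 1"
proof -
  have J: "linear J" "\<And>v. trace (J v) = 0" "\<And>v w. trace (J v ** J w) / 2 = lor v w"
    and hom: "\<rho> \<in> hom SL2R SO21"
    using gm unfolding gm_identification_def by (auto simp: bij_betw_def)
  define c s where "c = cosh (tlen x / 2)" and "s = sinh (tlen x / 2)"
  define B where "B = c *\<^sub>R mat 1 + s *\<^sub>R J (Xzero x)"
  have X22: "J v $2$2 = - J v $1$1" for v using J(2)[of v] by (simp add: trace2)
  have tr: "trace (J w ** J (Xzero x)) = 2 * lor w (Xzero x)" using J(3)[of w "Xzero x"] by simp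
  have "det (J (Xzero x)) = -1" using traceless_square(2)[OF J(2), of "Xzero x"] Xzero_unit[OF x] J(3)[of "Xzero x" "Xzero x"] by simp
  then have "det B = c\<^sup>2 - s\<^sup>2" unfolding B_def det_2 
    by (simp add: mat_def X22 power2_eq_square algebra_simps) (simp add: distrib_left[symmetric])
  then have B: "B \<in> carrier SL2R" by (simp add: SL2R_def c_def s_def cosh_square_eq)
  have xB: "x = \<rho> B" using gm_hyperbolic_eq[OF gm x] by (simp add: B_def c_def s_def)
  let ?A = "mexp (J w)"
  have A: "?A \<in> carrier SL2R" by (rule mexp_SL2R[OF J(2)])
  have "\<rho> ?A ** x = \<rho> (?A ** B)" using hom_mult[OF hom A B] xB by (simp add: SL2R_def)
  moreover have "?A ** B \<in> carrier SL2R" using A B by (simp add: SL2R_def det_mul)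
  ultimately have "trace (\<rho> ?A ** x) = (trace (?A ** B))\<^sup>2 - 1" by (simp add: trace_gm[OF gm])
  moreover have "trace (?A ** B) = 2 * coshq (lor w w) * c + 2 * sinhq (lor w w) * s * lor w (Xzero x)"
    unfolding mexp_traceless[OF J(2)] J(3) B_def
    by (simp add: mm_add scaleR_mm trace_add trace_scaleR J(2) tr) (simp add: trace2 mat_def algebra_simps)
  ultimately show ?thesis by (simp add: c_def s_def)
qed

text \<open>The length is \<open>arcosh ((T t - 1) / 2)\<close> for the trace \<open>T\<close>. The
  derivative of \<open>T\<close> at 0 is \<open>4 * sinh (tlen x)\<close> times the pairing, and
  that of arcosh at \<open>cosh (tlen x)\<close> is the reciprocal of \<open>sinh (tlen x)\<close>,
  which leaves the factor 2.\<close>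

lemma DERIV_tlen_deformation:
  assumes gm: "gm_identification \<rho> J" and x: "hyperbolic x"
    and w: "(w has_vector_derivative v) (at 0)" "w 0 = 0"
    and \<psi>: "\<And>t. \<psi> t \<in> carrier SO21" "\<psi> 0 = x" "\<forall>\<^sub>F t in at 0. \<psi> t = \<rho> (mexp (J (w t))) ** x"
  shows "((\<lambda>t. tlen (\<psi> t)) has_real_derivative 2 * lor v (Xzero x)) (at 0)"
proof -
  let ?l = "tlen x"
  have l: "?l > 0" by (rule tlen_pos[OF x])
  define q where "q = (\<lambda>t. lor (w t) (w t))"
  define p where "p = (\<lambda>t. lor (w t) (Xzero x))"
  define F where "F = (\<lambda>t. 2 * coshq (q t) * cosh (?l / 2) + 2 * sinhq (q t) * sinh (?l / 2) * p t)"
  define T where "T = (\<lambda>t. (F t)\<^sup>2 - 1)"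
  have comp: "((\<lambda>t. w t $ i) has_real_derivative v $ i) (at 0)" for i
    using bounded_linear.has_vector_derivative[OF bounded_linear_vec_nth w(1)]
    by (simp add: has_real_derivative_iff_has_vector_derivative)
  \<comment> \<open>Because \<open>q\<close> is quadratic in \<open>w\<close> and
    \<open>w 0 = 0\<close>.\<close>
  have q': "(q has_real_derivative 0) (at 0)" unfolding q_def lor_def
    by (auto intro!: derivative_eq_intros comp simp: w)
  have p': "(p has_real_derivative lor v (Xzero x)) (at 0)" unfolding p_def lor_def
    by (auto intro!: derivative_eq_intros comp)
  have q0: "q 0 = 0" "p 0 = 0" by (simp_all add: q_def p_def w lor_simps)
  obtain c1 where "(coshq has_real_derivative c1) (at (q 0))" using DERIV_coshq_0 q0 by auto
  from DERIV_chain2[OF this q'] have C': "((\<lambda>t. coshq (q t)) has_real_derivative 0) (at 0)" by simp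
  obtain c2 where "(sinhq has_real_derivative c2) (at (q 0))" using DERIV_sinhq_0 q0 by auto
  from DERIV_chain2[OF this q'] have S': "((\<lambda>t. sinhq (q t)) has_real_derivative 0) (at 0)" by simp
  have F': "(F has_real_derivative 2 * sinh (?l / 2) * lor v (Xzero x)) (at 0)" unfolding F_def
    by (rule derivative_eq_intros C' S' p' refl)+ (simp add: q0 sinhq_zero)
  have F0: "F 0 = 2 * cosh (?l / 2)" by (simp add: F_def q0 coshq_zero)
  have T': "(T has_real_derivative 2 * F 0 * (2 * sinh (?l / 2) * lor v (Xzero x))) (at 0)"
    unfolding T_def by (rule derivative_eq_intros F' refl)+ simp
  have T0: "(T 0 - 1) / 2 = cosh ?l" using cosh_double_cosh[of "?l / 2"] by (simp add: T_def F0 power_mult_distrib)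
  have sh: "2 * F 0 * (2 * sinh (?l / 2) * lor v (Xzero x)) = 4 * sinh ?l * lor v (Xzero x)"
    using sinh_double[of "?l / 2"] by (simp add: F0)
  \<comment> \<open>A neighbourhood including 0 itself is required to differentiate through an
    eventual equality.\<close>
  have trT: "\<forall>\<^sub>F t in nhds 0. trace (\<psi> t) = T t"
  proof -
    have 1: "trace (\<rho> (mexp (J (w t))) ** x) = T t" for t
      unfolding trace_deformed[OF gm x] T_def F_def q_def p_def by simp
    have "linear J" using gm by (simp add: gm_identification_def)
    then have "mexp (J (w 0)) = mat 1"
      using mexp_traceless[of 0] w by (simp add: linear_0 trace2 coshq_zero)
    then have "\<rho> (mexp (J (w 0))) = mat 1" using gm by (simp add: gm_identification_def SL2R_def)
    then have "trace (\<psi> 0) = T 0" using 1[of 0] \<psi>(2) by simp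
    moreover have "\<forall>\<^sub>F t in at 0. trace (\<psi> t) = T t" using \<psi>(3) by eventually_elim (simp add: 1)
    ultimately show ?thesis by (simp add: eventually_nhds_conv_at)
  qed
  have "isCont T 0" using T' by (rule DERIV_isCont)
  moreover have "T 0 > 3" using T0 cosh_real_nonneg_less_iff[of 0 ?l] l by simp
  ultimately have "\<forall>\<^sub>F t in at 0. T t > 3" unfolding isCont_def by (rule order_tendstoD)
  then have "\<forall>\<^sub>F t in nhds 0. T t > 3" using \<open>T 0 > 3\<close> by (simp add: eventually_nhds_conv_at)
  with trT have ev: "\<forall>\<^sub>F t in nhds 0. tlen (\<psi> t) = arcosh ((T t - 1) / 2)"
    by eventually_elim (metis \<psi>(1) tlen_trace)
  have "cosh ?l > 1" using cosh_real_nonneg_less_iff[of 0 ?l] l by simp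
  have "((\<lambda>t. arcosh ((T t - 1) / 2)) has_real_derivative
      (1 / sqrt ((cosh ?l)\<^sup>2 - 1)) * (4 * sinh ?l * lor v (Xzero x) / 2)) (at 0)"
  proof (rule DERIV_chain2[where f = arcosh])
    show "(arcosh has_real_derivative 1 / sqrt ((cosh ?l)\<^sup>2 - 1)) (at ((T 0 - 1) / 2))"
      unfolding T0 by (rule arcosh_real_has_field_derivative[OF \<open>cosh ?l > 1\<close>])
    show "((\<lambda>t. (T t - 1) / 2) has_real_derivative 4 * sinh ?l * lor v (Xzero x) / 2) (at 0)"
      using DERIV_cdivide[OF DERIV_diff[OF T'[unfolded sh] DERIV_const[of 1]], of 2] by simp
  qed
  moreover have "sqrt ((cosh ?l)\<^sup>2 - 1) = sinh ?l" using l by (simp add: cosh_square_eq)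
  moreover have "sinh ?l \<noteq> 0" using l by simp
  ultimately have "((\<lambda>t. arcosh ((T t - 1) / 2)) has_real_derivative 2 * lor v (Xzero x)) (at 0)" by simp
  then show ?thesis using DERIV_cong_ev[OF refl ev refl] by blast
qed

section \<open>Discrete groups of hyperbolic isometries\<close>

text \<open>The (3,3) entry bounds the last row, since \<open>ladj k *v axis 3 1\<close> has norm
  -1; the norm of each column then bounds its other entries.\<close>

lemma SO21_entry_bound:
  assumes k: "k \<in> carrier SO21" shows "\<bar>k$i$j\<bar> \<le> 1 + k$3$3"
proof -
  have k33: "k$3$3 > 0" using k by (simp add: SO21_carrier)
  have "lor (ladj k *v axis 3 1) (ladj k *v axis 3 1) = -1"
    using SO21_lor[OF ladj_SO21[OF k]] by (simp add: lor_e3)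
  then have row: "(k$3$1)\<^sup>2 + (k$3$2)\<^sup>2 = (k$3$3)\<^sup>2 - 1"
    by (simp add: lor_def mv3 ladj_nth axis_def power2_eq_square)
  have "lor (k *v axis j 1) (k *v axis j 1) = lor (axis j 1) (axis j 1)" by (rule SO21_lor[OF k])
  then have "(k$1$j)\<^sup>2 + (k$2$j)\<^sup>2 = (k$3$j)\<^sup>2 + lor (axis j 1) (axis j 1)"
    by (simp add: lor_def matrix_vector_mult_basis column_def power2_eq_square)
  moreover have "lor (axis j 1) (axis j 1) \<le> 1" by (simp add: lor_def axis_def)
  moreover have r: "(k$3$j)\<^sup>2 \<le> (k$3$3)\<^sup>2"
  proof -
    have "(k$3$1)\<^sup>2 \<le> (k$3$3)\<^sup>2" "(k$3$2)\<^sup>2 \<le> (k$3$3)\<^sup>2"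
      using row zero_le_power2[of "k$3$1"] zero_le_power2[of "k$3$2"] by linarith+
    then show ?thesis using exhaust_3[of j] by auto
  qed
  ultimately have c: "(k$1$j)\<^sup>2 + (k$2$j)\<^sup>2 \<le> (k$3$3)\<^sup>2 + 1" by linarith
  have "(k$i$j)\<^sup>2 \<le> (k$3$3)\<^sup>2 + 1"
  proof -
    have "(k$1$j)\<^sup>2 \<le> (k$3$3)\<^sup>2 + 1" "(k$2$j)\<^sup>2 \<le> (k$3$3)\<^sup>2 + 1" "(k$3$j)\<^sup>2 \<le> (k$3$3)\<^sup>2 + 1"
      using c r zero_le_power2[of "k$1$j"] zero_le_power2[of "k$2$j"] by linarith+
    then show ?thesis using exhaust_3[of i] by auto
  qed
  also have "\<dots> \<le> (1 + k$3$3)\<^sup>2" using k33 by (simp add: power2_sum)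
  finally show ?thesis using k33 by (simp add: abs_le_square_iff[symmetric])
qed

lemma tendsto_matrix_mult:
  fixes A :: "'a \<Rightarrow> real^'n^'m" and B :: "'a \<Rightarrow> real^'k^'n"
  assumes "(A \<longlongrightarrow> a) F" "(B \<longlongrightarrow> b) F" shows "((\<lambda>t. A t ** B t) \<longlongrightarrow> a ** b) F"
  unfolding matrix_matrix_mult_def
  by (rule vec_tendstoI, rule vec_tendstoI, simp only: vec_lambda_beta)
    (intro tendsto_intros assms)

lemma tendsto_ladj:
  assumes "(A \<longlongrightarrow> a) F" shows "((\<lambda>t. ladj (A t)) \<longlongrightarrow> ladj a) F"
  unfolding ladj_def
  by (rule vec_tendstoI, rule vec_tendstoI, simp only: vec_lambda_beta)
    (intro tendsto_intros assms)

definition conjs :: "(real^3^3) set \<Rightarrow> real^3^3 \<Rightarrow> (real^3^3) set"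
  where "conjs G h = {x ** h ** matrix_inv x | x. x \<in> G}"

locale fuchsian =
  fixes G :: "(real^3^3) set"
  assumes G_subgroup: "subgroup G SO21"
    and G_discrete: "discrete G"
    and G_hyperbolic: "\<And>x. x \<in> G \<Longrightarrow> x \<noteq> mat 1 \<Longrightarrow> hyperbolic x"
begin

lemma G_SO21: "x \<in> G \<Longrightarrow> x \<in> carrier SO21"
  using G_subgroup by (auto dest: subgroup.subset)

lemma G_one: "mat 1 \<in> G"
  using subgroup.one_closed[OF G_subgroup] by simp

lemma G_mult: "x \<in> G \<Longrightarrow> y \<in> G \<Longrightarrow> x ** y \<in> G"
  using subgroup.m_closed[OF G_subgroup] by simp

lemma G_ladj: "x \<in> G \<Longrightarrow> ladj x \<in> G"
  using subgroup.m_inv_closed[OF G_subgroup] inv_SO21[OF G_SO21] by metis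

text \<open>Discreteness isolates the points of \<open>G\<close>, but a limit of elements could lie
  outside \<open>G\<close>. Quotients of consecutive terms of a convergent sequence do lie in
  \<open>G\<close> and tend to the identity, so they eventually equal it.\<close>

lemma finite_bounded_G: "finite {k \<in> G. k$3$3 \<le> M}"
proof (rule ccontr)
  assume "infinite {k \<in> G. k$3$3 \<le> M}"
  then obtain f :: "nat \<Rightarrow> real^3^3" where f: "inj f" "range f \<subseteq> {k \<in> G. k$3$3 \<le> M}"
    using infinite_countable_subset by blast
  have "norm (f n) \<le> 9 * (1 + M)" for n
  proof -
    have fn: "f n \<in> G" "f n $3$3 \<le> M" using f by auto
    have "norm (f n $ i) \<le> 3 * (1 + M)" for i
    proof -
      have "norm (f n $ i) \<le> (\<Sum>j\<in>UNIV. \<bar>f n $ i $ j\<bar>)" by (rule norm_le_l1_cart)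
      also have "\<dots> \<le> (\<Sum>j\<in>(UNIV::3 set). 1 + M)"
        using SO21_entry_bound[OF G_SO21[OF fn(1)]] fn(2) by (intro sum_mono) (meson add_left_mono order_trans)
      finally show ?thesis by simp
    qed
    then have "(\<Sum>i\<in>UNIV. norm (f n $ i)) \<le> (\<Sum>i\<in>(UNIV::3 set). 3 * (1 + M))" by (intro sum_mono)
    moreover have "norm (f n) \<le> (\<Sum>i\<in>UNIV. norm (f n $ i))"
      unfolding norm_vec_def by (rule L2_set_le_sum) simp
    ultimately show ?thesis by simp
  qed
  then have "bounded (range f)" by (auto simp: bounded_iff)
  then obtain l r where r: "strict_mono (r :: nat \<Rightarrow> nat)" and lim: "(f \<circ> r) \<longlonglongrightarrow> l"
    using bounded_imp_convergent_subsequence by blast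
  define k where "k = f \<circ> r"
  have kG: "k n \<in> G" for n using f by (auto simp: k_def)
  have lim: "k \<longlonglongrightarrow> l" using lim by (simp add: k_def)
  have "(\<lambda>n. ladj (k n) ** k n) \<longlonglongrightarrow> ladj l ** l" by (intro tendsto_matrix_mult tendsto_ladj lim)
  moreover have "ladj (k n) ** k n = mat 1" for n using ladj_mult[OF G_SO21[OF kG]] by blast
  ultimately have "(\<lambda>n::nat. mat 1 :: real^3^3) \<longlonglongrightarrow> ladj l ** l" by simp
  then have l: "ladj l ** l = mat 1" using LIMSEQ_unique tendsto_const by blast
  have "(\<lambda>n. ladj (k n) ** k (Suc n)) \<longlonglongrightarrow> ladj l ** l"
    by (intro tendsto_matrix_mult tendsto_ladj lim LIMSEQ_Suc)
  moreover obtain T where T: "open T" "T \<inter> G = {mat 1}"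
    using G_discrete G_one unfolding discrete_def isolated_in_def by blast
  moreover have "ladj l ** l \<in> T" using T l by blast
  ultimately have "\<forall>\<^sub>F n in sequentially. ladj (k n) ** k (Suc n) \<in> T"
    using topological_tendstoD by blast
  then obtain n where "ladj (k n) ** k (Suc n) \<in> T" 
    unfolding eventually_sequentially by blast
  then have "ladj (k n) ** k (Suc n) = mat 1" using T G_mult[OF G_ladj[OF kG] kG] by blast
  then have "k n ** (ladj (k n) ** k (Suc n)) = k n" by simp
  then have "k (Suc n) = k n" by (simp add: matrix_mul_assoc ladj_mult[OF G_SO21[OF kG]])
  then have "r (Suc n) = r n" using f(1) by (simp add: k_def inj_eq)
  then show False using r by (simp add: strict_mono_eq)
qed

end

text \<open>\<open>z$3\<close> is the hyperbolic cosine of the distance from \<open>axis 3 1\<close>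
  to \<open>z\<close>, and \<open>\<bar>v$3\<bar>\<close> the hyperbolic sine of the distance to the
  geodesic orthogonal to \<open>v\<close>, on which \<open>z\<close> lies.\<close>

lemma orthogonal_height:
  assumes "z \<in> H2" "lor z v = 0" "lor v v = 1" shows "(v$3)\<^sup>2 \<le> (z$3)\<^sup>2"
proof -
  have z: "(z$1)\<^sup>2 + (z$2)\<^sup>2 = (z$3)\<^sup>2 - 1" and v: "(v$1)\<^sup>2 + (v$2)\<^sup>2 = 1 + (v$3)\<^sup>2"
    using assms by (simp_all add: H2_iff lor_def power2_eq_square)
  have "z$1 * v$1 + z$2 * v$2 = z$3 * v$3" using assms by (simp add: lor_def)
  then have "(z$3 * v$3)\<^sup>2 \<le> ((z$3)\<^sup>2 - 1) * (1 + (v$3)\<^sup>2)"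
    using cauchy_schwarz_2[of "z$1" "v$1" "z$2" "v$2"] z v by simp
  also have "\<dots> = (z$3)\<^sup>2 - 1 + (z$3 * v$3)\<^sup>2 - (v$3)\<^sup>2" by (simp add: power_mult_distrib algebra_simps)
  finally show ?thesis by simp
qed

section \<open>Local finiteness of the lifts of \<open>h\<close>\<close>

locale fuchsian_elem = fuchsian +
  fixes h :: "real^3^3"
  assumes h_G: "h \<in> G" and h_ne: "h \<noteq> mat 1"
begin

lemma h_hyperbolic: "hyperbolic h"
  using G_hyperbolic h_G h_ne by blast

lemma conjsE:
  assumes "k \<in> conjs G h"
  obtains x where "x \<in> G" "k = x ** h ** matrix_inv x" "hyperbolic k" "Xzero k = x *v Xzero h"
    "tlen k = tlen h" "geod_axis k = (\<lambda>z. x *v z) ` geod_axis h" "k \<in> G"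
proof -
  obtain x where x: "x \<in> G" "k = x ** h ** matrix_inv x" using assms by (auto simp: conjs_def)
  note S = G_SO21[OF x(1)]
  have "k \<in> G" unfolding x matrix_inv_SO21[OF S] by (intro G_mult G_ladj x h_G)
  then show ?thesis
    using that[OF x] hyperbolic_conj[OF S h_hyperbolic] geod_axis_conj[OF S h_hyperbolic] x(2) by simp
qed

lemma conjsI: "x \<in> G \<Longrightarrow> x ** h ** matrix_inv x \<in> conjs G h"
  by (auto simp: conjs_def)

text \<open>All conjugates have the same translation length, so one whose axis descends to bounded
  height moves the point \<open>axis 3 1\<close> by a bounded amount; that displacement is measured
  by \<open>k$3$3\<close>.\<close>

lemma finite_conjs_meeting: "finite {k \<in> conjs G h. \<exists>z\<in>geod_axis k. z$3 \<le> M}"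
proof (rule finite_subset[OF _ finite_bounded_G])
  let ?c = "cosh (tlen h)"
  show "{k \<in> conjs G h. \<exists>z\<in>geod_axis k. z$3 \<le> M} \<subseteq> {k \<in> G. k$3$3 \<le> ?c + M\<^sup>2 * (?c - 1)}"
  proof safe
    fix k z assume k: "k \<in> conjs G h" and z: "z \<in> geod_axis k" "z$3 \<le> M"
    from k show "k \<in> G" by (elim conjsE)
    from k have kh: "hyperbolic k" "tlen k = tlen h" by (elim conjsE, simp)+
    have zz: "z \<in> H2" "lor z (Xzero k) = 0" using z geod_axis_eq[OF kh(1)] by auto
    have "k$3$3 = - lor (axis 3 1) (k *v axis 3 1)"
      unfolding lor_e3 by (simp add: mv3 axis_def)
    also have "\<dots> = ?c + (Xzero k $ 3)\<^sup>2 * (?c - 1)"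
      using hframe_displacement[OF hyperbolic_frame[OF kh(1)] e3_H2] kh(2) by (simp add: lor_e3)
    also have "\<dots> \<le> ?c + M\<^sup>2 * (?c - 1)"
    proof -
      have "(Xzero k $ 3)\<^sup>2 \<le> (z$3)\<^sup>2" by (rule orthogonal_height[OF zz Xzero_unit[OF kh(1)]])
      also have "\<dots> \<le> M\<^sup>2" using z zz by (intro power_mono) (auto simp: H2_iff)
      finally show ?thesis by (simp add: mult_right_mono cosh_real_ge_1)
    qed
    finally show "k$3$3 \<le> ?c + M\<^sup>2 * (?c - 1)" .
  qed
qed

text \<open>The unit normals of a common plane agree up to sign. A change of sign would come from an
  element of \<open>G\<close> with eigenvalue -1, while the eigenvalues of hyperbolic elements are
  positive.\<close>

lemma conjs_eqI:
  assumes gm: "gm_identification \<rho> J" and k: "k \<in> conjs G h" and k': "k' \<in> conjs G h"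
    and eq: "geod_axis k = geod_axis k'"
  shows "k = k'"
proof -
  obtain x where x: "x \<in> G" "hyperbolic k" "Xzero k = x *v Xzero h" "tlen k = tlen h"
    using k by (elim conjsE) auto
  obtain y where y: "y \<in> G" "hyperbolic k'" "Xzero k' = y *v Xzero h" "tlen k' = tlen h"
    using k' by (elim conjsE) auto
  let ?v = "Xzero k'"
  have ax: "lor (axis_path k s) ?v = 0" for s
  proof -
    have "axis_path k s \<in> geod_axis k'" using eq by (auto simp: geod_axis_def)
    then show ?thesis using geod_axis_eq[OF y(2)] by auto
  qed
  have "lor (axis_path k (0 + 1)) ?v = sinh 1 * lor (axis_dir k 0) ?v"
    unfolding axis_path_add by (simp add: lor_simps ax)
  then have dr: "lor (axis_dir k 0) ?v = 0" using ax by simp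
  note E = lor_frame_expand[OF det3_axis_frame[OF x(2), of 0] axis_lor(1,2)[OF x(2)] Xzero_unit[OF x(2)] axis_lor(3,4,5)[OF x(2)]]
  define c where "c = lor ?v (Xzero k)"
  have "lor ?v w = lor (c *\<^sub>R Xzero k) w" for w
    using E[of ?v w] ax[of 0] dr lor_sym[of ?v "axis_path k 0"] lor_sym[of ?v "axis_dir k 0"] lor_sym[of w "Xzero k"]
    by (simp add: c_def lor_simps)
  then have v: "?v = c *\<^sub>R Xzero k" by (rule lor_eqI)
  have "c\<^sup>2 = 1" using Xzero_unit[OF y(2)] Xzero_unit[OF x(2)] unfolding v
    by (simp add: lor_simps power2_eq_square)
  then consider "c = 1" | "c = -1" by (auto simp: power2_eq_1_iff)
  then show ?thesis
  proof cases
    case 1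
    then show ?thesis using hyperbolic_eqI[OF gm x(2) y(2)] x y v by simp
  next
    case 2
    let ?g = "y ** ladj x"
    have g: "?g \<in> G" using x y G_mult G_ladj by blast
    have "?g *v Xzero k = ?v" unfolding y(3) x(3)
      by (simp add: matrix_vector_mul_assoc[symmetric] ladj_vec[OF G_SO21[OF x(1)]])
    then have neg: "?g *v Xzero k = (-1) *\<^sub>R Xzero k" using v 2 by simp
    have ne: "Xzero k \<noteq> 0" using Xzero_unit[OF x(2)] by (auto simp: lor_simps)
    have "?g \<noteq> mat 1"
    proof
      assume "?g = mat 1"
      then have "Xzero k = - Xzero k" using neg by simp
      then show False using ne by (simp add: vec3_eq_iff)
    qed
    then have "hframe ?g (exp (tlen ?g)) (Xplus ?g) (Xminus ?g) (Xzero ?g)"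
      using G_hyperbolic g hyperbolic_frame by blast
    then have "eigenvalues ?g = {1 / exp (tlen ?g), 1, exp (tlen ?g)}" by (rule hframe_eigenvalues)
    moreover have "-1 \<in> eigenvalues ?g" using neg ne unfolding eigenvalues_def by blast
    ultimately show ?thesis by (auto simp: exp_minus[symmetric] inverse_eq_divide[symmetric]) (metis exp_ge_zero neg_0_le_iff_le not_one_le_zero)+
  qed
qed

lemma simple_axes:
  assumes "simple_loop G h" "k \<in> conjs G h" "k' \<in> conjs G h" "z \<in> geod_axis k" "z \<in> geod_axis k'"
  shows "geod_axis k = geod_axis k'"
proof -
  obtain x where x: "x \<in> G" "geod_axis k = (\<lambda>z. x *v z) ` geod_axis h" using assms(2) by (elim conjsE) auto
  obtain y where y: "y \<in> G" "geod_axis k' = (\<lambda>z. y *v z) ` geod_axis h" using assms(3) by (elim conjsE) auto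
  note X = ladj_vec[OF G_SO21[OF x(1)]]
  let ?g = "ladj x ** y"
  have "?g \<in> G" using x y G_mult G_ladj by blast
  moreover obtain a b where "a \<in> geod_axis h" "b \<in> geod_axis h" "z = x *v a" "z = y *v b"
    using assms(4,5) x y by auto
  then have "a = ?g *v b" by (metis X(1) matrix_vector_mul_assoc)
  then have "(\<lambda>z. ?g *v z) ` geod_axis h \<inter> geod_axis h \<noteq> {}"
    using \<open>a \<in> geod_axis h\<close> \<open>b \<in> geod_axis h\<close> by blast
  ultimately have "(\<lambda>z. ?g *v z) ` geod_axis h = geod_axis h" using assms(1) unfolding simple_loop_def by blast
  then have "(\<lambda>z. x *v z) ` (\<lambda>z. ?g *v z) ` geod_axis h = geod_axis k" using x by simp
  moreover have "(\<lambda>z. x *v z) ` (\<lambda>z. ?g *v z) ` geod_axis h = geod_axis k'"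
    unfolding y image_image by (simp add: matrix_vector_mul_assoc[symmetric] X)
  ultimately show ?thesis by simp
qed

lemma crossings_conjs:
  "crossings G h \<sigma> = {(s, k). 0 \<le> s \<and> s < tlen \<sigma> \<and> k \<in> conjs G h \<and>
     axis_path \<sigma> s \<in> geod_axis k \<and> geod_axis k \<noteq> geod_axis \<sigma>}"
  by (simp add: crossings_def conjs_def)

lemma crossing_param_unique:
  assumes "hyperbolic \<sigma>" "hyperbolic k" "axis_path \<sigma> s \<in> geod_axis k" "axis_path \<sigma> t \<in> geod_axis k"
    "geod_axis k \<noteq> geod_axis \<sigma>"
  shows "s = t"
proof -
  have "lor (axis_dir \<sigma> s) (Xzero k) \<noteq> 0" using axis_crossing_unique assms by blast
  moreover have "lor (axis_path \<sigma> s) (Xzero k) = 0" "lor (axis_path \<sigma> t) (Xzero k) = 0"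
    using assms geod_axis_eq by auto
  then have "sinh (t - s) * lor (axis_dir \<sigma> s) (Xzero k) = 0"
    using axis_path_add[of \<sigma> s "t - s"] by (simp add: lor_simps)
  ultimately show ?thesis by simp
qed

text \<open>A transversal axis is met only once, so crossings inject into the conjugates, and over a
  bounded parameter range the path stays below some height.\<close>

lemma finite_crossing_params:
  assumes \<sigma>: "hyperbolic \<sigma>"
  shows "finite {(s, k). a \<le> s \<and> s \<le> b \<and> k \<in> conjs G h \<and> axis_path \<sigma> s \<in> geod_axis k \<and> geod_axis k \<noteq> geod_axis \<sigma>}"
    (is "finite ?C")
proof -
  have "compact ((\<lambda>s. axis_path \<sigma> s $ 3) ` {a..b})"
    by (intro compact_continuous_image continuous_intros) auto
  then obtain M where M: "\<And>s. s \<in> {a..b} \<Longrightarrow> axis_path \<sigma> s $ 3 \<le> M"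
    using compact_imp_bounded bounded_has_Sup(1) by (metis bounded_real abs_le_D1 image_eqI)
  have "inj_on snd ?C"
    using crossing_param_unique[OF \<sigma>] by (auto simp: inj_on_def elim!: conjsE)
  moreover have "snd ` ?C \<subseteq> {k \<in> conjs G h. \<exists>z\<in>geod_axis k. z$3 \<le> M}" using M by force
  from finite_subset[OF this finite_conjs_meeting] have "finite (snd ` ?C)" .
  ultimately show ?thesis by (rule finite_imageD[rotated])
qed

end

section \<open>Geodesic segments and the Nielsen region\<close>

text \<open>The component \<open>?c\<close> of \<open>a\<close> orthogonal to \<open>b\<close> is
  zero or spacelike, and its norm is \<open>(lor a b)\<^sup>2 - 1\<close>.\<close>

lemma lor_H2_le: "a \<in> H2 \<Longrightarrow> b \<in> H2 \<Longrightarrow> lor a b \<le> -1"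
proof -
  assume a: "a \<in> H2" and b: "b \<in> H2"
  have neg: "lor a b < 0" by (rule future_lor_neg) (use a b in \<open>auto simp: H2_iff\<close>)
  let ?c = "a + lor a b *\<^sub>R b"
  have "lor ?c b = 0" using b by (simp add: lor_simps H2_iff)
  then have "lor ?c ?c \<ge> 0"
    using spacelike_of_orthogonal[of b ?c] b lor_sym[of b ?c]
    by (cases "?c = 0") (auto simp: H2_iff lor_zero_left)
  then have "1 \<le> (lor a b)\<^sup>2"
    using a b by (simp add: lor_simps H2_iff lor_sym[of b a] power2_eq_square algebra_simps)
  then have "1 \<le> - lor a b" using neg by (simp add: abs_le_square_iff[of 1 "lor a b", simplified, symmetric])
  then show ?thesis by simp
qed

lemma comb_H2:
  assumes a: "a \<in> H2" and b: "b \<in> H2" and c: "\<alpha> \<ge> 0" "\<beta> \<ge> 0" "\<alpha> + \<beta> > 0"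
  defines "v \<equiv> \<alpha> *\<^sub>R a + \<beta> *\<^sub>R b"
  shows "lor v v \<le> - (\<alpha> + \<beta>)\<^sup>2" "(1 / sqrt (- lor v v)) *\<^sub>R v \<in> H2"
proof -
  have "lor v v = - (\<alpha> + \<beta>)\<^sup>2 + 2 * (\<alpha> * \<beta>) * (lor a b + 1)"
    using a b by (simp add: v_def lor_simps H2_iff lor_sym[of b a] power2_eq_square algebra_simps)
  moreover have "(\<alpha> * \<beta>) * (lor a b + 1) \<le> 0"
    using c lor_H2_le[OF a b] by (intro mult_nonneg_nonpos) auto
  ultimately show le: "lor v v \<le> - (\<alpha> + \<beta>)\<^sup>2" by simp
  then have n: "- lor v v > 0" using c by (smt (verit) zero_less_power)
  have "v$3 > 0"
  proof -
    have "\<alpha> * a$3 \<ge> 0" "\<beta> * b$3 \<ge> 0" using a b c by (simp_all add: H2_iff)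
    moreover have "\<alpha> * a$3 > 0 \<or> \<beta> * b$3 > 0" using a b c by (auto simp: H2_iff zero_less_mult_iff)
    ultimately show ?thesis unfolding v_def by auto
  qed
  then show "(1 / sqrt (- lor v v)) *\<^sub>R v \<in> H2"
    using n by (simp add: H2_iff lor_simps)
qed

text \<open>The chord projected radially to the hyperboloid: a geodesic segment, not at constant
  speed, whose points are nonnegative combinations of its ends as in
  \<open>hyp_convex\<close>.\<close>

definition hseg :: "real^3 \<Rightarrow> real^3 \<Rightarrow> real \<Rightarrow> real^3"
  where "hseg a b t = (let v = (1 - t) *\<^sub>R a + t *\<^sub>R b in (1 / sqrt (- lor v v)) *\<^sub>R v)"

text \<open>The projection divides by a number at least 1, whence
  \<open>\<alpha> + \<beta> \<le> 1\<close>; this keeps a segment below the height of its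
  ends.\<close>

lemma hseg_coeffs:
  assumes "a \<in> H2" "b \<in> H2" "0 \<le> t" "t \<le> 1"
  obtains \<alpha> \<beta> where "hseg a b t = \<alpha> *\<^sub>R a + \<beta> *\<^sub>R b" "\<alpha> \<ge> 0" "\<beta> \<ge> 0" "\<alpha> + \<beta> \<le> 1"
    "t < 1 \<Longrightarrow> \<alpha> > 0" "t > 0 \<Longrightarrow> \<beta> > 0" "\<alpha> + \<beta> > 0"
proof -
  let ?v = "(1 - t) *\<^sub>R a + t *\<^sub>R b"
  let ?n = "sqrt (- lor ?v ?v)"
  have "lor ?v ?v \<le> - (1 - t + t)\<^sup>2" using assms by (intro comb_H2) auto
  then have n: "?n \<ge> 1" by simp
  then have n0: "?n > 0" by linarith
  show ?thesis
  proof (rule that[of "(1 - t) / ?n" "t / ?n"])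
    show "hseg a b t = ((1 - t) / ?n) *\<^sub>R a + (t / ?n) *\<^sub>R b"
      by (simp add: hseg_def Let_def scaleR_add_right)
    have "(1 - t) / ?n + t / ?n = 1 / ?n" by (simp add: add_divide_distrib[symmetric])
    then show "(1 - t) / ?n + t / ?n \<le> 1" "(1 - t) / ?n + t / ?n > 0" using n n0 by auto
  qed (use assms n0 in auto)
qed

lemma hseg_ends: "a \<in> H2 \<Longrightarrow> hseg a b 0 = a" "b \<in> H2 \<Longrightarrow> hseg a b 1 = b"
  by (simp_all add: hseg_def H2_iff)

lemma hseg_H2:
  assumes "a \<in> H2" "b \<in> H2" "0 \<le> t" "t \<le> 1" shows "hseg a b t \<in> H2"
  unfolding hseg_def Let_def using assms by (intro comb_H2(2)) auto

lemma hseg_height: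
  assumes "a \<in> H2" "b \<in> H2" "0 \<le> t" "t \<le> 1" "a$3 \<le> M" "b$3 \<le> M" shows "hseg a b t $ 3 \<le> M"
proof -
  obtain \<alpha> \<beta> where c: "hseg a b t = \<alpha> *\<^sub>R a + \<beta> *\<^sub>R b" "\<alpha> \<ge> 0" "\<beta> \<ge> 0" "\<alpha> + \<beta> \<le> 1"
    using hseg_coeffs[OF assms(1-4)] by metis
  have "M \<ge> 0" using assms by (simp add: H2_iff)
  have "\<alpha> * a$3 + \<beta> * b$3 \<le> \<alpha> * M + \<beta> * M"
    using assms c by (intro add_mono mult_left_mono) auto
  also have "\<dots> = (\<alpha> + \<beta>) * M" by (simp add: algebra_simps)
  also have "\<dots> \<le> 1 * M" using c \<open>M \<ge> 0\<close> by (intro mult_right_mono) auto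
  finally show ?thesis using c by simp
qed

lemma continuous_on_hseg:
  assumes "a \<in> H2" "b \<in> H2" shows "continuous_on {0..1} (hseg a b)"
proof -
  have "lor ((1 - t) *\<^sub>R a + t *\<^sub>R b) ((1 - t) *\<^sub>R a + t *\<^sub>R b) < 0" if "t \<in> {0..1}" for t
    using comb_H2(1)[OF assms, of "1 - t" t] that by simp
  then show ?thesis unfolding hseg_def[abs_def] Let_def
    by (intro continuous_intros) (auto simp: less_le)
qed

lemma hseg_convex:
  assumes "hyp_convex C" "a \<in> C" "b \<in> C" "0 \<le> t" "t \<le> 1" shows "hseg a b t \<in> C"
proof -
  have H: "a \<in> H2" "b \<in> H2" using assms by (auto simp: hyp_convex_def)
  obtain \<alpha> \<beta> where "hseg a b t = \<alpha> *\<^sub>R a + \<beta> *\<^sub>R b" "\<alpha> \<ge> 0" "\<beta> \<ge> 0"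
    using hseg_coeffs[OF H assms(4,5)] by metis
  then show ?thesis using assms hseg_H2[OF H assms(4,5)] unfolding hyp_convex_def by metis
qed

lemma hframe_orbit:
  assumes F: "hframe x l p m e"
  shows "((*v) x ^^ n) (a *\<^sub>R e + b *\<^sub>R p + c *\<^sub>R m) = a *\<^sub>R e + (b * l ^ n) *\<^sub>R p + (c / l ^ n) *\<^sub>R m"
    "((*v) (ladj x) ^^ n) (a *\<^sub>R e + b *\<^sub>R p + c *\<^sub>R m) = a *\<^sub>R e + (b / l ^ n) *\<^sub>R p + (c * l ^ n) *\<^sub>R m"
proof -
  have l: "l > 1" and x: "x \<in> carrier SO21" using F by (simp_all add: hframe_def)
  have inv: "ladj x *v (a *\<^sub>R e + b *\<^sub>R p + c *\<^sub>R m) = a *\<^sub>R e + (b / l) *\<^sub>R p + (c * l) *\<^sub>R m" for a b c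
    using ladj_vec(1)[OF x, of "a *\<^sub>R e + (b / l) *\<^sub>R p + (c * l) *\<^sub>R m"] l
    unfolding hframe_mv[OF F] by simp
  show "((*v) x ^^ n) (a *\<^sub>R e + b *\<^sub>R p + c *\<^sub>R m) = a *\<^sub>R e + (b * l ^ n) *\<^sub>R p + (c / l ^ n) *\<^sub>R m"
    by (induction n) (simp_all add: hframe_mv[OF F] mult_ac)
  show "((*v) (ladj x) ^^ n) (a *\<^sub>R e + b *\<^sub>R p + c *\<^sub>R m) = a *\<^sub>R e + (b / l ^ n) *\<^sub>R p + (c * l ^ n) *\<^sub>R m"
    by (induction n) (simp_all add: inv mult_ac)
qed

text \<open>Forward and backward translates of one point approach the two ideal endpoints. Rescaled
  by \<open>\<epsilon> n\<close> they converge to multiples of the null eigenvectors, whose positive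
  combinations fill the axis.\<close>

lemma axis_in_convex:
  assumes x: "hyperbolic x" and C: "C \<noteq> {}" "closed C" "hyp_convex C"
    and inv: "\<And>z. z \<in> C \<Longrightarrow> x *v z \<in> C" "\<And>z. z \<in> C \<Longrightarrow> ladj x *v z \<in> C"
  shows "geod_axis x \<subseteq> C"
proof
  fix y assume "y \<in> geod_axis x"
  then obtain s where y: "y = axis_path x s" by (auto simp: geod_axis_def)
  note F = hyperbolic_frame[OF x]
  note f = F[unfolded hframe_def] and g = hframe_lor[OF F]
  let ?p = "Xplus x" and ?m = "Xminus x" and ?e = "Xzero x" and ?l = "exp (tlen x)"
  obtain N where N: "N > 0" "axis_path x s = (1 / N) *\<^sub>R (exp s *\<^sub>R ?p + exp (- s) *\<^sub>R ?m)"
    using Xpm_norm[OF x] by metis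
  obtain z where z: "z \<in> C" using C by blast
  then have zH: "z \<in> H2" using C by (auto simp: hyp_convex_def)
  define a b d where "a = lor z ?e" and "b = lor z ?m / lor ?p ?m" and "d = lor z ?p / lor ?p ?m"
  have ze: "z = a *\<^sub>R ?e + b *\<^sub>R ?p + d *\<^sub>R ?m"
    using hframe_expand[OF F] by (simp add: a_def b_def d_def)
  have "lor z ?m < 0" "lor z ?p < 0"
    by (rule future_lor_neg; use zH f in \<open>simp add: H2_iff\<close>)+
  then have bd: "b > 0" "d > 0" using g by (simp_all add: b_def d_def divide_neg_neg)
  define \<epsilon> where "\<epsilon> = (\<lambda>n::nat. 1 / ?l ^ n)"
  \<comment> \<open>Chosen so that \<open>\<alpha> * b\<close> and \<open>\<beta> * d\<close> are
    the coefficients of \<open>y\<close>.\<close>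
  define \<alpha> \<beta> where "\<alpha> = exp s / (N * b)" and "\<beta> = exp (- s) / (N * d)"
  have ab: "\<alpha> > 0" "\<beta> > 0" using N bd by (simp_all add: \<alpha>_def \<beta>_def)
  have \<epsilon>pos: "\<epsilon> n > 0" for n by (simp add: \<epsilon>_def)
  have \<epsilon>l: "\<epsilon> n * ?l ^ n = 1" "1 / ?l ^ n = \<epsilon> n" for n by (simp_all add: \<epsilon>_def)
  define u w where "u = (\<lambda>n. ((*v) x ^^ n) z)" and "w = (\<lambda>n. ((*v) (ladj x) ^^ n) z)"
  have uC: "u n \<in> C" "w n \<in> C" for n unfolding u_def w_def by (induction n) (use z inv in auto)
  then have uH: "u n \<in> H2" "w n \<in> H2" for n using C by (auto simp: hyp_convex_def)
  define c where "c = (\<lambda>n. (\<alpha> * \<epsilon> n) *\<^sub>R u n + (\<beta> * \<epsilon> n) *\<^sub>R w n)"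
  have pos: "\<alpha> * \<epsilon> n > 0" "\<beta> * \<epsilon> n > 0" for n using ab \<epsilon>pos by auto
  have cc: "lor (c n) (c n) < 0" "(1 / sqrt (- lor (c n) (c n))) *\<^sub>R c n \<in> H2" for n
    using comb_H2[OF uH(1) uH(2), of "\<alpha> * \<epsilon> n" "\<beta> * \<epsilon> n" n n] pos[of n]
    unfolding c_def by (auto simp: less_le_trans add_pos_pos intro: le_less_trans)
  have "(1 / sqrt (- lor (c n) (c n))) *\<^sub>R c n \<in> C" for n
  proof -
    let ?r = "1 / sqrt (- lor (c n) (c n))"
    have "?r *\<^sub>R c n = (?r * (\<alpha> * \<epsilon> n)) *\<^sub>R u n + (?r * (\<beta> * \<epsilon> n)) *\<^sub>R w n"
      by (simp add: c_def scaleR_add_right)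
    moreover have "?r * (\<alpha> * \<epsilon> n) \<ge> 0" "?r * (\<beta> * \<epsilon> n) \<ge> 0" using pos[of n] cc(1)[of n] by auto
    ultimately show ?thesis using C(3) uC cc(2)[of n] unfolding hyp_convex_def by metis
  qed
  moreover have "(\<lambda>n. (1 / sqrt (- lor (c n) (c n))) *\<^sub>R c n) \<longlonglongrightarrow> (1 / sqrt (- lor y y)) *\<^sub>R y"
  proof -
    have "c n = ((\<alpha> + \<beta>) * a * \<epsilon> n) *\<^sub>R ?e + (exp s / N + \<beta> * b * (\<epsilon> n * \<epsilon> n)) *\<^sub>R ?p
        + (exp (- s) / N + \<alpha> * d * (\<epsilon> n * \<epsilon> n)) *\<^sub>R ?m" for n
    proof -
      have "c n = (\<alpha> * \<epsilon> n) *\<^sub>R (a *\<^sub>R ?e + (b * ?l ^ n) *\<^sub>R ?p + (d / ?l ^ n) *\<^sub>R ?m)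
        + (\<beta> * \<epsilon> n) *\<^sub>R (a *\<^sub>R ?e + (b / ?l ^ n) *\<^sub>R ?p + (d * ?l ^ n) *\<^sub>R ?m)"
        unfolding c_def u_def w_def by (subst (1 2) ze) (simp only: hframe_orbit[OF F])
      also have "\<dots> = ((\<alpha> + \<beta>) * a * \<epsilon> n) *\<^sub>R ?e + (\<alpha> * b * (\<epsilon> n * ?l ^ n) + \<beta> * b * (\<epsilon> n * (1 / ?l ^ n))) *\<^sub>R ?p
        + (\<alpha> * d * (\<epsilon> n * (1 / ?l ^ n)) + \<beta> * d * (\<epsilon> n * ?l ^ n)) *\<^sub>R ?m"
        by (simp add: algebra_simps)
      also have "\<dots> = ((\<alpha> + \<beta>) * a * \<epsilon> n) *\<^sub>R ?e + (\<alpha> * b + \<beta> * b * (\<epsilon> n * \<epsilon> n)) *\<^sub>R ?p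
        + (\<beta> * d + \<alpha> * d * (\<epsilon> n * \<epsilon> n)) *\<^sub>R ?m" unfolding \<epsilon>l by (simp add: add.commute)
      also have "\<alpha> * b = exp s / N" using bd by (simp add: \<alpha>_def)
      also have "\<beta> * d = exp (- s) / N" using bd by (simp add: \<beta>_def)
      finally show ?thesis .
    qed
    then have ceq: "c = (\<lambda>n. ((\<alpha> + \<beta>) * a * \<epsilon> n) *\<^sub>R ?e + (exp s / N + \<beta> * b * (\<epsilon> n * \<epsilon> n)) *\<^sub>R ?p
        + (exp (- s) / N + \<alpha> * d * (\<epsilon> n * \<epsilon> n)) *\<^sub>R ?m)" by (rule ext)
    have "\<epsilon> \<longlonglongrightarrow> 0"
      unfolding \<epsilon>_def using f by (intro tendsto_divide_0[OF tendsto_const] filterlim_at_top_imp_at_infinity filterlim_realpow_sequentially_gt1) auto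
    then have "c \<longlonglongrightarrow> ((\<alpha> + \<beta>) * a * 0) *\<^sub>R ?e + (exp s / N + \<beta> * b * (0 * 0)) *\<^sub>R ?p
        + (exp (- s) / N + \<alpha> * d * (0 * 0)) *\<^sub>R ?m"
      unfolding ceq by (intro tendsto_intros)
    then have "c \<longlonglongrightarrow> y" using y N by (simp add: scaleR_add_right)
    then show ?thesis using axis_lor(1)[OF x, of s] y by (intro tendsto_intros) auto
  qed
  ultimately have "(1 / sqrt (- lor y y)) *\<^sub>R y \<in> C" by (rule closed_sequentially[OF C(2)])
  then show "y \<in> C" using axis_lor(1)[OF x, of s] y by simp
qed

lemma closed_H2: "closed H2"
proof -
  have eq: "H2 = {z. lor z z = -1} \<inter> {z. z$3 \<ge> 0}"
  proof -
    have "z$3 \<noteq> 0" if "lor z z = -1" for z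
    proof
      assume "z$3 = 0"
      then have "lor z z \<ge> 0" by (simp add: lor_def)
      then show False using that by simp
    qed
    then show ?thesis by (auto simp: H2_iff less_le)
  qed
  show ?thesis unfolding eq
    by (intro closed_Int closed_Collect_eq closed_Collect_le continuous_intros)
qed

lemma closed_geod_axis:
  assumes "hyperbolic x" shows "closed (geod_axis x)"
proof -
  have eq: "geod_axis x = H2 \<inter> {z. lor z (Xzero x) = 0}" using geod_axis_eq[OF assms] by blast
  show ?thesis unfolding eq by (intro closed_Int closed_H2 closed_Collect_eq continuous_intros)
qed

section \<open>Convexity, invariance and connectedness of the Nielsen region\<close>

context fuchsian
begin

abbreviation "N \<equiv> nielsen_region G"

lemma N_H2: "N \<subseteq> H2"
proof -
  have "hyp_convex H2" by (auto simp: hyp_convex_def)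
  then show ?thesis unfolding nielsen_region_def
    using closed_H2 e3_H2 SO21_H2[OF G_SO21] by blast
qed

lemma N_convex: "hyp_convex N"
  unfolding hyp_convex_def
proof (intro conjI N_H2 ballI allI impI)
  fix z w :: "real^3" and a b :: real
  assume zw: "z \<in> N" "w \<in> N" and ab: "a \<ge> 0" "b \<ge> 0" "a *\<^sub>R z + b *\<^sub>R w \<in> H2"
  show "a *\<^sub>R z + b *\<^sub>R w \<in> N" unfolding nielsen_region_def
  proof (rule InterI)
    fix C assume C: "C \<in> {C. C \<noteq> {} \<and> closed C \<and> hyp_convex C \<and> (\<forall>x\<in>G. \<forall>z\<in>C. x *v z \<in> C)}"
    then have "z \<in> C" "w \<in> C" using zw unfolding nielsen_region_def by (auto dest: InterD)
    moreover have "hyp_convex C" using C by simp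
    ultimately show "a *\<^sub>R z + b *\<^sub>R w \<in> C" using ab unfolding hyp_convex_def by simp
  qed
qed

lemma N_invariant: "x \<in> G \<Longrightarrow> z \<in> N \<Longrightarrow> x *v z \<in> N"
  unfolding nielsen_region_def by blast

lemma axis_N: "x \<in> G \<Longrightarrow> x \<noteq> mat 1 \<Longrightarrow> geod_axis x \<subseteq> N"
  unfolding nielsen_region_def
  by (rule Inter_greatest) (use axis_in_convex[OF G_hyperbolic] G_ladj in blast)

lemma connected_N: "connected N"
proof (rule path_connected_imp_connected, unfold path_connected_def, intro ballI)
  fix a b assume ab: "a \<in> N" "b \<in> N"
  then have H: "a \<in> H2" "b \<in> H2" using N_H2 by auto
  show "\<exists>g. path g \<and> path_image g \<subseteq> N \<and> pathstart g = a \<and> pathfinish g = b"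
    using continuous_on_hseg[OF H] hseg_convex[OF N_convex ab] hseg_ends H
    by (intro exI[of _ "hseg a b"]) (auto simp: path_def path_image_def pathstart_def pathfinish_def)
qed

lemma orbit_eq_iff: "orbit G z = orbit G w \<longleftrightarrow> (\<exists>x\<in>G. z = x *v w)"
proof
  assume "orbit G z = orbit G w"
  moreover have "z \<in> orbit G z" unfolding orbit_def using G_one by force
  ultimately show "\<exists>x\<in>G. z = x *v w" unfolding orbit_def by auto
next
  assume "\<exists>x\<in>G. z = x *v w"
  then obtain x where x: "x \<in> G" "z = x *v w" by blast
  then have w: "w = ladj x *v z" using ladj_vec[OF G_SO21] by metis
  show "orbit G z = orbit G w" unfolding orbit_def
  proof safe
    fix y assume "y \<in> G"
    then show "y *v z \<in> (\<lambda>x. x *v w) ` G" using x G_mult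
      by (auto simp: matrix_vector_mul_assoc intro!: image_eqI[of _ _ "y ** x"])
    show "y *v w \<in> (\<lambda>x. x *v z) ` G" using x w G_mult G_ladj \<open>y \<in> G\<close>
      by (auto simp: matrix_vector_mul_assoc intro!: image_eqI[of _ _ "y ** ladj x"])
  qed
qed

lemma topspace_surface: "topspace (surface G) = orbit G ` N"
  by (simp add: surface_def topspace_quotient_by)

lemma openin_surface:
  "openin (surface G) U \<longleftrightarrow> U \<subseteq> orbit G ` N \<and> openin (top_of_set N) {w \<in> N. orbit G w \<in> U}"
  by (simp add: surface_def openin_quotient_by)

end

section \<open>The two sides of a separating geodesic\<close>

locale separating_loop = fuchsian_elem +
  fixes S1 S2 C1 C2 :: "(real^3) set set"
  assumes simple: "simple_loop G h"
    and C_ne: "C1 \<noteq> C2"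
    and C_comps: "connected_components_of (subtopology (surface G) (topspace (surface G) - loop_image G h)) = {C1, C2}"
    and S1_def: "S1 = surface G closure_of C1" and S2_def: "S2 = surface G closure_of C2"
    and left_S2: "lies_left G h S2"
begin

definition "L = (\<Union>k\<in>conjs G h. geod_axis k)"

abbreviation "W \<equiv> subtopology (surface G) (topspace (surface G) - loop_image G h)"

text \<open>The preimages of the open pieces, those of the closed pieces being \<open>P\<close>.
  \<open>True\<close> stands for the piece on the left of \<open>h\<close>; a boolean index lets
  most facts be proved once for both sides.\<close>

definition Q :: "bool \<Rightarrow> (real^3) set"
  where "Q i = {w \<in> N. orbit G w \<in> (if i then C2 else C1)}"

definition P :: "bool \<Rightarrow> (real^3) set"
  where "P i = {w \<in> N. orbit G w \<in> (if i then S2 else S1)}"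

lemma h_conjs: "h \<in> conjs G h"
proof -
  have "matrix_inv (mat 1 :: real^3^3) = mat 1" by (rule matrix_inv_eqI) simp_all
  then show ?thesis using conjsI[OF G_one] by simp
qed

lemma axis_h_N: "geod_axis h \<subseteq> N"
  using axis_N h_G h_ne by blast

lemma L_iff: "z \<in> L \<longleftrightarrow> (\<exists>x\<in>G. \<exists>w\<in>geod_axis h. z = x *v w)"
proof
  assume "z \<in> L"
  then obtain k where "k \<in> conjs G h" "z \<in> geod_axis k" by (auto simp: L_def)
  then show "\<exists>x\<in>G. \<exists>w\<in>geod_axis h. z = x *v w" by (elim conjsE) auto
next
  assume "\<exists>x\<in>G. \<exists>w\<in>geod_axis h. z = x *v w"
  then obtain x w where x: "x \<in> G" "w \<in> geod_axis h" "z = x *v w" by blast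
  then have "z \<in> geod_axis (x ** h ** matrix_inv x)"
    using geod_axis_conj[OF G_SO21 h_hyperbolic] by auto
  then show "z \<in> L" using conjsI[OF x(1)] by (auto simp: L_def)
qed

lemma orbit_loop_image: "orbit G w \<in> loop_image G h \<longleftrightarrow> w \<in> L"
proof
  assume "orbit G w \<in> loop_image G h"
  then obtain z where "z \<in> geod_axis h" "orbit G w = orbit G z" by (auto simp: loop_image_def)
  then show "w \<in> L" unfolding L_iff orbit_eq_iff by blast
next
  assume "w \<in> L"
  then obtain z where "z \<in> geod_axis h" "orbit G w = orbit G z" unfolding L_iff orbit_eq_iff by blast
  then show "orbit G w \<in> loop_image G h" by (simp add: loop_image_def)
qed

text \<open>An infinite but locally finite union: near \<open>z\<close> only the lifts with a point
  of height at most \<open>z$3 + 1\<close> count.\<close>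

lemma closed_L: "closed L"
  unfolding closed_sequential_limits
proof (intro allI impI, elim conjE)
  fix f z assume f: "\<forall>n. f n \<in> L" "f \<longlonglongrightarrow> z"
  let ?F = "{k \<in> conjs G h. \<exists>w\<in>geod_axis k. w$3 \<le> z$3 + 1}"
  have "closed (\<Union>k\<in>?F. geod_axis k)"
    by (rule closed_UN[OF finite_conjs_meeting]) (auto intro: closed_geod_axis elim: conjsE)
  moreover have "\<forall>\<^sub>F n in sequentially. f n \<in> (\<Union>k\<in>?F. geod_axis k)"
  proof -
    have "(\<lambda>n. f n $ 3) \<longlonglongrightarrow> z$3" using f(2) by (intro tendsto_intros)
    then have "\<forall>\<^sub>F n in sequentially. f n $ 3 < z$3 + 1" by (rule order_tendstoD) simp
    then show ?thesis
    proof eventually_elim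
      case (elim n)
      obtain k where "k \<in> conjs G h" "f n \<in> geod_axis k" using f(1) by (auto simp: L_def)
      then show ?case using elim by (auto intro!: bexI[of _ k] bexI[of _ "f n"])
    qed
  qed
  ultimately have "z \<in> (\<Union>k\<in>?F. geod_axis k)"
    using Lim_in_closed_set[OF _ _ sequentially_bot f(2)] by blast
  then show "z \<in> L" by (auto simp: L_def)
qed

lemma topspace_W: "topspace W = orbit G ` (N - L)"
  unfolding topspace_subtopology topspace_surface using orbit_loop_image by auto

lemma C_union: "C1 \<union> C2 = orbit G ` (N - L)" and C_disjoint: "C1 \<inter> C2 = {}" and C_nonempty: "C1 \<noteq> {}" "C2 \<noteq> {}"
proof -
  have m: "C1 \<in> connected_components_of W" "C2 \<in> connected_components_of W" using C_comps by auto
  show "C1 \<union> C2 = orbit G ` (N - L)" using Union_connected_components_of[of W] C_comps topspace_W by simp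
  show "C1 \<inter> C2 = {}" using connected_components_of_disjoint[OF m] C_ne by (simp add: disjnt_def)
  show "C1 \<noteq> {}" "C2 \<noteq> {}" using nonempty_connected_components_of m by blast+
qed

lemma Q_union: "Q False \<union> Q True = N - L" and Q_disjoint: "Q False \<inter> Q True = {}"
  and Q_nonempty: "Q i \<noteq> {}" and Q_N: "Q i \<subseteq> N"
proof -
  have "w \<in> Q False \<union> Q True \<longleftrightarrow> w \<in> N - L" for w
  proof -
    have "orbit G w \<in> orbit G ` (N - L) \<longleftrightarrow> w \<in> N - L" if "w \<in> N"
      using that orbit_loop_image[of w] by (auto simp: orbit_loop_image[symmetric])
    then show ?thesis unfolding Q_def C_union[symmetric] by auto
  qed
  then show "Q False \<union> Q True = N - L" by blast
  show "Q False \<inter> Q True = {}" using C_disjoint by (auto simp: Q_def)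
  obtain c where c: "c \<in> (if i then C2 else C1)" using C_nonempty by (cases i) auto
  then have "c \<in> orbit G ` (N - L)" using C_union by (auto split: if_splits)
  then show "Q i \<noteq> {}" using c by (auto simp: Q_def)
qed (auto simp: Q_def)

text \<open>Components are closed, and as there are just two, each is also the complement of a
  closed set.\<close>

lemma openin_Q: "openin (top_of_set N) (Q i)"
proof -
  have W_open: "openin (surface G) (topspace W)"
    unfolding openin_surface topspace_W
  proof
    have "{w \<in> N. orbit G w \<in> orbit G ` (N - L)} = N \<inter> (- L)"
      using orbit_loop_image by auto (metis Diff_iff)+
    then show "openin (top_of_set N) {w \<in> N. orbit G w \<in> orbit G ` (N - L)}"
      using closed_L by (auto simp: openin_open intro!: exI[of _ "- L"])
  qed auto
  have cl: "closedin W C1" "closedin W C2" using closedin_connected_components_of[of _ W] C_comps by auto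
  have "topspace W - C1 = C2" "topspace W - C2 = C1" using C_union C_disjoint topspace_W by auto
  then have op: "openin W C1" "openin W C2"
    using cl openin_diff[OF openin_topspace cl(1)] openin_diff[OF openin_topspace cl(2)] by auto
  have W_open': "openin (surface G) (topspace (surface G) - loop_image G h)"
    using W_open by (simp add: topspace_subtopology Int_absorb1 Diff_subset)
  have "openin (surface G) (if i then C2 else C1)"
    using op openin_trans_full[OF _ W_open'] by (cases i) auto
  then show ?thesis unfolding openin_surface Q_def by simp
qed

lemma Q_connected:
  assumes "connected T" "T \<subseteq> N - L" "T \<inter> Q i \<noteq> {}" shows "T \<subseteq> Q i"
proof -
  have "openin (top_of_set T) (T \<inter> Q j)" for j
    using openin_Q[of j] assms(2) by (auto simp: openin_open)
  moreover have "T - (T \<inter> Q i) = T \<inter> Q (\<not> i)" using Q_union Q_disjoint assms(2) by (cases i) auto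
  ultimately have "closedin (top_of_set T) (T \<inter> Q i)" "openin (top_of_set T) (T \<inter> Q i)"
    by (simp_all add: closedin_def)
  then have "T \<inter> Q i = {} \<or> T \<inter> Q i = T" using assms(1) unfolding connected_clopen by blast
  then show ?thesis using assms(3) by blast
qed

lemma Q_P: "Q i \<subseteq> P i"
proof -
  have "C1 \<subseteq> topspace (surface G)" "C2 \<subseteq> topspace (surface G)"
    unfolding topspace_surface using C_union by blast+
  then have "C1 \<subseteq> S1" "C2 \<subseteq> S2" unfolding S1_def S2_def by (auto intro: closure_of_subset[THEN subsetD])
  then show ?thesis by (auto simp: Q_def P_def)
qed

lemma P_closure:
  assumes w: "w \<in> N" and cl: "w \<in> closure (Q i)" shows "w \<in> P i"
proof -
  let ?C = "if i then C2 else C1"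
  have "orbit G w \<in> surface G closure_of ?C"
    unfolding in_closure_of
  proof (intro conjI allI impI)
    show "orbit G w \<in> topspace (surface G)" using w by (simp add: topspace_surface)
    fix T assume T: "orbit G w \<in> T \<and> openin (surface G) T"
    then obtain U where U: "open U" "{w \<in> N. orbit G w \<in> T} = N \<inter> U"
      unfolding openin_surface openin_open by blast
    then have "w \<in> U" using w T by blast
    then have "U \<inter> Q i \<noteq> {}" using cl U(1) open_Int_closure_eq_empty[of U "Q i"] by blast
    then show "\<exists>y. y \<in> ?C \<and> y \<in> T" using U(2) by (auto simp: Q_def)
  qed
  then have "orbit G w \<in> (if i then S2 else S1)" by (cases i) (simp_all add: S1_def S2_def)
  then show ?thesis using w by (simp add: P_def)
qed

lemma P_disjoint: "P i \<inter> Q (\<not> i) = {}"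
proof -
  have *: "\<exists>U. openin (surface G) U \<and> U \<inter> (if i then C2 else C1) = {} \<and> Q (\<not> i) = {w \<in> N. orbit G w \<in> U}"
  proof -
    have "openin (surface G) (if \<not> i then C2 else C1)"
    proof -
      have "(if \<not> i then C2 else C1) \<subseteq> orbit G ` N" using C_union by (cases i) auto
      then show ?thesis unfolding openin_surface using openin_Q[of "\<not> i"] by (simp add: Q_def)
    qed
    then show ?thesis using C_disjoint
      by (intro exI[of _ "if \<not> i then C2 else C1"]) (auto simp: Q_def)
  qed
  then obtain U where U: "openin (surface G) U" "U \<inter> (if i then C2 else C1) = {}" "Q (\<not> i) = {w \<in> N. orbit G w \<in> U}"
    by blast
  show ?thesis
  proof (rule ccontr)
    assume "P i \<inter> Q (\<not> i) \<noteq> {}"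
    then obtain w where w: "w \<in> P i" "w \<in> Q (\<not> i)" by blast
    then have "orbit G w \<in> (if i then S2 else S1)" by (simp add: P_def)
    then have "orbit G w \<in> surface G closure_of (if i then C2 else C1)"
      by (cases i) (simp_all add: S1_def S2_def)
    moreover have "orbit G w \<in> U" using w U by blast
    ultimately show False using U unfolding in_closure_of by blast
  qed
qed

lemma Q_invariant: "x \<in> G \<Longrightarrow> w \<in> Q i \<Longrightarrow> x *v w \<in> Q i"
  and P_invariant: "x \<in> G \<Longrightarrow> w \<in> P i \<Longrightarrow> x *v w \<in> P i"
  using N_invariant[of x w] orbit_eq_iff[of "x *v w" w] by (auto simp: Q_def P_def)

section \<open>Which piece lies on which side of the axis of \<open>h\<close>\<close>

lemma disjoint_axes:
  assumes "k \<in> conjs G h" "geod_axis k \<noteq> geod_axis h" shows "geod_axis k \<inter> geod_axis h = {}"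
  using simple_axes[OF simple assms(1) h_conjs] assms(2) by blast

text \<open>With opposite signs, the weighted sum of the two points on which the pairing with
  \<open>Xzero k\<close> cancels would normalise to a common point of two disjoint axes.\<close>

lemma axis_one_side:
  assumes k: "k \<in> conjs G h" "geod_axis k \<noteq> geod_axis h" and y: "y \<in> geod_axis h" "y' \<in> geod_axis h"
  shows "lor y (Xzero k) * lor y' (Xzero k) > 0"
proof (rule ccontr)
  assume neg: "\<not> ?thesis"
  have kh: "hyperbolic k" using k by (elim conjsE)
  have H: "y \<in> H2" "y' \<in> H2" "lor y (Xzero h) = 0" "lor y' (Xzero h) = 0"
    using y geod_axis_eq[OF h_hyperbolic] by auto
  let ?u = "lor y (Xzero k)" and ?v = "lor y' (Xzero k)"
  have d: "z \<notin> geod_axis k" if "z \<in> geod_axis h" for z using disjoint_axes[OF k] that by blast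
  have uv: "?u \<noteq> 0" "?v \<noteq> 0" using d y H geod_axis_eq[OF kh] by auto
  then have "?u * ?v < 0" using neg by (simp add: less_le)
  define c where "c = \<bar>?v\<bar> *\<^sub>R y + \<bar>?u\<bar> *\<^sub>R y'"
  define z where "z = (1 / sqrt (- lor c c)) *\<^sub>R c"
  have "z \<in> H2" unfolding z_def c_def using H uv by (intro comb_H2(2)) auto
  moreover have "lor c (Xzero h) = 0" using H by (simp add: c_def lor_simps)
  moreover have "lor c (Xzero k) = 0"
    using \<open>?u * ?v < 0\<close> by (auto simp: c_def lor_simps abs_if mult_less_0_iff)
  ultimately have "z \<in> geod_axis h" "z \<in> geod_axis k"
    using geod_axis_eq[OF h_hyperbolic] geod_axis_eq[OF kh] by (auto simp: z_def lor_simps)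
  then show False using d by blast
qed

text \<open>Near the axis of \<open>h\<close>, short detours do not reach the other lifts of \<open>h\<close>: locally finitely
  many lifts matter, and each of them has all of the axis of \<open>h\<close> strictly on one side.\<close>

lemma strip:
  assumes y: "y \<in> geod_axis h" "y' \<in> geod_axis h"
  obtains \<delta> where "\<delta> > 0" "\<And>w w' k t. w \<in> H2 \<Longrightarrow> w' \<in> H2 \<Longrightarrow> dist w y < \<delta> \<Longrightarrow> dist w' y' < \<delta> \<Longrightarrow>
    k \<in> conjs G h \<Longrightarrow> geod_axis k \<noteq> geod_axis h \<Longrightarrow> 0 \<le> t \<Longrightarrow> t \<le> 1 \<Longrightarrow> hseg w w' t \<notin> geod_axis k"
proof -
  \<comment> \<open>Strictly above both heights, so that points near \<open>y\<close> and
    \<open>y'\<close> stay below \<open>M\<close> and segments between them can meet only lifts in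
    the finite set \<open>F\<close>.\<close>
  define M where "M = max (y$3) (y'$3) + 1"
  define F where "F = {k \<in> conjs G h. \<exists>z\<in>geod_axis k. z$3 \<le> M} \<inter> {k. geod_axis k \<noteq> geod_axis h}"
  have fin: "finite F" unfolding F_def using finite_conjs_meeting by blast
  have near: "\<exists>\<delta>>0. \<forall>w. dist w x < \<delta> \<longrightarrow> w$3 < M \<and> (\<forall>k\<in>F. lor w (Xzero k) * lor x (Xzero k) > 0)"
    if x: "x \<in> geod_axis h" "x$3 < M" for x
  proof -
    have "((\<lambda>w. w$3) \<longlongrightarrow> x$3) (nhds x)" by (intro tendsto_intros filterlim_ident)
    then have 1: "\<forall>\<^sub>F w in nhds x. w$3 < M" using x(2) by (rule order_tendstoD)
    have "\<forall>\<^sub>F w in nhds x. lor w (Xzero k) * lor x (Xzero k) > 0" if "k \<in> F" for k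
    proof -
      have "((\<lambda>w. lor w (Xzero k) * lor x (Xzero k)) \<longlongrightarrow> lor x (Xzero k) * lor x (Xzero k)) (nhds x)"
        by (intro tendsto_intros filterlim_ident)
      moreover have "lor x (Xzero k) * lor x (Xzero k) > 0"
        using axis_one_side[of k x x] that x by (simp add: F_def)
      ultimately show ?thesis by (rule order_tendstoD)
    qed
    then have 2: "\<forall>\<^sub>F w in nhds x. \<forall>k\<in>F. lor w (Xzero k) * lor x (Xzero k) > 0"
      using fin by (simp add: eventually_ball_finite)
    from eventually_conj[OF 1 2] show ?thesis unfolding eventually_nhds_metric by blast
  qed
  have My: "y$3 < M" "y'$3 < M" by (auto simp: M_def)
  obtain d where d: "d > 0" "\<And>w. dist w y < d \<Longrightarrow> w$3 < M \<and> (\<forall>k\<in>F. lor w (Xzero k) * lor y (Xzero k) > 0)"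
    using near[OF y(1) My(1)] by blast
  obtain d' where d': "d' > 0" "\<And>w. dist w y' < d' \<Longrightarrow> w$3 < M \<and> (\<forall>k\<in>F. lor w (Xzero k) * lor y' (Xzero k) > 0)"
    using near[OF y(2) My(2)] by blast
  show ?thesis
  proof (rule that[of "min d d'"])
    show "min d d' > 0" using d d' by simp
    fix w w' k and t :: real
    assume w: "w \<in> H2" "w' \<in> H2" "dist w y < min d d'" "dist w' y' < min d d'"
      and k: "k \<in> conjs G h" "geod_axis k \<noteq> geod_axis h" and t: "0 \<le> t" "t \<le> 1"
    show "hseg w w' t \<notin> geod_axis k"
    proof
      assume mem: "hseg w w' t \<in> geod_axis k"
      have "hseg w w' t $ 3 \<le> M" using hseg_height[OF w(1,2) t] d d' w by (simp add: less_imp_le)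
      then have kF: "k \<in> F" using k mem by (auto simp: F_def)
      have kh: "hyperbolic k" using k by (elim conjsE)
      have 1: "lor w (Xzero k) * lor y (Xzero k) > 0" "lor w' (Xzero k) * lor y' (Xzero k) > 0"
        using d d' w kF by auto
      have 2: "lor y (Xzero k) * lor y' (Xzero k) > 0" by (rule axis_one_side[OF k y])
      obtain \<alpha> \<beta> where c: "hseg w w' t = \<alpha> *\<^sub>R w + \<beta> *\<^sub>R w'" "\<alpha> \<ge> 0" "\<beta> \<ge> 0" "\<alpha> + \<beta> > 0"
        using hseg_coeffs[OF w(1,2) t] by metis
      have "\<alpha> * lor w (Xzero k) + \<beta> * lor w' (Xzero k) = 0"
        using mem geod_axis_eq[OF kh] c by (simp add: lor_simps)
      moreover have "\<alpha> > 0 \<or> \<beta> > 0" using c by linarith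
      ultimately show False using 1 2 c(2,3)
        by (smt (verit) mult_nonneg_nonneg mult_nonneg_nonpos mult_pos_pos mult_pos_neg zero_less_mult_iff)
    qed
  qed
qed

text \<open>The sign of \<open>s\<close> selects a side of the axis, and \<open>y\<close>,
  \<open>y'\<close> may be far apart, so information travels along the axis. Since \<open>w'\<close>
  may lie on the axis itself, the end \<open>t = 1\<close> is left out.\<close>

lemma side_segment:
  assumes y: "y \<in> geod_axis h" "y' \<in> geod_axis h"
  obtains \<delta> where "\<delta> > 0" "\<And>w w' s t. w \<in> N \<Longrightarrow> w' \<in> N \<Longrightarrow> dist w y < \<delta> \<Longrightarrow> dist w' y' < \<delta> \<Longrightarrow>
    s * lor w (Xzero h) > 0 \<Longrightarrow> s * lor w' (Xzero h) \<ge> 0 \<Longrightarrow> 0 \<le> t \<Longrightarrow> t < 1 \<Longrightarrow> hseg w w' t \<in> N - L"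
proof -
  obtain \<delta> where \<delta>: "\<delta> > 0" "\<And>w w' k t. w \<in> H2 \<Longrightarrow> w' \<in> H2 \<Longrightarrow> dist w y < \<delta> \<Longrightarrow> dist w' y' < \<delta> \<Longrightarrow>
    k \<in> conjs G h \<Longrightarrow> geod_axis k \<noteq> geod_axis h \<Longrightarrow> 0 \<le> t \<Longrightarrow> t \<le> 1 \<Longrightarrow> hseg w w' t \<notin> geod_axis k"
    using strip[OF y] by metis
  show ?thesis
  proof (rule that[OF \<delta>(1)])
    fix w w' and s t :: real
    assume w: "w \<in> N" "w' \<in> N" "dist w y < \<delta>" "dist w' y' < \<delta>"
      and s: "s * lor w (Xzero h) > 0" "s * lor w' (Xzero h) \<ge> 0" and t: "0 \<le> t" "t < 1"
    have H: "w \<in> H2" "w' \<in> H2" using w N_H2 by auto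
    have "hseg w w' t \<in> N" using hseg_convex[OF N_convex w(1,2)] t by simp
    moreover have "hseg w w' t \<notin> geod_axis h"
    proof
      assume "hseg w w' t \<in> geod_axis h"
      then have 0: "lor (hseg w w' t) (Xzero h) = 0" using geod_axis_eq[OF h_hyperbolic] by auto
      obtain \<alpha> \<beta> where c: "hseg w w' t = \<alpha> *\<^sub>R w + \<beta> *\<^sub>R w'" "\<alpha> > 0" "\<beta> \<ge> 0"
        using hseg_coeffs[OF H, of t] t by (metis less_imp_le)
      have "\<alpha> * (s * lor w (Xzero h)) + \<beta> * (s * lor w' (Xzero h)) = s * lor (hseg w w' t) (Xzero h)"
        unfolding c by (simp add: lor_simps algebra_simps)
      moreover have "\<alpha> * (s * lor w (Xzero h)) > 0" "\<beta> * (s * lor w' (Xzero h)) \<ge> 0" using c s by auto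
      ultimately show False using 0 by simp
    qed
    moreover have "hseg w w' t \<notin> geod_axis k" if "k \<in> conjs G h" "geod_axis k \<noteq> geod_axis h" for k
      using \<delta>(2)[OF H w(3,4) that] t by simp
    ultimately show "hseg w w' t \<in> N - L" unfolding L_def by auto
  qed
qed

text \<open>\<open>Q i\<close> is open and neither empty nor all of the connected set
  \<open>N\<close>, so it is not closed. A missing limit point avoids the opposite open piece, hence
  lies on a lift, and \<open>G\<close> moves it to the axis of \<open>h\<close>.\<close>

lemma Q_accumulates:
  obtains z where "z \<in> geod_axis h" "z \<in> closure (Q i)"
proof -
  have "\<not> closedin (top_of_set N) (Q i)"
  proof
    assume "closedin (top_of_set N) (Q i)"
    then have "Q i = {} \<or> Q i = N" using openin_Q connected_N unfolding connected_clopen by blast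
    then show False using Q_nonempty[of i] Q_nonempty[of "\<not> i"] Q_disjoint Q_N[of "\<not> i"] by (cases i) auto
  qed
  then obtain z where z: "z \<in> N" "z islimpt Q i" "z \<notin> Q i" using Q_N by (auto simp: closedin_limpt)
  have zc: "z \<in> closure (Q i)" using z by (simp add: closure_def)
  then have "z \<in> P i" by (rule P_closure[OF z(1)])
  then have "z \<notin> Q (\<not> i)" using P_disjoint by blast
  then have "z \<in> L" using z Q_union by (cases i) auto
  then obtain x w where x: "x \<in> G" "w \<in> geod_axis h" "z = x *v w" by (auto simp: L_iff)
  have "(\<lambda>v. ladj x *v v) ` closure (Q i) \<subseteq> closure ((\<lambda>v. ladj x *v v) ` Q i)"
    by (rule closure_bounded_linear_image_subset) (rule matrix_vector_mul_bounded_linear)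
  moreover have "(\<lambda>v. ladj x *v v) ` Q i \<subseteq> Q i" using Q_invariant G_ladj[OF x(1)] by blast
  ultimately have "ladj x *v z \<in> closure (Q i)" using zc closure_mono by blast
  then show ?thesis using that x ladj_vec(1)[OF G_SO21[OF x(1)]] by simp
qed

lemma Q_off: assumes "w \<in> Q i" shows "w \<in> N - L" "lor w (Xzero h) \<noteq> 0"
proof -
  show *: "w \<in> N - L" using assms Q_union by (cases i) auto
  have "w \<notin> geod_axis h" using * h_conjs by (auto simp: L_def)
  then show "lor w (Xzero h) \<noteq> 0" using * N_H2 geod_axis_eq[OF h_hyperbolic] by auto
qed

lemma connected_hseg:
  assumes "a \<in> N" "b \<in> N" "J \<subseteq> {0..1}" "connected J" shows "connected (hseg a b ` J)"
proof -
  have "continuous_on {0..1} (hseg a b)" using continuous_on_hseg assms N_H2 by blast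
  then show ?thesis using assms by (intro connected_continuous_image) (auto intro: continuous_on_subset)
qed

text \<open>One accumulation point suffices: a nearby point of \<open>Q i\<close>, on whichever side
  it lies, is joined to any point of the axis by a segment that meets the lifts only at its
  end.\<close>

lemma axis_P: "geod_axis h \<subseteq> P i"
proof
  fix y assume y: "y \<in> geod_axis h"
  then have yN: "y \<in> N" "y \<in> H2" "lor y (Xzero h) = 0" using axis_h_N N_H2 geod_axis_eq[OF h_hyperbolic] by auto
  obtain z where z: "z \<in> geod_axis h" "z \<in> closure (Q i)" by (rule Q_accumulates)
  obtain \<delta> where \<delta>: "\<delta> > 0" "\<And>w w' s t. w \<in> N \<Longrightarrow> w' \<in> N \<Longrightarrow> dist w z < \<delta> \<Longrightarrow> dist w' y < \<delta> \<Longrightarrow>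
    s * lor w (Xzero h) > 0 \<Longrightarrow> s * lor w' (Xzero h) \<ge> 0 \<Longrightarrow> 0 \<le> t \<Longrightarrow> t < 1 \<Longrightarrow> hseg w w' t \<in> N - L"
    using side_segment[OF z(1) y] by metis
  obtain w where w: "w \<in> Q i" "dist w z < \<delta>" using z(2) \<delta>(1) by (meson closure_approachable)
  note off = Q_off[OF w(1)]
  have wH: "w \<in> H2" using off N_H2 by auto
  let ?T = "hseg w y ` {0..<1}"
  have "?T \<subseteq> N - L"
  proof safe
    fix t :: real assume t: "t \<in> {0..<1}"
    have "sgn (lor w (Xzero h)) * lor w (Xzero h) > 0" using off by (simp add: sgn_if)
    then have "hseg w y t \<in> N - L" using \<delta>(2)[of w y "sgn (lor w (Xzero h))" t] off w yN \<delta>(1) t by simp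
    then show "hseg w y t \<in> N" "hseg w y t \<in> L \<Longrightarrow> False" by auto
  qed
  moreover have "connected ?T" using off yN by (intro connected_hseg) auto
  moreover have "w \<in> ?T" using hseg_ends(1)[OF wH] by (intro image_eqI[of _ _ 0]) auto
  ultimately have "?T \<subseteq> Q i" using Q_connected w(1) by blast
  moreover have "hseg w y ` closure {0..<1} \<subseteq> closure ?T"
    using continuous_on_hseg[OF wH yN(2)]
    by (intro image_closure_subset[of "{0..<1}"]) (auto simp: closure_subset)
  then have "hseg w y 1 \<in> closure ?T" by auto
  ultimately have "y \<in> closure (Q i)" using hseg_ends(2)[OF yN(2), of w] closure_mono[of ?T "Q i"] by auto
  then show "y \<in> P i" by (rule P_closure[OF yN(1)])
qed

text \<open>\<open>lies_left\<close> only places nearby points in the closed piece; as they lie off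
  every lift, they belong to the open one.\<close>

lemma near_left:
  assumes y: "y \<in> geod_axis h"
  obtains \<delta> where "\<delta> > 0" "\<And>w. w \<in> N \<Longrightarrow> dist w y < \<delta> \<Longrightarrow> lor w (Xzero h) > 0 \<Longrightarrow> w \<in> Q True"
proof -
  have "\<forall>\<^sub>F w in at y within {w \<in> N. on_left h w}. orbit G w \<in> S2"
    using left_S2 y unfolding lies_left_def by blast
  then obtain d where d: "d > 0" "\<And>w. w \<in> N \<Longrightarrow> on_left h w \<Longrightarrow> w \<noteq> y \<Longrightarrow> dist w y < d \<Longrightarrow> orbit G w \<in> S2"
    unfolding eventually_at by auto
  obtain \<delta> where \<delta>: "\<delta> > 0" "\<And>w w' s t. w \<in> N \<Longrightarrow> w' \<in> N \<Longrightarrow> dist w y < \<delta> \<Longrightarrow> dist w' y < \<delta> \<Longrightarrow>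
    s * lor w (Xzero h) > 0 \<Longrightarrow> s * lor w' (Xzero h) \<ge> 0 \<Longrightarrow> 0 \<le> t \<Longrightarrow> t < 1 \<Longrightarrow> hseg w w' t \<in> N - L"
    using side_segment[OF y y] by metis
  show ?thesis
  proof (rule that[of "min d \<delta>"])
    fix w assume w: "w \<in> N" "dist w y < min d \<delta>" "lor w (Xzero h) > 0"
    have "w \<noteq> y" using y geod_axis_eq[OF h_hyperbolic] w by auto
    then have "orbit G w \<in> S2" using d w on_left_iff[OF h_hyperbolic] by simp
    then have "w \<in> P True" using w by (simp add: P_def)
    moreover have "hseg w w 0 \<in> N - L" using \<delta>(2)[of w w 1 0] w by simp
    then have "w \<in> N - L" using hseg_ends(1)[of w w] w N_H2 by auto
    ultimately show "w \<in> Q True" using P_disjoint[of True] Q_union by auto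
  qed (use d \<delta> in auto)
qed

text \<open>\<open>Q False\<close> accumulates at the axis, and the left is already taken by
  \<open>Q True\<close>, so it accumulates from the right; a segment carries this to any other point
  of the axis.\<close>

lemma near_right:
  assumes y: "y \<in> geod_axis h"
  obtains \<delta> where "\<delta> > 0" "\<And>w. w \<in> N \<Longrightarrow> dist w y < \<delta> \<Longrightarrow> lor w (Xzero h) < 0 \<Longrightarrow> w \<in> Q False"
proof -
  obtain z where z: "z \<in> geod_axis h" "z \<in> closure (Q False)" by (rule Q_accumulates)
  obtain d where d: "d > 0" "\<And>w. w \<in> N \<Longrightarrow> dist w z < d \<Longrightarrow> lor w (Xzero h) > 0 \<Longrightarrow> w \<in> Q True"
    using near_left[OF z(1)] by metis
  obtain \<delta> where \<delta>: "\<delta> > 0" "\<And>w w' s t. w \<in> N \<Longrightarrow> w' \<in> N \<Longrightarrow> dist w y < \<delta> \<Longrightarrow> dist w' z < \<delta> \<Longrightarrow>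
    s * lor w (Xzero h) > 0 \<Longrightarrow> s * lor w' (Xzero h) \<ge> 0 \<Longrightarrow> 0 \<le> t \<Longrightarrow> t < 1 \<Longrightarrow> hseg w w' t \<in> N - L"
    using side_segment[OF y z(1)] by metis
  have "min d \<delta> > 0" using d \<delta> by simp
  then obtain v where v: "v \<in> Q False" "dist v z < min d \<delta>" using z(2) by (meson closure_approachable)
  note off = Q_off[OF v(1)]
  have "v \<notin> Q True" using v Q_disjoint by blast
  then have vn: "lor v (Xzero h) < 0" using d(2)[of v] off v by fastforce
  show ?thesis
  proof (rule that[OF \<delta>(1)])
    fix w assume w: "w \<in> N" "dist w y < \<delta>" "lor w (Xzero h) < 0"
    let ?T = "hseg w v ` {0..1}"
    have H: "w \<in> H2" "v \<in> H2" using w off N_H2 by auto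
    have "?T \<subseteq> N - L"
    proof
      fix u assume "u \<in> ?T"
      then obtain t where t: "0 \<le> t" "t \<le> 1" "u = hseg w v t" by auto
      show "u \<in> N - L"
      proof (cases "t = 1")
        case True
        then show ?thesis using t hseg_ends(2)[OF H(2)] off by simp
      next
        case False
        then show ?thesis using \<delta>(2)[of w v "-1" t] w off v vn t by simp
      qed
    qed
    moreover have "connected ?T" using off w by (intro connected_hseg) auto
    moreover have "v \<in> ?T" "w \<in> ?T" using hseg_ends H by (force intro: image_eqI[of _ _ 1] image_eqI[of _ _ 0])+
    ultimately show "w \<in> Q False" using Q_connected v(1) by blast
  qed
qed

lemma near_axis:
  assumes k: "k \<in> conjs G h" and y: "y \<in> geod_axis k"
  obtains \<delta> where "\<delta> > 0" "\<And>w. w \<in> N \<Longrightarrow> dist w y < \<delta> \<Longrightarrow> lor w (Xzero k) > 0 \<Longrightarrow> w \<in> Q True"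
    "\<And>w. w \<in> N \<Longrightarrow> dist w y < \<delta> \<Longrightarrow> lor w (Xzero k) < 0 \<Longrightarrow> w \<in> Q False"
proof -
  obtain x where x: "x \<in> G" "Xzero k = x *v Xzero h" "geod_axis k = (\<lambda>z. x *v z) ` geod_axis h"
    using k by (elim conjsE)
  note X = ladj_vec[OF G_SO21[OF x(1)]]
  obtain y0 where y0: "y0 \<in> geod_axis h" "y = x *v y0" using x y by auto
  obtain d1 where d1: "d1 > 0" "\<And>w. w \<in> N \<Longrightarrow> dist w y0 < d1 \<Longrightarrow> lor w (Xzero h) > 0 \<Longrightarrow> w \<in> Q True"
    using near_left[OF y0(1)] by metis
  obtain d2 where d2: "d2 > 0" "\<And>w. w \<in> N \<Longrightarrow> dist w y0 < d2 \<Longrightarrow> lor w (Xzero h) < 0 \<Longrightarrow> w \<in> Q False"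
    using near_right[OF y0(1)] by metis
  have "isCont (\<lambda>v. ladj x *v v) y" by (intro linear_continuous_at matrix_vector_mul_bounded_linear)
  then obtain \<delta> where \<delta>: "\<delta> > 0" "\<And>w. dist w y < \<delta> \<Longrightarrow> dist (ladj x *v w) (ladj x *v y) < min d1 d2"
    using d1 d2 unfolding continuous_at_eps_delta by (metis min_less_iff_conj)
  have y0': "ladj x *v y = y0" using y0 X by simp
  have bk: "w \<in> Q i" if "ladj x *v w \<in> Q i" for w i using Q_invariant[OF x(1) that] X by simp
  have inN: "ladj x *v w \<in> N" if "w \<in> N" for w by (rule N_invariant[OF G_ladj[OF x(1)] that])
  have lk: "lor w (Xzero k) = lor (ladj x *v w) (Xzero h)" for w unfolding x(2) by (simp add: lor_ladj)
  show ?thesis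
  proof (rule that[OF \<delta>(1)])
    fix w assume "w \<in> N" "dist w y < \<delta>" "lor w (Xzero k) > 0"
    then show "w \<in> Q True" using bk d1(2)[OF inN] \<delta>(2)[of w] y0' lk by simp
  next
    fix w assume "w \<in> N" "dist w y < \<delta>" "lor w (Xzero k) < 0"
    then show "w \<in> Q False" using bk d2(2)[OF inN] \<delta>(2)[of w] y0' lk by simp
  qed
qed

end

section \<open>The cocycle along a closed geodesic\<close>

text \<open>Jumps compare values on the two sides of a point of \<open>T\<close>, leaving the value
  at the point free; this matters because \<open>height\<close> has no meaning on the lifts.\<close>

lemma sum_of_jumps:
  fixes f j :: "real \<Rightarrow> real"
  assumes "finite T" "a \<le> b" "T \<subseteq> {a<..<b}"
    and "\<And>s t. a \<le> s \<Longrightarrow> s \<le> t \<Longrightarrow> t \<le> b \<Longrightarrow> {s..t} \<inter> T = {} \<Longrightarrow> f s = f t"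
    and "\<And>\<tau>. \<tau> \<in> T \<Longrightarrow> \<exists>\<epsilon>>0. \<forall>s t. \<tau> - \<epsilon> < s \<and> s < \<tau> \<and> \<tau> < t \<and> t < \<tau> + \<epsilon> \<longrightarrow> f t - f s = j \<tau>"
  shows "f b - f a = (\<Sum>\<tau>\<in>T. j \<tau>)"
  using assms
proof (induction T arbitrary: b rule: finite_linorder_max_induct)
  case empty
  then show ?case using empty(3)[of a b] by simp
next
  case (insert m A)
  obtain \<epsilon> where \<epsilon>: "\<epsilon> > 0" "\<And>s t. m - \<epsilon> < s \<Longrightarrow> s < m \<Longrightarrow> m < t \<Longrightarrow> t < m + \<epsilon> \<Longrightarrow> f t - f s = j m"
    using insert.prems(4)[of m] by blast
  have m: "a < m" "m < b" using insert.prems by auto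
  \<comment> \<open>\<open>b'\<close> has to lie beyond all other jumps and inside the window in
    which the jump at \<open>m\<close> is controlled.\<close>
  let ?A = "insert a (insert (m - \<epsilon>) A)"
  have "Max ?A < m" using insert.hyps m \<epsilon> by (subst Max_less_iff) auto
  then obtain b' where b': "Max ?A < b'" "b' < m" using dense by blast
  then have low: "a < b'" "m - \<epsilon> < b'" "\<And>x. x \<in> A \<Longrightarrow> x < b'" using insert.hyps by (auto simp: Max_less_iff)
  obtain t where t: "m < t" "t < min b (m + \<epsilon>)" using dense[of m "min b (m + \<epsilon>)"] m \<epsilon> by auto
  have "f b' - f a = (\<Sum>\<tau>\<in>A. j \<tau>)"
  proof (rule insert.IH)
    show "A \<subseteq> {a<..<b'}" using low insert.prems by auto
    show "f s = f t" if "a \<le> s" "s \<le> t" "t \<le> b'" "{s..t} \<inter> A = {}" for s t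
      using insert.prems(3)[of s t] that b' m by auto
  qed (use low insert.prems in auto)
  moreover have "f t - f b' = j m" using \<epsilon>(2)[of b' t] low b' t by simp
  moreover have "f t = f b" using insert.prems(3)[of t b] t m insert.hyps by fastforce
  ultimately show ?case using insert.hyps by auto
qed

lemma path_component_image_interval:
  fixes f :: "real \<Rightarrow> 'a::topological_space"
  assumes "continuous_on {a..b} f" "f ` {a..b} \<subseteq> S" "s \<in> {a..b}" "t \<in> {a..b}"
  shows "path_component S (f s) (f t)"
proof -
  have "path_connected (f ` {a..b})"
    by (intro path_connected_continuous_image assms convex_imp_path_connected) simp
  then have "path_component (f ` {a..b}) (f s) (f t)" using assms(3,4) by (auto simp: path_connected_component)
  then show ?thesis using assms(2) path_component_of_subset by blast
qed

section \<open>The step function whose coboundary is the cocycle\<close>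

locale twisted_loop = separating_loop +
  fixes z0 :: "real^3" and u :: "real^3^3 \<Rightarrow> real^3"
  assumes z0: "z0 \<in> geod_axis h"
    and twist: "affine_twist G (subsurface_group G z0 S1) (subsurface_group G z0 S2) h u"
begin

text \<open>The value of the step function at \<open>z0\<close> seen from side \<open>i\<close>; on
  the group of that side the cocycle is the coboundary of this vector.\<close>

definition off :: "bool \<Rightarrow> real^3" where "off i = (if i then Xzero h else 0)"

text \<open>The cocycle is the coboundary of a vector-valued function on the complement of the lifts,
  constant on each complementary region; \<open>dev w i v\<close> means that this function has the value \<open>v\<close> on
  the region of type \<open>i\<close> (\<open>True\<close> for \<open>S2\<close>) with \<open>w\<close> in its closure.\<close>

definition dev :: "real^3 \<Rightarrow> bool \<Rightarrow> real^3 \<Rightarrow> bool"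
  where "dev w i v \<longleftrightarrow> (\<exists>x\<in>G. path_component (P i) (x *v z0) w \<and> v = u x + x *v off i)"

lemma u_mult: "x \<in> G \<Longrightarrow> y \<in> G \<Longrightarrow> u (x ** y) = x *v u y + u x"
  using twist by (simp add: affine_twist_def cocycle_def)

lemma u_side:
  assumes "x \<in> G" "path_component (P i) z0 (x *v z0)" shows "u x = off i - x *v off i"
proof -
  have "x \<in> subsurface_group G z0 (if i then S2 else S1)"
    using assms unfolding subsurface_group_def path_component_def P_def by blast
  then show ?thesis using twist by (auto simp: affine_twist_def off_def split: if_splits)
qed

lemma path_component_translate:
  assumes "x \<in> G" "path_component (P i) a b" shows "path_component (P i) (x *v a) (x *v b)"
proof -
  obtain g where g: "path g" "path_image g \<subseteq> P i" "pathstart g = a" "pathfinish g = b"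
    using assms(2) by (auto simp: path_component_def)
  have "continuous_on (path_image g) (\<lambda>v. x *v v)"
    by (intro linear_continuous_on matrix_vector_mul_bounded_linear)
  then have "path ((\<lambda>v. x *v v) \<circ> g)" by (rule path_continuous_image[OF g(1)])
  moreover have "path_image ((\<lambda>v. x *v v) \<circ> g) \<subseteq> P i"
    using g(2) P_invariant[OF assms(1)] by (auto simp: path_image_compose)
  ultimately show ?thesis unfolding path_component_def using g(3,4)
    by (intro exI[of _ "(\<lambda>v. x *v v) \<circ> g"]) (simp add: pathstart_compose pathfinish_compose)
qed

text \<open>Two translates of \<open>z0\<close> in one component differ by an element of the group
  of that side, where \<open>u\<close> is known; the cocycle identity then equates the two
  values.\<close>

lemma dev_unique:
  assumes "dev w i v" "dev w i v'" shows "v = v'"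
proof -
  obtain x where x: "x \<in> G" "path_component (P i) (x *v z0) w" "v = u x + x *v off i"
    using assms(1) by (auto simp: dev_def)
  obtain y where y: "y \<in> G" "path_component (P i) (y *v z0) w" "v' = u y + y *v off i"
    using assms(2) by (auto simp: dev_def)
  let ?g = "ladj x ** y"
  have g: "?g \<in> G" using x y G_mult G_ladj by blast
  have "path_component (P i) (x *v z0) (y *v z0)"
    using path_component_trans[OF x(2) path_component_sym[OF y(2)]] .
  from path_component_translate[OF G_ladj[OF x(1)] this]
  have "path_component (P i) z0 (?g *v z0)"
    by (simp add: ladj_mult[OF G_SO21[OF x(1)]] matrix_vector_mul_assoc)
  then have ug: "u ?g = off i - ?g *v off i" by (rule u_side[OF g])
  have xg: "x ** ?g = y" by (simp add: matrix_mul_assoc ladj_mult[OF G_SO21[OF x(1)]])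
  have "u y = x *v u ?g + u x" using u_mult[OF x(1) g] xg by simp
  also have "\<dots> = x *v off i - y *v off i + u x"
    unfolding ug by (simp add: matrix_vector_mult_diff_distrib matrix_vector_mul_assoc xg)
  finally show ?thesis using x y by simp
qed

lemma dev_transport: "dev w i v \<Longrightarrow> path_component (P i) w w' \<Longrightarrow> dev w' i v"
  unfolding dev_def using path_component_trans by blast

lemma dev_translate:
  assumes "y \<in> G" "dev w i v" shows "dev (y *v w) i (u y + y *v v)"
proof -
  obtain x where x: "x \<in> G" "path_component (P i) (x *v z0) w" "v = u x + x *v off i"
    using assms(2) by (auto simp: dev_def)
  have "path_component (P i) ((y ** x) *v z0) (y *v w)"
    using path_component_translate[OF assms(1) x(2)] by (simp add: matrix_vector_mul_assoc)
  moreover have "u y + y *v v = u (y ** x) + (y ** x) *v off i"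
    unfolding x(3) u_mult[OF assms(1) x(1)] by (simp add: matrix_vector_right_distrib matrix_vector_mul_assoc)
  ultimately show ?thesis unfolding dev_def using G_mult[OF assms(1) x(1)] by blast
qed

text \<open>Both types apply on a lift, and their values differ by \<open>x *v Xzero h\<close>, the
  vector \<open>Xzero\<close> of the conjugate of \<open>h\<close> by \<open>x\<close>. This is the
  source of the jumps.\<close>

lemma dev_axis:
  assumes "x \<in> G" "w \<in> geod_axis h" shows "dev (x *v w) i (u x + x *v off i)"
proof -
  have "path_connected (geod_axis h)" unfolding geod_axis_def
    by (intro path_connected_continuous_image continuous_on_axis_path) simp
  then have "path_component (geod_axis h) z0 w" using z0 assms(2) by (simp add: path_connected_component)
  then have "path_component (P i) z0 w" using axis_P path_component_of_subset by blast
  then show ?thesis unfolding dev_def using path_component_translate assms(1) by blast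
qed

lemma L_P: "w \<in> L \<Longrightarrow> w \<in> P i"
  using axis_P P_invariant unfolding L_iff by blast

text \<open>Going straight from \<open>w\<close> towards \<open>z0\<close>, the first lift met is a
  translate of the axis of \<open>h\<close>, where \<open>dev_axis\<close> supplies a value; up to
  there the segment stays in \<open>Q i\<close>.\<close>

lemma dev_exists:
  assumes w: "w \<in> Q i" shows "\<exists>v. dev w i v"
proof -
  have wN: "w \<in> N" "w \<notin> L" using Q_off(1)[OF w] by auto
  have z0N: "z0 \<in> N" "z0 \<in> L" using z0 axis_h_N h_conjs by (auto simp: L_def)
  have H: "w \<in> H2" "z0 \<in> H2" using wN z0N N_H2 by auto
  let ?f = "hseg w z0"
  have cont: "continuous_on {0..1} ?f" by (rule continuous_on_hseg[OF H])
  define T where "T = {t \<in> {0..1}. ?f t \<in> L}"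
  have "closed T" unfolding T_def
    using continuous_closed_preimage[OF cont _ closed_L] by (simp add: vimage_def Int_def)
  moreover have "1 \<in> T" using z0N hseg_ends(2)[OF H(2)] by (simp add: T_def)
  moreover have bdd: "bdd_below T" by (auto simp: T_def intro: bdd_belowI[of _ 0])
  ultimately have t0: "Inf T \<in> T" by (intro closed_contains_Inf) auto
  define t0 where "t0 = Inf T"
  have t: "t0 \<in> T" "0 \<le> t0" "t0 \<le> 1" using t0 by (auto simp: t0_def T_def)
  have "t0 \<noteq> 0" using t wN hseg_ends(1)[OF H(1), of z0] by (auto simp: T_def)
  have before: "?f s \<in> N - L" if "0 \<le> s" "s < t0" for s
  proof -
    have "s \<notin> T" using that(2) cInf_lower[OF _ bdd] unfolding t0_def by fastforce
    then show ?thesis using hseg_convex[OF N_convex wN(1) z0N(1), of s] that t by (simp add: T_def)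
  qed
  have "?f ` {0..<t0} \<subseteq> Q i"
  proof (rule Q_connected)
    show "connected (?f ` {0..<t0})" using t by (intro connected_hseg wN z0N) auto
    show "?f ` {0..<t0} \<subseteq> N - L" using before by auto
    have "w \<in> ?f ` {0..<t0}" using t \<open>t0 \<noteq> 0\<close> hseg_ends(1)[OF H(1), of z0] by (intro image_eqI[of _ _ 0]) auto
    then show "?f ` {0..<t0} \<inter> Q i \<noteq> {}" using w by blast
  qed
  moreover have tL: "?f t0 \<in> L" using t by (simp add: T_def)
  ultimately have "?f ` {0..t0} \<subseteq> P i"
    using Q_P L_P by (fastforce simp: less_le)
  moreover have "continuous_on {0..t0} ?f" using t by (intro continuous_on_subset[OF cont]) auto
  ultimately have "path_component (P i) (?f t0) (?f 0)" using t by (intro path_component_image_interval[of 0 t0 ?f]) auto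
  moreover obtain x y where "x \<in> G" "y \<in> geod_axis h" "?f t0 = x *v y" using tL by (auto simp: L_iff)
  ultimately show ?thesis using dev_axis[of x y i] dev_transport hseg_ends(1)[OF H(1), of z0] by metis
qed

lemma dev_type:
  assumes "dev w i v" "w \<in> Q j" shows "i = j"
proof -
  have "w \<in> P i" using assms(1) path_component_mem(2) by (auto simp: dev_def)
  then show ?thesis using assms(2) P_disjoint[of i] by (cases i; cases j) auto
qed

end

section \<open>The step function along the axis of \<sigma>\<close>

locale twisted_geodesic = twisted_loop +
  fixes \<sigma> :: "real^3^3"
  assumes \<sigma>_G: "\<sigma> \<in> G" and \<sigma>_ne: "\<sigma> \<noteq> mat 1"
begin

lemma \<sigma>_hyperbolic: "hyperbolic \<sigma>"
  using G_hyperbolic \<sigma>_G \<sigma>_ne by blast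

abbreviation "c \<equiv> axis_path \<sigma>"

lemma c_N: "c s \<in> N"
  using axis_N[OF \<sigma>_G \<sigma>_ne] by (auto simp: geod_axis_def)

lemma lor_\<sigma>: "lor (\<sigma> *v v) (Xzero \<sigma>) = lor v (Xzero \<sigma>)"
proof -
  have "\<sigma> *v Xzero \<sigma> = Xzero \<sigma>" using hyperbolic_frame[OF \<sigma>_hyperbolic] by (simp add: hframe_def)
  then show ?thesis using SO21_lor[OF G_SO21[OF \<sigma>_G], of v "Xzero \<sigma>"] by simp
qed

text \<open>Meaningful only off \<open>L\<close>: on a lift the two types may give different
  values.\<close>

definition height :: "real \<Rightarrow> real"
  where "height s = (THE r. \<exists>i v. dev (c s) i v \<and> r = lor v (Xzero \<sigma>))"

lemma height_eq:
  assumes "dev (c s) i v" "c s \<notin> L" shows "height s = lor v (Xzero \<sigma>)"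
  unfolding height_def
proof (rule the_equality)
  show "\<exists>i va. dev (c s) i va \<and> lor v (Xzero \<sigma>) = lor va (Xzero \<sigma>)" using assms(1) by blast
  fix r assume "\<exists>i v. dev (c s) i v \<and> r = lor v (Xzero \<sigma>)"
  then obtain j v' where j: "dev (c s) j v'" "r = lor v' (Xzero \<sigma>)" by blast
  have "c s \<in> Q False \<union> Q True" using Q_union c_N assms(2) by blast
  then have "i = j" using dev_type[OF assms(1)] dev_type[OF j(1)] by blast
  then show "r = lor v (Xzero \<sigma>)" using dev_unique j assms(1) by blast
qed

lemma height_exists:
  assumes "c s \<notin> L" obtains i v where "dev (c s) i v" "c s \<in> Q i" "height s = lor v (Xzero \<sigma>)"
proof -
  have "c s \<in> Q False \<union> Q True" using Q_union c_N assms by blast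
  then obtain i where i: "c s \<in> Q i" by blast
  then show ?thesis using that dev_exists height_eq assms by blast
qed

lemma height_const:
  assumes "s \<le> t" "\<And>r. s \<le> r \<Longrightarrow> r \<le> t \<Longrightarrow> c r \<notin> L" shows "height s = height t"
proof -
  have st: "c s \<notin> L" "c t \<notin> L" using assms by auto
  obtain i v where v: "dev (c s) i v" "c s \<in> Q i" "height s = lor v (Xzero \<sigma>)"
    using height_exists[OF st(1)] by blast
  have "c ` {s..t} \<subseteq> Q i"
  proof (rule Q_connected)
    show "connected (c ` {s..t})" by (intro connected_continuous_image continuous_on_axis_path) simp
    show "c ` {s..t} \<subseteq> N - L" using c_N assms(2) by auto
    have "c s \<in> c ` {s..t}" using assms(1) by simp
    then show "c ` {s..t} \<inter> Q i \<noteq> {}" using v(2) by blast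
  qed
  then have "c ` {s..t} \<subseteq> P i" using Q_P by blast
  then have "path_component (P i) (c s) (c t)"
    using assms(1) continuous_on_axis_path by (intro path_component_image_interval) auto
  then have "dev (c t) i v" by (rule dev_transport[OF v(1)])
  then show ?thesis using height_eq[OF _ st(2)] v(3) by simp
qed

lemma c_translate: "c (s + tlen \<sigma>) = \<sigma> *v c s"
  using axis_path_mv[OF \<sigma>_hyperbolic] by simp

lemma L_translate: "c (s + tlen \<sigma>) \<in> L \<longleftrightarrow> c s \<in> L"
proof -
  have "x *v z \<in> L" if "x \<in> G" "z \<in> L" for x z
    using that G_mult unfolding L_iff by (metis matrix_vector_mul_assoc)
  from this[OF \<sigma>_G, of "c s"] this[OF G_ladj[OF \<sigma>_G], of "\<sigma> *v c s"]
  show ?thesis unfolding c_translate ladj_vec[OF G_SO21[OF \<sigma>_G]] by blast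
qed

text \<open>\<open>\<sigma>\<close> fixes \<open>Xzero \<sigma>\<close>, so pairing with it removes
  the linear part of the affine action in \<open>dev_translate\<close> and leaves the translation
  \<open>u \<sigma>\<close>.\<close>

lemma height_period:
  assumes "c s \<notin> L" shows "height (s + tlen \<sigma>) - height s = lor (u \<sigma>) (Xzero \<sigma>)"
proof -
  obtain i v where v: "dev (c s) i v" "height s = lor v (Xzero \<sigma>)"
    using height_exists[OF assms] by blast
  have "dev (c (s + tlen \<sigma>)) i (u \<sigma> + \<sigma> *v v)"
    unfolding c_translate by (rule dev_translate[OF \<sigma>_G v(1)])
  then have "height (s + tlen \<sigma>) = lor (u \<sigma> + \<sigma> *v v) (Xzero \<sigma>)"
    using height_eq L_translate assms by blast
  then show ?thesis using v(2) by (simp add: lor_simps lor_\<sigma>)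
qed

text \<open>The same \<open>v\<close>, the pairing of \<open>u x\<close>, serves both sides, and the
  left side adds that of \<open>Xzero k\<close>. Since \<open>lor (c s) (Xzero k)\<close> is
  \<open>sinh (s - \<tau>)\<close> times its slope at the crossing, the sign of the product in the
  condition decides the side.\<close>

lemma height_near_crossing:
  assumes k: "k \<in> conjs G h" "c \<tau> \<in> geod_axis k" "geod_axis k \<noteq> geod_axis \<sigma>"
  obtains \<epsilon> v where "\<epsilon> > 0" "\<And>s. s \<noteq> \<tau> \<Longrightarrow> \<bar>s - \<tau>\<bar> < \<epsilon> \<Longrightarrow>
    height s = v + (if (s - \<tau>) * lor (axis_dir \<sigma> \<tau>) (Xzero k) > 0 then lor (Xzero k) (Xzero \<sigma>) else 0)"
proof -
  obtain x where x: "x \<in> G" "hyperbolic k" "Xzero k = x *v Xzero h" "geod_axis k = (\<lambda>z. x *v z) ` geod_axis h"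
    using k(1) by (elim conjsE)
  let ?d = "lor (axis_dir \<sigma> \<tau>) (Xzero k)"
  have d: "?d \<noteq> 0" using axis_crossing_unique[OF \<sigma>_hyperbolic x(2) k(2)] k(3) by blast
  obtain \<delta> where \<delta>: "\<delta> > 0" "\<And>w. w \<in> N \<Longrightarrow> dist w (c \<tau>) < \<delta> \<Longrightarrow> lor w (Xzero k) > 0 \<Longrightarrow> w \<in> Q True"
    "\<And>w. w \<in> N \<Longrightarrow> dist w (c \<tau>) < \<delta> \<Longrightarrow> lor w (Xzero k) < 0 \<Longrightarrow> w \<in> Q False"
    using near_axis[OF k(1,2)] by blast
  have "isCont c \<tau>" using continuous_on_axis_path[of UNIV \<sigma>] by (simp add: continuous_on_eq_continuous_at)
  then obtain \<epsilon> where \<epsilon>: "\<epsilon> > 0" "\<And>s. dist s \<tau> < \<epsilon> \<Longrightarrow> dist (c s) (c \<tau>) < \<delta>"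
    using \<delta>(1) unfolding continuous_at_eps_delta by blast
  have lk: "lor (c s) (Xzero k) = sinh (s - \<tau>) * ?d" for s
    using axis_path_add[of \<sigma> \<tau> "s - \<tau>"] geod_axis_eq[OF x(2)] k(2) by (simp add: lor_simps)
  have inQ: "c s \<in> Q ((s - \<tau>) * ?d > 0)" if "s \<noteq> \<tau>" "\<bar>s - \<tau>\<bar> < \<epsilon>" for s
  proof (cases "(s - \<tau>) * ?d > 0")
    case True
    then have "lor (c s) (Xzero k) > 0" unfolding lk by (simp add: zero_less_mult_iff)
    then show ?thesis using True \<delta>(2)[OF c_N \<epsilon>(2)] that by (simp add: dist_real_def)
  next
    case False
    then have "(s - \<tau>) * ?d < 0" using that d by (simp add: less_le)
    then have "lor (c s) (Xzero k) < 0" unfolding lk by (simp add: mult_less_0_iff)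
    then show ?thesis using False \<delta>(3)[OF c_N \<epsilon>(2)] that by (simp add: dist_real_def)
  qed
  have kL: "c \<tau> \<in> L" using k by (auto simp: L_def)
  show ?thesis
  proof (rule that[OF \<epsilon>(1)])
    fix s assume s: "s \<noteq> \<tau>" "\<bar>s - \<tau>\<bar> < \<epsilon>"
    let ?i = "(s - \<tau>) * ?d > 0"
    obtain y where "y \<in> geod_axis h" "c \<tau> = x *v y" using k(2) x(4) by auto
    then have "dev (c \<tau>) ?i (u x + x *v off ?i)" using dev_axis[OF x(1)] by metis
    moreover have "c ` {min s \<tau>..max s \<tau>} \<subseteq> P ?i"
    proof safe
      fix r assume r: "r \<in> {min s \<tau>..max s \<tau>}"
      show "c r \<in> P ?i"
      proof (cases "r = \<tau>")
        case True
        then show ?thesis using L_P[OF kL] by blast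
      next
        case False
        then have eq: "((r - \<tau>) * ?d > 0) = ?i" using r s(1) by (auto simp: zero_less_mult_iff)
        have "\<bar>r - \<tau>\<bar> < \<epsilon>" using r s(2) by auto
        from inQ[OF False this] have "c r \<in> Q ?i" unfolding eq .
        then show ?thesis using Q_P by blast
      qed
    qed
    then have "path_component (P ?i) (c \<tau>) (c s)"
      by (intro path_component_image_interval[of "min s \<tau>" "max s \<tau>"] continuous_on_axis_path) auto
    ultimately have "dev (c s) ?i (u x + x *v off ?i)" by (rule dev_transport)
    moreover have "c s \<notin> L" using inQ[OF s] Q_off(1) by blast
    ultimately have "height s = lor (u x + x *v off ?i) (Xzero \<sigma>)" by (rule height_eq)
    then show "height s = lor (u x) (Xzero \<sigma>) + (if ?i then lor (Xzero k) (Xzero \<sigma>) else 0)"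
      by (auto simp: off_def x(3) lor_simps)
  qed
qed

text \<open>The path runs inside one lift, where the value of type \<open>False\<close> is constant;
  translation by \<open>\<sigma>\<close> must reproduce it. No crossings occur because distinct
  lifts are disjoint.\<close>

lemma lor_u_axis_in_L:
  assumes "k \<in> conjs G h" "geod_axis k = geod_axis \<sigma>"
  shows "lor (u \<sigma>) (Xzero \<sigma>) = 0" "crossings G h \<sigma> = {}"
proof -
  obtain x where x: "x \<in> G" "geod_axis k = (\<lambda>z. x *v z) ` geod_axis h"
    using assms(1) by (elim conjsE)
  have dv: "dev (c s) False (u x + x *v off False)" for s
  proof -
    have "c s \<in> geod_axis k" using assms(2) by (auto simp: geod_axis_def)
    then show ?thesis using dev_axis[OF x(1)] x(2) by auto
  qed
  have "dev (c (0 + tlen \<sigma>)) False (u \<sigma> + \<sigma> *v (u x + x *v off False))"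
    unfolding c_translate by (rule dev_translate[OF \<sigma>_G dv])
  then have "u \<sigma> + \<sigma> *v (u x + x *v off False) = u x + x *v off False" using dev_unique dv by blast
  from arg_cong[OF this, of "\<lambda>v. lor v (Xzero \<sigma>)"]
  show "lor (u \<sigma>) (Xzero \<sigma>) = 0" by (simp only: lor_add_left lor_\<sigma>)
  show "crossings G h \<sigma> = {}"
    using simple_axes[OF simple assms(1)] assms(2) unfolding crossings_conjs geod_axis_def[of \<sigma>] by blast
qed

lemma lor_u_eq_sum:
  assumes gm: "gm_identification \<rho> J"
  shows "lor (u \<sigma>) (Xzero \<sigma>) = (\<Sum>(s, k)\<in>crossings G h \<sigma>. cos (crossing_angle k \<sigma> (c s)))"
proof (cases "\<exists>k\<in>conjs G h. geod_axis k = geod_axis \<sigma>")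
  case True
  then show ?thesis using lor_u_axis_in_L by auto
next
  case False
  let ?l = "tlen \<sigma>"
  have l: "?l > 0" by (rule tlen_pos[OF \<sigma>_hyperbolic])
  have transversal: "geod_axis k \<noteq> geod_axis \<sigma>" if "k \<in> conjs G h" for k using False that by blast
  \<comment> \<open>The lift through a point of the path is unique, by simplicity and
    \<open>conjs_eqI\<close>, so a crossing is determined by its parameter.\<close>
  define K where "K = (\<lambda>\<tau>. SOME k. k \<in> conjs G h \<and> c \<tau> \<in> geod_axis k)"
  have K: "K \<tau> \<in> conjs G h" "c \<tau> \<in> geod_axis (K \<tau>)" if "c \<tau> \<in> L" for \<tau>
    using that someI_ex[of "\<lambda>k. k \<in> conjs G h \<and> c \<tau> \<in> geod_axis k"] by (auto simp: L_def K_def)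
  have K_unique: "k = K \<tau>" if "k \<in> conjs G h" "c \<tau> \<in> geod_axis k" for k \<tau>
  proof -
    have "c \<tau> \<in> L" using that by (auto simp: L_def)
    then show ?thesis using conjs_eqI[OF gm that(1) K(1)] simple_axes[OF simple that(1) K(1) that(2) K(2)] by blast
  qed
  define j where "j = (\<lambda>\<tau>. cos (crossing_angle (K \<tau>) \<sigma> (c \<tau>)))"
  define T where "T = {\<tau>. c \<tau> \<in> L}"
  have fin: "finite (T \<inter> {a..b})" for a b
  proof -
    have "T \<inter> {a..b} \<subseteq> fst ` {(s, k). a \<le> s \<and> s \<le> b \<and> k \<in> conjs G h \<and> c s \<in> geod_axis k \<and> geod_axis k \<noteq> geod_axis \<sigma>}"
      using K transversal by (force simp: T_def)
    then show ?thesis using finite_crossing_params[OF \<sigma>_hyperbolic] finite_surj by blast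
  qed
  \<comment> \<open>A crossing may sit at parameter 0 itself. Starting the period slightly earlier
    keeps its two ends free of crossings while containing the same ones as the half-open period from
    0.\<close>
  obtain a where a: "a < 0" "\<And>s. a \<le> s \<Longrightarrow> s < 0 \<Longrightarrow> s \<notin> T"
  proof -
    let ?A = "insert (-1) (T \<inter> {-1..0} - {0})"
    have f: "finite ?A" using fin by simp
    then have "Max ?A < 0" by (subst Max_less_iff) auto
    then obtain a where a: "Max ?A < a" "a < 0" using dense by blast
    have lt: "s < a" if "s \<in> ?A" for s using a(1) Max_ge[OF f that] by linarith
    show ?thesis
    proof (rule that[OF a(2)])
      fix s assume s: "a \<le> s" "s < 0"
      have "-1 < a" by (rule lt) simp
      then show "s \<notin> T" using lt[of s] s by auto
    qed
  qed
  have T_period: "s + ?l \<in> T \<longleftrightarrow> s \<in> T" for s using L_translate by (simp add: T_def)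
  have shift: "s \<notin> T" if "a + ?l \<le> s" "s < ?l" for s using a(2)[of "s - ?l"] T_period[of "s - ?l"] that by simp
  have Teq: "T \<inter> {a<..<a + ?l} = T \<inter> {0..<?l}"
    using a shift by (auto; smt (verit))
  have "height (a + ?l) - height a = (\<Sum>\<tau>\<in>T \<inter> {a<..<a + ?l}. j \<tau>)"
  proof (rule sum_of_jumps[where f = height])
    show "finite (T \<inter> {a<..<a + ?l})" by (rule finite_subset[OF _ fin[of a "a + ?l"]]) auto
    show "height s = height t" if "a \<le> s" "s \<le> t" "t \<le> a + ?l" "{s..t} \<inter> (T \<inter> {a<..<a + ?l}) = {}" for s t
    proof (rule height_const[OF that(2)])
      fix r assume r: "s \<le> r" "r \<le> t"
      have "r \<notin> T"
      proof (cases "r = a \<or> r = a + ?l")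
        case True
        then show ?thesis using a T_period[of a] by auto
      next
        case False
        then show ?thesis using that r by auto
      qed
      then show "c r \<notin> L" by (simp add: T_def)
    qed
    fix \<tau> assume "\<tau> \<in> T \<inter> {a<..<a + ?l}"
    then have \<tau>: "c \<tau> \<in> L" by (simp add: T_def)
    note k = K[OF \<tau>]
    have kh: "hyperbolic (K \<tau>)" using k(1) by (elim conjsE)
    let ?d = "lor (axis_dir \<sigma> \<tau>) (Xzero (K \<tau>))"
    have d: "?d \<noteq> 0" using axis_crossing_unique[OF \<sigma>_hyperbolic kh k(2)] transversal[OF k(1)] by blast
    obtain \<epsilon> v where \<epsilon>: "\<epsilon> > 0" "\<And>s. s \<noteq> \<tau> \<Longrightarrow> \<bar>s - \<tau>\<bar> < \<epsilon> \<Longrightarrow>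
      height s = v + (if (s - \<tau>) * ?d > 0 then lor (Xzero (K \<tau>)) (Xzero \<sigma>) else 0)"
      using height_near_crossing[OF k transversal[OF k(1)]] by blast
    have "height t - height s = j \<tau>" if "\<tau> - \<epsilon> < s" "s < \<tau>" "\<tau> < t" "t < \<tau> + \<epsilon>" for s t
    proof -
      \<comment> \<open>The sign of \<open>?d\<close> tells whether the path enters or leaves the
        left side, so the jump is the pairing of the normals with the very sign found in
        \<open>cos_crossing_angle\<close>.\<close>
      have "(t - \<tau>) * ?d > 0 \<longleftrightarrow> ?d > 0" "(s - \<tau>) * ?d > 0 \<longleftrightarrow> \<not> ?d > 0"
        using that d by (auto simp: zero_less_mult_iff)
      then show ?thesis unfolding j_def cos_crossing_angle[OF kh \<sigma>_hyperbolic k(2)]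
        using \<epsilon>(2)[of s] \<epsilon>(2)[of t] that by simp
    qed
    then show "\<exists>\<epsilon>>0. \<forall>s t. \<tau> - \<epsilon> < s \<and> s < \<tau> \<and> \<tau> < t \<and> t < \<tau> + \<epsilon> \<longrightarrow> height t - height s = j \<tau>"
      using \<epsilon>(1) by blast
  qed (use l in auto)
  moreover have "height (a + ?l) - height a = lor (u \<sigma>) (Xzero \<sigma>)"
    using height_period[of a] a by (simp add: T_def)
  moreover have "crossings G h \<sigma> = (\<lambda>\<tau>. (\<tau>, K \<tau>)) ` (T \<inter> {0..<?l})"
  proof
    show "crossings G h \<sigma> \<subseteq> (\<lambda>\<tau>. (\<tau>, K \<tau>)) ` (T \<inter> {0..<?l})"
      unfolding crossings_conjs using K_unique by (auto simp: T_def L_def)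
    show "(\<lambda>\<tau>. (\<tau>, K \<tau>)) ` (T \<inter> {0..<?l}) \<subseteq> crossings G h \<sigma>"
      unfolding crossings_conjs using K transversal by (auto simp: T_def)
  qed
  then have "(\<Sum>(s, k)\<in>crossings G h \<sigma>. cos (crossing_angle k \<sigma> (c s))) = (\<Sum>\<tau>\<in>T \<inter> {0..<?l}. j \<tau>)"
    by (simp add: sum.reindex inj_on_def j_def)
  ultimately show ?thesis unfolding Teq by simp
qed

end

theorem theorem1p2:
  fixes g b :: nat
    and G :: "(real^3^3) set"
    and \<sigma> h :: "real^3^3"
    and S1 S2 :: "(real^3) set set"
    and z0 :: "real^3"
    and u :: "real^3^3 \<Rightarrow> real^3"
    and \<rho> :: "real^2^2 \<Rightarrow> real^3^3"
    and J :: "real^3 \<Rightarrow> real^2^2"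
    and \<phi> :: "real \<Rightarrow> real^3^3 \<Rightarrow> real^3^3"
  assumes "b \<ge> 1"
    and "surface_group g b G"
    and "\<sigma> \<in> G" and "\<sigma> \<noteq> mat 1"
    and "h \<in> G" and "h \<noteq> mat 1" and "h \<noteq> \<sigma>"
    and "separates_into G h S1 S2"
    and "lies_left G h S2"
    and "z0 \<in> geod_axis h"
    and "affine_twist G (subsurface_group G z0 S1) (subsurface_group G z0 S2) h u"
    and "gm_identification \<rho> J"
    and "gm_deformation \<rho> J G u \<phi>"
  shows "((\<lambda>t. tlen (\<phi> t \<sigma>)) has_real_derivative
            2 * (\<Sum>(s, k)\<in>crossings G h \<sigma>. cos (crossing_angle k \<sigma> (axis_path \<sigma> s)))) (at 0)"
proof -
  obtain C1 C2 where C: "C1 \<noteq> C2"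
    "connected_components_of (subtopology (surface G) (topspace (surface G) - loop_image G h)) = {C1, C2}"
    "S1 = surface G closure_of C1" "S2 = surface G closure_of C2" and simple: "simple_loop G h"
    using assms(8) unfolding separates_into_def by blast
  have F: "subgroup G SO21" "discrete G" "\<And>x. x \<in> G \<Longrightarrow> x \<noteq> mat 1 \<Longrightarrow> hyperbolic x"
    using assms(2) unfolding surface_group_def by blast+
  interpret twisted_geodesic G h S1 S2 C1 C2 z0 u \<sigma>
    by unfold_locales (fact subgroup.subset[OF F(1)] subgroup.m_closed[OF F(1)]
      subgroup.one_closed[OF F(1)] subgroup.m_inv_closed[OF F(1)] F C simple assms)+
  obtain r :: "real \<Rightarrow> real^3" where r: "(\<lambda>t. norm (r t)) \<in> O[at 0](\<lambda>t. t^2)"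
    "\<forall>\<^sub>F t in at 0. \<phi> t \<sigma> = \<rho> (mexp (J (t *\<^sub>R u \<sigma> + r t))) ** \<sigma>"
    using assms(13) \<sigma>_G unfolding gm_deformation_def by blast
  \<comment> \<open>The bound on \<open>r\<close> concerns a punctured neighbourhood, so the value
    at 0 is set by hand to match \<open>\<phi> 0 \<sigma> = \<sigma>\<close>.\<close>
  define w where "w = (\<lambda>t. if t = 0 then 0 else t *\<^sub>R u \<sigma> + r t)"
  have w': "(w has_vector_derivative u \<sigma>) (at 0)"
  proof -
    obtain B where B: "\<forall>\<^sub>F t in at 0. norm (norm (r t)) \<le> B * norm (t\<^sup>2)"
      using r(1) by (auto elim: landau_o.bigE)
    have "((\<lambda>t. norm (w (0 + t) - w 0 - t *\<^sub>R u \<sigma>) / norm t) \<longlongrightarrow> 0) (at 0)"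
    proof (rule tendsto_sandwich[of "\<lambda>_. 0" _ _ "\<lambda>t. B * \<bar>t\<bar>"])
      show "\<forall>\<^sub>F t in at 0. norm (w (0 + t) - w 0 - t *\<^sub>R u \<sigma>) / norm t \<le> B * \<bar>t\<bar>"
        using B eventually_neq_at_within[of 0 0 UNIV]
      proof eventually_elim
        case (elim t)
        then have "norm (r t) \<le> (B * \<bar>t\<bar>) * \<bar>t\<bar>" by (simp add: power2_eq_square abs_mult)
        then show ?case using elim by (simp add: w_def divide_simps)
      qed
      have "((\<lambda>t. B * \<bar>t\<bar>) \<longlongrightarrow> B * \<bar>0\<bar>) (at (0::real))" by (intro tendsto_intros)
      then show "((\<lambda>t. B * \<bar>t\<bar>) \<longlongrightarrow> 0) (at (0::real))" by simp
    qed auto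
    then show ?thesis
      unfolding has_vector_derivative_def has_derivative_at by (simp add: bounded_linear_scaleR_left)
  qed
  have "((\<lambda>t. tlen (\<phi> t \<sigma>)) has_real_derivative 2 * lor (u \<sigma>) (Xzero \<sigma>)) (at 0)"
  proof (rule DERIV_tlen_deformation[OF assms(12) \<sigma>_hyperbolic w'])
    show "w 0 = 0" by (simp add: w_def)
    show "\<phi> t \<sigma> \<in> carrier SO21" for t
      using assms(13) \<sigma>_G unfolding gm_deformation_def hom_def by auto
    show "\<phi> 0 \<sigma> = \<sigma>" using assms(13) \<sigma>_G unfolding gm_deformation_def by blast
    show "\<forall>\<^sub>F t in at 0. \<phi> t \<sigma> = \<rho> (mexp (J (w t))) ** \<sigma>"
      using r(2) eventually_neq_at_within[of 0 0 UNIV] by eventually_elim (simp add: w_def)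
  qed
  then show ?thesis unfolding lor_u_eq_sum[OF assms(12)] .
qed

end
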